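(* Let $K\subset\mathbb{R}$ be a Cantor set and let $G$ be a finitely generated subgroup of $\mathfrak{diff}^{1+Lip}(K)$ which contains no free subsemigroup on two generators. Then the group $G$ is virtually abelian.
   Context: A Cantor set is a (nonempty) compact totally disconnected set each of whose points is an accumulation point. For a Cantor set $K\subset\mathbb{R}$, $\mathfrak{diff}^{1+Lip}(K)$ is the group (under composition) of homeomorphisms $f$ of $K$ such that for every $x\in K$ there exist an open interval $I\subset\mathbb{R}$ containing $x$ and a $C^1$-diffeomorphism $\tilde f:I\to\tilde f(I)\subset\mathbb{R}$ with $\log|\tilde f'|$ Lipschitz continuous on $I$ and $\tilde f_{|I\cap K}=f_{|I\cap K}$. A group is virtually abelian if it contains an abelian subgroup of finite index. *)

theory Defs
  imports "HOL-Analysis.Analysis" "HOL-Algebra.Bij" "HOL-Algebra.Coset"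
    "HOL-Algebra.Generated_Groups"
begin

definition totally_disconnected :: "'a::topological_space set \<Rightarrow> bool" where
  "totally_disconnected S \<longleftrightarrow> (\<forall>x\<in>S. connected_component_set S x = {x})"

definition cantor_set :: "'a::topological_space set \<Rightarrow> bool" where
  "cantor_set K \<longleftrightarrow>
     K \<noteq> {} \<and> compact K \<and> totally_disconnected K \<and> (\<forall>x\<in>K. x islimpt K)"

text \<open>A \<open>C\<^sup>1\<close>-diffeomorphism of \<open>I\<close> onto \<open>F ` I\<close>; intended for open intervals \<open>I\<close>, for
  which \<open>F ` I\<close> is open as well, so that the two-sided derivatives used by
  \<^const>\<open>C1_differentiable_on\<close> depend only on the values on \<open>I\<close> and on \<open>F ` I\<close>.\<close>

definition C1_diffeomorphism_on :: "real set \<Rightarrow> (real \<Rightarrow> real) \<Rightarrow> bool" where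
  "C1_diffeomorphism_on I F \<longleftrightarrow>
     (\<exists>H. homeomorphism I (F ` I) F H \<and>
          F C1_differentiable_on I \<and> H C1_differentiable_on (F ` I))"

text \<open>As in \<^const>\<open>BijGroup\<close>, a self-map of \<open>K\<close> is represented by the function that is
  \<^const>\<open>undefined\<close> outside \<open>K\<close>, so that equality of functions is equality of maps on \<open>K\<close>.\<close>

definition diff_1Lip :: "real set \<Rightarrow> (real \<Rightarrow> real) set" where
  "diff_1Lip K =
     {f \<in> Bij K. (\<exists>g. homeomorphism K K f g) \<and>
        (\<forall>x\<in>K. \<exists>I F. open I \<and> is_interval I \<and> x \<in> I \<and>
           C1_diffeomorphism_on I F \<and>
           (\<exists>L. lipschitz_on L I (\<lambda>t. ln \<bar>deriv F t\<bar>)) \<and>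
           (\<forall>t \<in> I \<inter> K. F t = f t))}"

definition diff_1Lip_group :: "real set \<Rightarrow> (real \<Rightarrow> real) monoid" where
  "diff_1Lip_group K = (BijGroup K)\<lparr>carrier := diff_1Lip K\<rparr>"

definition finitely_generated_group :: "('a, 'b) monoid_scheme \<Rightarrow> bool" where
  "finitely_generated_group G \<longleftrightarrow>
     (\<exists>S. finite S \<and> S \<subseteq> carrier G \<and> generate G S = carrier G)"

text \<open>The image of a word in two letters under the homomorphism that sends the letter
  \<^const>\<open>True\<close> to \<open>a\<close> and the letter \<^const>\<open>False\<close> to \<open>b\<close>.\<close>

definition eval_word :: "('a, 'b) monoid_scheme \<Rightarrow> 'a \<Rightarrow> 'a \<Rightarrow> bool list \<Rightarrow> 'a" where
  "eval_word G a b w = foldr (\<lambda>c y. (if c then a else b) \<otimes>\<^bsub>G\<^esub> y) w \<one>\<^bsub>G\<^esub>"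

text \<open>The free semigroup on two generators consists of the nonempty words.\<close>

definition contains_free_subsemigroup_2 :: "('a, 'b) monoid_scheme \<Rightarrow> bool" where
  "contains_free_subsemigroup_2 G \<longleftrightarrow>
     (\<exists>a\<in>carrier G. \<exists>b\<in>carrier G. inj_on (eval_word G a b) {w. w \<noteq> []})"

definition virtually_abelian :: "('a, 'b) monoid_scheme \<Rightarrow> bool" where
  "virtually_abelian G \<longleftrightarrow>
     (\<exists>H. subgroup H G \<and> comm_group (G\<lparr>carrier := H\<rparr>) \<and> finite (rcosets\<^bsub>G\<^esub> H))"

end

(* The regularity of G enters only through bounded distortion: near every point an element is
   monotone on K and changes ratios of lengths inside an interval of length r by a factor of at
   most exp (L * r).

   An infinite minimal set gives a free subsemigroup: follow one of its gaps along a path of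
   distinct gaps; as their lengths have a bounded sum, the distortion along the path is bounded and
   a fixed neighbourhood of an endpoint is contracted to arbitrarily small size.  By minimality two
   such contractions can be given disjoint images inside that neighbourhood.

   Hence every orbit accumulates at a finite orbit, and it suffices to see that the stabiliser of a
   point p of a finite orbit commutes near p.  In the absence of free subsemigroups an element with
   an attracting fixed point u on one side of an interval cannot be combined with an element that
   moves u into that interval.  So the elements whose fixed points accumulate at p form a normal
   subgroup N, and the quotient carries an Archimedean bi-invariant order, hence is abelian.  By
   Milnor's argument the conjugates of an element c of N under a contraction f outside N generate a
   finitely generated group M.  Far along the orbit of f the generators of M are too close to the
   identity to move a gap, while conjugation by f has bounded distortion; so M, and with it c, is
   trivial near p. *)
theory Submission
  imports Defs
begin

section \<open>Groups without free subsemigroups\<close>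

text \<open>Commutation near finite orbits suffices because the points with a neighbourhood on which
  some subgroup of finite index commutes form an open invariant set. Its complement in
  \<open>K\<close>, if nonempty, contains a minimal set; that set is finite, so its points have
  finite orbits after all. Compactness then leaves finitely many subgroups to intersect. The
  obstacle is uniformity: two elements whose germs commute at \<open>p\<close> do so on a
  neighbourhood depending on both. It is overcome by showing that each element of N is the identity
  on the whole interval of one contraction, and by applying this to commutators. Finite generation
  of M serves the same end: its generators share distortion constants, so one far image of an
  interval is small enough for all of them. If points fixed by all of G accumulate at
  \<open>p\<close>, then N is everything and no contraction exists; an interval between such points
  is then treated at the infimum of an orbit. As \<open>K\<close> is disconnected, intermediate
  values are replaced throughout by limits of monotone orbits.\<close>

context group
begin

lemma mult_inv_cancel:
  assumes "x \<in> carrier G" "y \<in> carrier G"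
  shows "x \<otimes> (inv x \<otimes> y) = y" "inv x \<otimes> (x \<otimes> y) = y"
  using assms by (simp_all add: m_assoc[symmetric])

lemma eval_word_closed:
  assumes "a \<in> carrier G" "b \<in> carrier G"
  shows "eval_word G a b w \<in> carrier G"
  using assms by (induction w) (auto simp: eval_word_def)

lemma eval_word_Cons:
  "eval_word G a b (c # w) = (if c then a else b) \<otimes> eval_word G a b w"
  by (simp add: eval_word_def)

lemma eval_word_snoc:
  assumes "a \<in> carrier G" "b \<in> carrier G"
  shows "eval_word G a b (w @ [c]) = eval_word G a b w \<otimes> (if c then a else b)"
proof (induction w)
  case Nil
  then show ?case using assms by (auto simp: eval_word_def)
next
  case (Cons d w)
  then show ?case using assms eval_word_closed[OF assms, of w]
    by (auto simp: eval_word_Cons m_assoc)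
qed

text \<open>Ping-pong for semigroups: whether a word sends \<open>C\<close> into \<open>A\<close> or
  into \<open>B\<close> reveals its first letter, which is then cancelled in the group.\<close>

lemma ping_pong_free:
  fixes act :: "'a \<Rightarrow> 'c \<Rightarrow> 'c"
  assumes ab: "a \<in> carrier G" "b \<in> carrier G"
    and one: "\<And>x. x \<in> C \<Longrightarrow> act \<one> x = x"
    and mult: "\<And>g h x. g \<in> carrier G \<Longrightarrow> h \<in> carrier G \<Longrightarrow> x \<in> C \<Longrightarrow> act (g \<otimes> h) x = act g (act h x)"
    and a: "\<And>x. x \<in> C \<Longrightarrow> act a x \<in> A" and b: "\<And>x. x \<in> C \<Longrightarrow> act b x \<in> B"
    and AB: "A \<subseteq> C" "B \<subseteq> C" "A \<inter> B = {}" and C: "C \<noteq> {}"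
  shows "contains_free_subsemigroup_2 G"
proof -
  let ?e = "eval_word G a b"
  have cl: "?e w \<in> carrier G" for w by (rule eval_word_closed[OF ab])
  have C_inv: "act (?e w) x \<in> C" if "x \<in> C" for w x
    using that
  proof (induction w)
    case Nil
    then show ?case by (simp add: eval_word_def one)
  next
    case (Cons c w)
    then show ?case using ab a b AB cl[of w] mult
      by (cases c) (auto simp: eval_word_Cons)
  qed
  have im: "act (?e (c # w)) x \<in> (if c then A else B)" if "x \<in> C" for c w x
    using C_inv[OF that, of w] a b mult[OF _ cl that] ab by (auto simp: eval_word_Cons)
  obtain x0 where x0: "x0 \<in> C" using C by blast
  \<comment> \<open>A nonempty word acting trivially would put all of \<open>C\<close> into one of
    the disjoint sets \<open>A\<close> and \<open>B\<close>, though both meet \<open>C\<close>. The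
    case matters because cancelling first letters may exhaust one word before the other.\<close>
  have nontriv: "?e (c # w) \<noteq> \<one>" for c w
  proof
    assume "?e (c # w) = \<one>"
    then have *: "x \<in> (if c then A else B)" if "x \<in> C" for x
      using im[OF that, of c w] one[OF that] by simp
    have "act a x0 \<in> A" "act b x0 \<in> B" using a b x0 by auto
    then show False using *[of "act a x0"] *[of "act b x0"] AB by (cases c) auto
  qed
  have "u = v" if "?e u = ?e v" for u v
    using that
  proof (induction u arbitrary: v)
    case Nil
    have "?e [] = \<one>" by (simp add: eval_word_def)
    with Nil nontriv show ?case by (cases v) metis+
  next
    case (Cons c u)
    show ?case
    proof (cases v)
      case Nil
      with Cons.prems nontriv[of c u] show ?thesis by (simp add: eval_word_def)
    next
      case (Cons d v')
      have "c = d"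
        using im[OF x0, of c u] im[OF x0, of d v'] Cons.prems Cons AB by (auto split: if_splits)
      moreover have "?e u = ?e v'"
        using Cons.prems Cons \<open>c = d\<close> ab cl[of u] cl[of v']
        by (auto simp: eval_word_Cons split: if_splits)
      ultimately show ?thesis using Cons.IH Cons by blast
    qed
  qed
  then show ?thesis
    unfolding contains_free_subsemigroup_2_def inj_on_def using ab by blast
qed

section \<open>Conjugates of one element under the powers of another\<close>

definition conj_pow :: "'a \<Rightarrow> 'a \<Rightarrow> nat \<Rightarrow> 'a" where
  "conj_pow f c i = f [^] i \<otimes> c \<otimes> inv (f [^] i)"

lemma conj_pow_closed [simp]:
  "f \<in> carrier G \<Longrightarrow> c \<in> carrier G \<Longrightarrow> conj_pow f c i \<in> carrier G"
  by (simp add: conj_pow_def)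

lemma conj_pow_Suc:
  assumes "f \<in> carrier G" "c \<in> carrier G"
  shows "f \<otimes> conj_pow f c i \<otimes> inv f = conj_pow f c (Suc i)"
proof -
  have "f [^] Suc i = f \<otimes> f [^] i" using assms nat_pow_Suc2 by blast
  then show ?thesis using assms unfolding conj_pow_def
    by (simp add: inv_mult_group m_assoc del: nat_pow_Suc)
qed

lemma conj_pow_0 [simp]: "c \<in> carrier G \<Longrightarrow> conj_pow f c 0 = c"
  by (simp add: conj_pow_def)

text \<open>Milnor's argument: compare the last letters of two words in \<open>f\<close> and \<open>c \<otimes> f\<close>.\<close>

lemma conj_pow_in_generate:
  assumes fc: "f \<in> carrier G" "c \<in> carrier G"
    and nf: "\<not> contains_free_subsemigroup_2 G"
    and N: "subgroup N G" "\<And>i. conj_pow f c i \<in> N"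
    and fN: "\<And>n::nat. n > 0 \<Longrightarrow> f [^] n \<notin> N"
  obtains n where "conj_pow f c n \<in> generate G (conj_pow f c ` {..<n})"
proof -
  let ?e = "eval_word G f (c \<otimes> f)"
  let ?M = "\<lambda>n. generate G (conj_pow f c ` {..<n})"
  have cf: "c \<otimes> f \<in> carrier G" using fc by simp
  have cl: "?e w \<in> carrier G" for w by (rule eval_word_closed[OF fc(1) cf])
  have Mcl: "conj_pow f c ` {..<n} \<subseteq> carrier G" for n using fc by auto
  have M_in: "x \<in> ?M n \<Longrightarrow> x \<in> carrier G" for x n
    using generate_in_carrier[OF Mcl] by blast
  have M_mono: "?M n \<subseteq> ?M (Suc n)" for n by (intro mono_generate image_mono) auto
  have MN: "?M n \<subseteq> N" for n by (intro generate_subgroup_incl N) (use N in auto)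
  \<comment> \<open>Moving every \<open>f\<close> to the right end leaves one conjugate of
    \<open>c\<close> for each letter \<open>c \<otimes> f\<close>, indexed by the position of that
    letter counted from 0.\<close>
  have e_snoc: "?e (w @ [x]) \<otimes> inv (f [^] length (w @ [x])) =
      (?e w \<otimes> inv (f [^] length w)) \<otimes> (if x then \<one> else conj_pow f c (length w))" for w x
  proof -
    have e: "?e (w @ [x]) = ?e w \<otimes> (if x then f else c \<otimes> f)"
      by (rule eval_word_snoc[OF fc(1) cf])
    have p: "f [^] length (w @ [x]) = f [^] length w \<otimes> f" by simp
    have 1: "?e w \<otimes> f \<otimes> inv (f [^] length w \<otimes> f) = ?e w \<otimes> inv (f [^] length w)"
      using fc cl[of w] by (simp add: inv_mult_group m_assoc mult_inv_cancel)
    have 2: "?e w \<otimes> (c \<otimes> f) \<otimes> inv (f [^] length w \<otimes> f) = ?e w \<otimes> (c \<otimes> inv (f [^] length w))"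
      using fc cl[of w] by (simp add: inv_mult_group m_assoc mult_inv_cancel)
    have 3: "?e w \<otimes> (c \<otimes> inv (f [^] length w)) =
        (?e w \<otimes> inv (f [^] length w)) \<otimes> (f [^] length w \<otimes> c \<otimes> inv (f [^] length w))"
      using fc cl[of w] by (simp add: m_assoc mult_inv_cancel)
    show ?thesis
      using 1 2 3 e p fc cl[of w] by (auto simp: conj_pow_def)
  qed
  have part: "?e w \<otimes> inv (f [^] length w) \<in> ?M (length w)" for w
  proof (induction w rule: rev_induct)
    case Nil
    then show ?case by (simp add: eval_word_def generate.one)
  next
    case (snoc x w)
    have "conj_pow f c (length w) \<in> ?M (Suc (length w))" by (intro generate.incl) auto
    then have "(?e w \<otimes> inv (f [^] length w)) \<otimes> (if x then \<one> else conj_pow f c (length w))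
        \<in> ?M (Suc (length w))"
      using generate.eng[OF subsetD[OF M_mono snoc.IH], of "if x then \<one> else conj_pow f c (length w)"]
        generate.one by (cases x) auto
    then show ?case unfolding e_snoc by (simp only: length_append_singleton)
  qed
  have ex: "\<exists>n. conj_pow f c n \<in> ?M n" if "length u = length v" "u \<noteq> v" "?e u = ?e v" for u v
    using that
  proof (induction u arbitrary: v rule: rev_induct)
    case Nil
    then show ?case by auto
  next
    case (snoc x u)
    obtain v' y where v: "v = v' @ [y]" using snoc.prems(1) by (cases v rule: rev_cases) auto
    have len: "length u = length v'" using snoc.prems v by simp
    have eq: "?e (u @ [x]) = ?e (v' @ [y])" using snoc.prems v by simp
    show ?case
    proof (cases "x = y")
      case True
      then have "?e u = ?e v'"
        using eq cl[of u] cl[of v'] fc eval_word_snoc[OF fc(1) cf] by (auto split: if_splits)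
      then show ?thesis using snoc.IH[OF len] True v snoc.prems by blast
    next
      case False
      let ?u = "?e u \<otimes> inv (f [^] length u)" and ?v = "?e v' \<otimes> inv (f [^] length v')"
      have *: "?u \<otimes> (if x then \<one> else conj_pow f c (length u)) =
            ?v \<otimes> (if y then \<one> else conj_pow f c (length v'))"
        using e_snoc[of u x] e_snoc[of v' y] eq len by simp
      have uv: "?u \<in> ?M (length u)" "?v \<in> ?M (length u)"
        using part[of u] part[of v'] len by auto
      have cu: "?u \<in> carrier G" "?v \<in> carrier G" using uv M_in by blast+
      have inv_in: "inv ?u \<in> ?M (length u)" "inv ?v \<in> ?M (length u)"
        using uv generate_m_inv_closed[OF Mcl] by blast+
      have cc: "conj_pow f c (length u) \<in> carrier G" using fc by simp
      \<comment> \<open>As the last letters differ, exactly one side carries the conjugate with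
        index \<open>length u\<close>; solving for it expresses it by conjugates of smaller
        index.\<close>
      have "conj_pow f c (length u) = inv ?v \<otimes> ?u \<or> conj_pow f c (length u) = inv ?u \<otimes> ?v"
        using * False cu cc len by (cases x; cases y) (auto simp: inv_solve_left)
      then have "conj_pow f c (length u) \<in> ?M (length u)"
        using uv inv_in by (auto intro: generate.eng)
      then show ?thesis by blast
    qed
  qed
  from nf obtain u v where uv: "u \<noteq> v" "?e u = ?e v"
    unfolding contains_free_subsemigroup_2_def inj_on_def using fc cf by blast
  \<comment> \<open>A word of length n lies in the coset of \<open>N\<close> through
    \<open>f [^] n\<close>, so a relation between words of different lengths would put a positive
    power of \<open>f\<close> into \<open>N\<close>.\<close>
  have key: "length v \<le> length u" if eq: "?e u = ?e v" for u v
  proof (rule ccontr)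
    assume "\<not> length v \<le> length u"
    then obtain d where d: "length v = length u + d" "d > 0"
      by (metis less_imp_add_positive not_le)
    have pu: "?e u \<otimes> inv (f [^] length u) \<in> N" "?e v \<otimes> inv (f [^] length v) \<in> N"
      using part MN by blast+
    have eu: "?e u = (?e u \<otimes> inv (f [^] length u)) \<otimes> f [^] length u" for u
      using cl[of u] fc by (simp add: m_assoc)
    define x y where "x = ?e u \<otimes> inv (f [^] length u)" and "y = ?e v \<otimes> inv (f [^] length v)"
    have xy: "x \<in> N" "y \<in> N" "x \<in> carrier G" "y \<in> carrier G"
      using pu subgroup.mem_carrier[OF N(1)] by (auto simp: x_def y_def)
    have "x \<otimes> f [^] length u = y \<otimes> f [^] (d + length u)"
      using eu[of u] eu[of v] eq d by (simp add: x_def y_def add.commute)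
    then have "x \<otimes> f [^] length u = (y \<otimes> f [^] d) \<otimes> f [^] length u"
      using fc xy by (simp add: nat_pow_mult[symmetric] m_assoc)
    then have "x = y \<otimes> f [^] d" using fc xy by simp
    then have "f [^] d = inv y \<otimes> x" using fc xy by (simp add: inv_solve_left)
    then have "f [^] d \<in> N"
      using xy N(1) by (simp add: subgroup.m_closed subgroup.m_inv_closed)
    then show False using fN d by blast
  qed
  have "length u = length v" using key[of u v] key[of v u] uv by simp
  then show ?thesis using ex[OF _ uv] that by blast
qed

lemma generate_conj:
  assumes "A \<subseteq> carrier G" "k \<in> carrier G" "x \<in> generate G A"
  shows "k \<otimes> x \<otimes> inv k \<in> generate G ((\<lambda>a. k \<otimes> a \<otimes> inv k) ` A)"
  using assms(3)
proof (induction x rule: generate.induct)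
  case one
  show ?case using assms(2) generate.one[of G "(\<lambda>a. k \<otimes> a \<otimes> inv k) ` A"] by simp
next
  case (incl h)
  show ?case by (rule generate.incl, rule imageI, rule incl)
next
  case (inv h)
  then have h: "h \<in> carrier G" using assms by auto
  have "inv (k \<otimes> h \<otimes> inv k) \<in> generate G ((\<lambda>a. k \<otimes> a \<otimes> inv k) ` A)"
    by (rule generate.inv, rule imageI, rule inv)
  moreover have "inv (k \<otimes> h \<otimes> inv k) = k \<otimes> inv h \<otimes> inv k"
    using h assms by (simp add: inv_mult_group m_assoc)
  ultimately show ?case by simp
next
  case (eng h1 h2)
  have h: "h1 \<in> carrier G" "h2 \<in> carrier G"
    using eng(1,2) generate_in_carrier[OF assms(1)] by blast+
  have "(k \<otimes> h1 \<otimes> inv k) \<otimes> (k \<otimes> h2 \<otimes> inv k) = k \<otimes> (h1 \<otimes> h2) \<otimes> inv k"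
    using h assms by (simp add: m_assoc mult_inv_cancel)
  then show ?case using generate.eng[OF eng(3,4)] by simp
qed

lemma generate_conj_closed:
  assumes "A \<subseteq> carrier G" "k \<in> carrier G" "\<And>a. a \<in> A \<Longrightarrow> k \<otimes> a \<otimes> inv k \<in> generate G A"
    and x: "x \<in> generate G A"
  shows "k \<otimes> x \<otimes> inv k \<in> generate G A"
proof -
  have "generate G ((\<lambda>a. k \<otimes> a \<otimes> inv k) ` A) \<subseteq> generate G A"
    by (rule generate_subgroup_incl) (use assms generate_is_subgroup in auto)
  then show ?thesis using generate_conj[OF assms(1,2) x] by blast
qed

lemma conj_pow_conj:
  assumes "f \<in> carrier G" "c \<in> carrier G"
  shows "f [^] k \<otimes> conj_pow f c i \<otimes> inv (f [^] k) = conj_pow f c (k + i)"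
  using assms unfolding conj_pow_def
  by (simp add: nat_pow_mult[symmetric] inv_mult_group m_assoc)

lemma conj_pow_inv_Suc:
  assumes "f \<in> carrier G" "c \<in> carrier G"
  shows "f \<otimes> conj_pow (inv f) c (Suc i) \<otimes> inv f = conj_pow (inv f) c i"
  using assms conj_pow_Suc[of "inv f" c i, symmetric]
  by (simp add: m_assoc mult_inv_cancel)

text \<open>Counting conjugates by \<open>inv f\<close> with negative indices, conjugation by
  \<open>f\<close> raises every index by one. Only the top generator leaves \<open>C\<close>, and a
  shift of the relation \<open>n(1)\<close> expresses its image by generators that are still in
  \<open>C\<close>.\<close>

lemma conj_pow_normalized_aux:
  assumes fc: "f \<in> carrier G" "c \<in> carrier G"
    and n: "conj_pow f c n \<in> generate G (conj_pow f c ` {..<n})" "n \<le> Suc r"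
    and C: "C = conj_pow f c ` {..Suc r} \<union> conj_pow (inv f) c ` {..Suc r}"
    and x: "x \<in> generate G C"
  shows "f \<otimes> x \<otimes> inv f \<in> generate G C"
proof (rule generate_conj_closed[OF _ fc(1) _ x])
  show CG: "C \<subseteq> carrier G" using fc C by auto
  fix a assume "a \<in> C"
  then obtain i where i: "i \<le> Suc r" "a = conj_pow f c i \<or> a = conj_pow (inv f) c i"
    unfolding C by auto
  consider "i \<le> r" "a = conj_pow f c i" | "a = conj_pow f c (Suc r)"
    | "a = conj_pow (inv f) c 0" | j where "j \<le> r" "a = conj_pow (inv f) c (Suc j)"
  proof (cases "a = conj_pow f c i")
    case True
    then show ?thesis using i that(1,2) by (cases "i = Suc r") auto
  next
    case False
    then show ?thesis using i that(3,4) by (cases i) auto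
  qed
  then show "f \<otimes> a \<otimes> inv f \<in> generate G C"
  proof cases
    case 1
    then have "f \<otimes> a \<otimes> inv f = conj_pow f c (Suc i)" using conj_pow_Suc fc by simp
    moreover have "conj_pow f c (Suc i) \<in> C" using 1 unfolding C by blast
    ultimately show ?thesis using generate.incl[of _ C G] by metis
  next
    case 2
    \<comment> \<open>Conjugation by \<open>f [^] k\<close> moves index \<open>n\<close> to
      \<open>r + 2\<close>, just past the top, and the indices below \<open>n\<close> to indices at
      most \<open>r + 1\<close>, which are in \<open>C\<close>.\<close>
    define k where "k = Suc (Suc r) - n"
    have kn: "k + n = Suc (Suc r)" using n by (simp add: k_def)
    have "f \<otimes> a \<otimes> inv f = conj_pow f c (k + n)" using 2 conj_pow_Suc fc kn by simp
    also have "\<dots> = f [^] k \<otimes> conj_pow f c n \<otimes> inv (f [^] k)" using conj_pow_conj fc by simp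
    also have "\<dots> \<in> generate G ((\<lambda>a. f [^] k \<otimes> a \<otimes> inv (f [^] k)) ` conj_pow f c ` {..<n})"
      by (rule generate_conj[OF _ nat_pow_closed[OF fc(1)] n(1)]) (use fc in auto)
    also have "\<dots> \<subseteq> generate G C"
    proof (rule mono_generate, rule image_subsetI)
      fix a assume "a \<in> conj_pow f c ` {..<n}"
      then obtain i where i: "i < n" "a = conj_pow f c i" by blast
      then have "f [^] k \<otimes> a \<otimes> inv (f [^] k) = conj_pow f c (k + i)"
        using conj_pow_conj[OF fc] by simp
      moreover have "k + i \<le> Suc r" using kn i by linarith
      ultimately show "f [^] k \<otimes> a \<otimes> inv (f [^] k) \<in> C" unfolding C by blast
    qed
    finally show ?thesis .
  next
    case 3
    then have "f \<otimes> a \<otimes> inv f = conj_pow f c (Suc 0)" using conj_pow_Suc[of f c 0] fc by simp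
    moreover have "conj_pow f c (Suc 0) \<in> C" unfolding C by blast
    ultimately show ?thesis using generate.incl[of _ C G] by metis
  next
    case 4
    then have "f \<otimes> a \<otimes> inv f = conj_pow (inv f) c j" using conj_pow_inv_Suc fc by simp
    moreover have "conj_pow (inv f) c j \<in> C" using 4 unfolding C by auto
    ultimately show ?thesis using generate.incl[of _ C G] by metis
  qed
qed

text \<open>\<open>C\<close> contains conjugates with positive and with negative exponents, so it is
  unchanged when \<open>f\<close> and \<open>inv f\<close> trade places, and the auxiliary lemma
  serves both directions. \<open>r\<close> is the larger of the two exponents that Milnor's argument
  yields for \<open>f\<close> and for \<open>inv f\<close>.\<close>

lemma conj_pow_normalized:
  assumes fc: "f \<in> carrier G" "c \<in> carrier G"
    and nf: "\<not> contains_free_subsemigroup_2 G"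
    and N: "subgroup N G" "c \<in> N" "\<And>k x. k \<in> carrier G \<Longrightarrow> x \<in> N \<Longrightarrow> k \<otimes> x \<otimes> inv k \<in> N"
    and fN: "\<And>n::nat. n > 0 \<Longrightarrow> f [^] n \<notin> N"
  obtains C where "finite C" "C \<subseteq> N" "c \<in> C"
    "\<And>x. x \<in> generate G C \<Longrightarrow> f \<otimes> x \<otimes> inv f \<in> generate G C"
    "\<And>x. x \<in> generate G C \<Longrightarrow> inv f \<otimes> x \<otimes> f \<in> generate G C"
proof -
  have if': "inv f \<in> carrier G" using fc by simp
  have cN: "conj_pow f c i \<in> N" "conj_pow (inv f) c i \<in> N" for i
    unfolding conj_pow_def by (intro N(3) nat_pow_closed fc if' N(2))+
  have inv_N: "inv f [^] n \<notin> N" if "n > 0" for n :: nat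
  proof
    assume "inv f [^] n \<in> N"
    then have "inv (inv f [^] n) \<in> N" using subgroup.m_inv_closed[OF N(1)] by blast
    then show False using fN[OF that] fc by (simp add: nat_pow_inv)
  qed
  obtain n where n: "conj_pow f c n \<in> generate G (conj_pow f c ` {..<n})"
    using conj_pow_in_generate[OF fc nf N(1) cN(1) fN] by blast
  obtain m where m: "conj_pow (inv f) c m \<in> generate G (conj_pow (inv f) c ` {..<m})"
    using conj_pow_in_generate[OF if' fc(2) nf N(1) cN(2) inv_N] by blast
  define r where "r = max n m"
  define C where "C = conj_pow f c ` {..Suc r} \<union> conj_pow (inv f) c ` {..Suc r}"
  have C': "C = conj_pow (inv f) c ` {..Suc r} \<union> conj_pow (inv (inv f)) c ` {..Suc r}"
    using fc by (auto simp: C_def)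
  have r: "n \<le> Suc r" "m \<le> Suc r" by (auto simp: r_def)
  show ?thesis
  proof (rule that[of C])
    show "finite C" "C \<subseteq> N" using cN by (auto simp: C_def)
    have "conj_pow f c 0 \<in> C" by (auto simp: C_def)
    then show "c \<in> C" using fc by simp
    show "f \<otimes> x \<otimes> inv f \<in> generate G C" if "x \<in> generate G C" for x
      by (rule conj_pow_normalized_aux[OF fc n r(1) C_def that])
    show "inv f \<otimes> x \<otimes> f \<in> generate G C" if "x \<in> generate G C" for x
      using conj_pow_normalized_aux[OF if' fc(2) m r(2) C' that] fc by simp
  qed
qed

end

section \<open>Subgroups of finite index\<close>

definition fin_index :: "('a, 'b) monoid_scheme \<Rightarrow> 'a set \<Rightarrow> bool" where
  "fin_index G H \<longleftrightarrow> subgroup H G \<and> finite (rcosets\<^bsub>G\<^esub> H)"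

context group
begin

lemma rcos_eq_iff:
  assumes "subgroup H G" "x \<in> carrier G" "y \<in> carrier G"
  shows "H #> x = H #> y \<longleftrightarrow> x \<otimes> inv y \<in> H"
proof
  assume "H #> x = H #> y"
  then have "x \<in> H #> y" using rcos_self assms by blast
  then show "x \<otimes> inv y \<in> H"
    using subgroup.rcos_module_imp[OF assms(1) is_group assms(3)] by blast
next
  assume "x \<otimes> inv y \<in> H"
  then have "x \<in> H #> y"
    using subgroup.rcos_module_rev[OF assms(1) is_group assms(3,2)] by blast
  then show "H #> x = H #> y" using repr_independence assms by blast
qed

text \<open>Any map with finite range whose fibres lie in single cosets bounds the index. Below,
  \<open>\<phi>\<close> records cosets of other subgroups, or the image of a point together with an
  orientation.\<close>

lemma fin_indexI:
  assumes H: "subgroup H G" and fin: "finite (\<phi> ` carrier G)"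
    and \<phi>: "\<And>x y. x \<in> carrier G \<Longrightarrow> y \<in> carrier G \<Longrightarrow> \<phi> x = \<phi> y \<Longrightarrow> x \<otimes> inv y \<in> H"
  shows "fin_index G H"
proof -
  have "rcosets H \<subseteq> (\<lambda>z. H #> (inv_into (carrier G) \<phi> z)) ` \<phi> ` carrier G"
  proof
    fix A assume "A \<in> rcosets H"
    then obtain x where x: "x \<in> carrier G" "A = H #> x" by (auto simp: RCOSETS_def)
    let ?y = "inv_into (carrier G) \<phi> (\<phi> x)"
    have y: "?y \<in> carrier G" "\<phi> ?y = \<phi> x"
      using x by (auto simp: inv_into_into f_inv_into_f)
    have "A = H #> ?y" using rcos_eq_iff[OF H x(1) y(1)] \<phi>[OF x(1) y(1)] x y by simp
    then show "A \<in> (\<lambda>z. H #> (inv_into (carrier G) \<phi> z)) ` \<phi> ` carrier G" using x by blast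
  qed
  then show ?thesis using fin H unfolding fin_index_def by (meson finite_imageI finite_subset)
qed

lemma fin_index_Int:
  assumes "fin_index G H" "fin_index G H'"
  shows "fin_index G (H \<inter> H')"
proof (rule fin_indexI[where \<phi> = "\<lambda>x. (H #> x, H' #> x)"])
  show "subgroup (H \<inter> H') G"
    using assms by (auto simp: fin_index_def intro: subgroups_Inter_pair)
  have "(\<lambda>x. (H #> x, H' #> x)) ` carrier G \<subseteq> (rcosets H) \<times> (rcosets H')"
    by (auto simp: RCOSETS_def)
  then show "finite ((\<lambda>x. (H #> x, H' #> x)) ` carrier G)"
    using assms unfolding fin_index_def by (meson finite_SigmaI finite_subset)
next
  fix x y assume "x \<in> carrier G" "y \<in> carrier G" "(H #> x, H' #> x) = (H #> y, H' #> y)"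
  then show "x \<otimes> inv y \<in> H \<inter> H'"
    using assms rcos_eq_iff unfolding fin_index_def by blast
qed

lemma fin_index_carrier: "fin_index G (carrier G)"
  by (rule fin_indexI[where \<phi> = "\<lambda>_. ()"]) (auto intro: subgroup_self)

text \<open>The factor \<open>carrier G\<close> gives the intersection its right value when
  \<open>I\<close> is empty.\<close>

lemma fin_index_Inter:
  assumes "finite I" "\<And>i. i \<in> I \<Longrightarrow> fin_index G (H i)"
  shows "fin_index G (carrier G \<inter> (\<Inter>i\<in>I. H i))"
  using assms
proof (induction I)
  case empty
  then show ?case by (simp add: fin_index_carrier)
next
  case (insert i I)
  have "fin_index G (carrier G \<inter> (\<Inter>i\<in>I. H i))"
    by (rule insert.IH) (rule insert.prems, simp)
  moreover have "fin_index G (H i)" by (rule insert.prems) simp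
  ultimately have "fin_index G (H i \<inter> (carrier G \<inter> (\<Inter>i\<in>I. H i)))"
    by (rule fin_index_Int[rotated])
  then show ?case by (simp add: Int_left_commute)
qed

text \<open>The set is the conjugate of \<open>H\<close> by \<open>k\<close>; its cosets are
  separated by the cosets of \<open>H\<close> through \<open>inv k \<otimes> x\<close>.\<close>

lemma fin_index_conj:
  assumes "fin_index G H" and k: "k \<in> carrier G"
  shows "fin_index G {g \<in> carrier G. inv k \<otimes> g \<otimes> k \<in> H}"
proof -
  have H: "subgroup H G" using assms by (simp add: fin_index_def)
  show ?thesis
  proof (rule fin_indexI[where \<phi> = "\<lambda>x. H #> (inv k \<otimes> x)"])
    show "subgroup {g \<in> carrier G. inv k \<otimes> g \<otimes> k \<in> H} G"
    proof (rule subgroupI)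
      show "{g \<in> carrier G. inv k \<otimes> g \<otimes> k \<in> H} \<noteq> {}"
        using k subgroup.one_closed[OF H] by (auto intro!: exI[of _ \<one>])
    next
      fix a assume a: "a \<in> {g \<in> carrier G. inv k \<otimes> g \<otimes> k \<in> H}"
      then have "inv (inv k \<otimes> a \<otimes> k) \<in> H" using subgroup.m_inv_closed[OF H] by blast
      moreover have "inv (inv k \<otimes> a \<otimes> k) = inv k \<otimes> inv a \<otimes> k"
        using a k by (simp add: inv_mult_group m_assoc)
      ultimately show "inv a \<in> {g \<in> carrier G. inv k \<otimes> g \<otimes> k \<in> H}" using a by simp
    next
      fix a b assume a: "a \<in> {g \<in> carrier G. inv k \<otimes> g \<otimes> k \<in> H}"
        and b: "b \<in> {g \<in> carrier G. inv k \<otimes> g \<otimes> k \<in> H}"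
      then have "(inv k \<otimes> a \<otimes> k) \<otimes> (inv k \<otimes> b \<otimes> k) \<in> H"
        using subgroup.m_closed[OF H] by blast
      moreover have "(inv k \<otimes> a \<otimes> k) \<otimes> (inv k \<otimes> b \<otimes> k) = inv k \<otimes> (a \<otimes> b) \<otimes> k"
        using a b k by (simp add: m_assoc mult_inv_cancel)
      ultimately show "a \<otimes> b \<in> {g \<in> carrier G. inv k \<otimes> g \<otimes> k \<in> H}" using a b by simp
    qed auto
  next
    have "(\<lambda>x. H #> (inv k \<otimes> x)) ` carrier G \<subseteq> rcosets H"
      using k by (auto intro!: rcosetsI subgroup.subset[OF H])
    then show "finite ((\<lambda>x. H #> (inv k \<otimes> x)) ` carrier G)"
      using assms unfolding fin_index_def by (meson finite_subset)
  next
    fix x y assume xy: "x \<in> carrier G" "y \<in> carrier G" "H #> (inv k \<otimes> x) = H #> (inv k \<otimes> y)"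
    then have "(inv k \<otimes> x) \<otimes> inv (inv k \<otimes> y) \<in> H" using rcos_eq_iff[OF H] k by simp
    moreover have "(inv k \<otimes> x) \<otimes> inv (inv k \<otimes> y) = inv k \<otimes> (x \<otimes> inv y) \<otimes> k"
      using xy k by (simp add: inv_mult_group m_assoc)
    ultimately show "x \<otimes> inv y \<in> {g \<in> carrier G. inv k \<otimes> g \<otimes> k \<in> H}" using xy by simp
  qed
qed

text \<open>Schreier's lemma; the set \<open>R\<close> of coset representatives need not be irredundant.\<close>

lemma finitely_generated_fin_index:
  assumes fg: "finitely_generated_group G" and H: "fin_index G H"
  shows "finitely_generated_group (G\<lparr>carrier := H\<rparr>)"
proof -
  have sH: "subgroup H G" using H by (simp add: fin_index_def)
  obtain S where S: "finite S" "S \<subseteq> carrier G" "generate G S = carrier G"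
    using fg by (auto simp: finitely_generated_group_def)
  define R where "R = insert \<one> ((\<lambda>A. SOME x. x \<in> carrier G \<and> A = H #> x) ` (rcosets H))"
  have rep: "(SOME x. x \<in> carrier G \<and> H #> y = H #> x) \<in> carrier G \<and>
      H #> y = H #> (SOME x. x \<in> carrier G \<and> H #> y = H #> x)" if "y \<in> carrier G" for y
    by (rule someI_ex) (use that in blast)
  have R: "finite R" "R \<subseteq> carrier G" "\<one> \<in> R"
    using H rep by (auto simp: R_def fin_index_def RCOSETS_def)
  have exR: "\<exists>t\<in>R. x \<otimes> inv t \<in> H" if x: "x \<in> carrier G" for x
  proof -
    have "(SOME z. z \<in> carrier G \<and> H #> x = H #> z) \<in> R"
      using x by (auto simp: R_def RCOSETS_def)
    then show ?thesis using rep[OF x] rcos_eq_iff[OF sH x] by blast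
  qed
  define S' where "S' = S \<union> m_inv G ` S"
  \<comment> \<open>\<open>R\<close> contains \<one> as the starting representative, but the coset
    \<open>H\<close> may have a second representative in \<open>R\<close>. The elements of
    \<open>R\<close> that lie in \<open>H\<close> are therefore added to the Schreier
    generators.\<close>
  define T where "T = ((\<lambda>(r, s, t). r \<otimes> s \<otimes> inv t) ` (R \<times> S' \<times> R) \<union> R) \<inter> H"
  have S': "finite S'" "S' \<subseteq> carrier G" using S by (auto simp: S'_def)
  have T: "finite T" "T \<subseteq> H" using R S' by (auto simp: T_def)
  have genH: "generate G T \<subseteq> H" by (rule generate_subgroup_incl[OF T(2) sH])
  have step: "\<exists>t\<in>R. r \<otimes> s \<otimes> inv t \<in> generate G T" if "r \<in> R" "s \<in> S'" for r s
  proof -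
    have "r \<otimes> s \<in> carrier G" using that R S' by auto
    then obtain t where t: "t \<in> R" "r \<otimes> s \<otimes> inv t \<in> H" using exR by blast
    have "r \<otimes> s \<otimes> inv t \<in> (\<lambda>(r, s, t). r \<otimes> s \<otimes> inv t) ` (R \<times> S' \<times> R)"
      using that t by (intro image_eqI[where x = "(r, s, t)"]) auto
    then have "r \<otimes> s \<otimes> inv t \<in> T" using t by (simp add: T_def)
    then show ?thesis using t(1) generate.incl[of _ T G] by blast
  qed
  \<comment> \<open>A word is read letter by letter while a representative is carried along; each
    letter costs one Schreier generator and replaces \<open>r\<close> by a new representative
    \<open>t\<close>.\<close>
  have main: "\<forall>r\<in>R. \<exists>t\<in>R. r \<otimes> g \<otimes> inv t \<in> generate G T" if "g \<in> generate G S" for g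
    using that
  proof (induction g rule: generate.induct)
    case one
    show ?case
    proof
      fix r assume "r \<in> R"
      moreover have "r \<otimes> \<one> \<otimes> inv r = \<one>" using \<open>r \<in> R\<close> R by auto
      ultimately show "\<exists>t\<in>R. r \<otimes> \<one> \<otimes> inv t \<in> generate G T"
        using generate.one[of G T] by metis
    qed
  next
    case (incl h)
    then have "h \<in> S'" by (simp add: S'_def)
    then show ?case using step by blast
  next
    case (inv h)
    then have "inv h \<in> S'" by (simp add: S'_def)
    then show ?case using step by blast
  next
    case (eng h1 h2)
    have h: "h1 \<in> carrier G" "h2 \<in> carrier G" using eng(1,2) S(3) by blast+
    show ?case
    proof
      fix r assume r: "r \<in> R"
      obtain t where t: "t \<in> R" "r \<otimes> h1 \<otimes> inv t \<in> generate G T" using eng r by blast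
      obtain t' where t': "t' \<in> R" "t \<otimes> h2 \<otimes> inv t' \<in> generate G T" using eng t by blast
      have "(r \<otimes> h1 \<otimes> inv t) \<otimes> (t \<otimes> h2 \<otimes> inv t') = r \<otimes> (h1 \<otimes> h2) \<otimes> inv t'"
      proof -
        have c: "r \<in> carrier G" "t \<in> carrier G" "t' \<in> carrier G" using r t t' R by auto
        then show ?thesis using h by (simp add: m_assoc mult_inv_cancel)
      qed
      then have "r \<otimes> (h1 \<otimes> h2) \<otimes> inv t' \<in> generate G T"
        using generate.eng[OF t(2) t'(2)] by simp
      then show "\<exists>t\<in>R. r \<otimes> (h1 \<otimes> h2) \<otimes> inv t \<in> generate G T" using t' by blast
    qed
  qed
  have "H \<subseteq> generate G T"
  proof
    fix h assume h: "h \<in> H"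
    then have hc: "h \<in> carrier G" using subgroup.mem_carrier[OF sH] by blast
    then have "h \<in> generate G S" using S by simp
    then obtain t where t: "t \<in> R" "\<one> \<otimes> h \<otimes> inv t \<in> generate G T" using main R by blast
    have tc: "t \<in> carrier G" using t R by blast
    have ht: "h \<otimes> inv t \<in> generate G T" using t hc by simp
    then have "h \<otimes> inv t \<in> H" using genH by blast
    then have "inv (h \<otimes> inv t) \<otimes> h \<in> H"
      using h sH by (meson subgroup.m_closed subgroup.m_inv_closed)
    moreover have "inv (h \<otimes> inv t) \<otimes> h = t" using hc tc by (simp add: inv_mult_group m_assoc)
    ultimately have "t \<in> T" using t by (auto simp: T_def)
    then have "(h \<otimes> inv t) \<otimes> t \<in> generate G T" using ht generate.incl generate.eng by metis
    moreover have "(h \<otimes> inv t) \<otimes> t = h" using hc tc by (simp add: m_assoc)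
    ultimately show "h \<in> generate G T" by simp
  qed
  then have "generate (G\<lparr>carrier := H\<rparr>) T = H"
    using genH generate_consistent[OF T(2) sH] by simp
  then show ?thesis unfolding finitely_generated_group_def using T by auto
qed

lemma contains_free_subsemigroup_2_subgroup:
  assumes "H \<subseteq> carrier G" "contains_free_subsemigroup_2 (G\<lparr>carrier := H\<rparr>)"
  shows "contains_free_subsemigroup_2 G"
proof -
  have "eval_word (G\<lparr>carrier := H\<rparr>) a b = eval_word G a b" for a b
    by (rule ext) (simp add: eval_word_def)
  then show ?thesis
    using assms unfolding contains_free_subsemigroup_2_def by (simp, blast)
qed

end

section \<open>Archimedean preorders\<close>

context group
begin

text \<open>Hoelder's theorem, for a bi-invariant total preorder in place of an order.\<close>

lemma archimedean_commute:
  fixes le :: "'a \<Rightarrow> 'a \<Rightarrow> bool"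
  assumes trans: "\<And>x y z. x \<in> carrier G \<Longrightarrow> y \<in> carrier G \<Longrightarrow> z \<in> carrier G \<Longrightarrow>
      le x y \<Longrightarrow> le y z \<Longrightarrow> le x z"
    and total: "\<And>x y. x \<in> carrier G \<Longrightarrow> y \<in> carrier G \<Longrightarrow> le x y \<or> le y x"
    and left: "\<And>x y z. x \<in> carrier G \<Longrightarrow> y \<in> carrier G \<Longrightarrow> z \<in> carrier G \<Longrightarrow>
      le x y \<Longrightarrow> le (z \<otimes> x) (z \<otimes> y)"
    and right: "\<And>x y z. x \<in> carrier G \<Longrightarrow> y \<in> carrier G \<Longrightarrow> z \<in> carrier G \<Longrightarrow>
      le x y \<Longrightarrow> le (x \<otimes> z) (y \<otimes> z)"
    and arch: "\<And>e g. e \<in> carrier G \<Longrightarrow> g \<in> carrier G \<Longrightarrow> \<not> le e \<one> \<Longrightarrow>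
      \<exists>n::nat. le g (e [^] n)"
    and gh: "g \<in> carrier G" "h \<in> carrier G"
  shows "le (g \<otimes> h) (h \<otimes> g)"
proof (rule ccontr)
  assume contra: "\<not> le (g \<otimes> h) (h \<otimes> g)"
  have left': "le x y" if "le (z \<otimes> x) (z \<otimes> y)" "x \<in> carrier G" "y \<in> carrier G" "z \<in> carrier G" for x y z
    using left[of "z \<otimes> x" "z \<otimes> y" "inv z"] that by (simp add: mult_inv_cancel)
  have mult: "le (x \<otimes> y) (x' \<otimes> y')"
    if "le x x'" "le y y'" "x \<in> carrier G" "y \<in> carrier G" "x' \<in> carrier G" "y' \<in> carrier G" for x y x' y'
    using trans[of "x \<otimes> y" "x \<otimes> y'" "x' \<otimes> y'"] left[of y y' x] right[of x x' y'] that by simp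
  \<comment> \<open>Every element lies between consecutive powers of a positive \<open>e\<close>.
    Shifting the exponents by \<open>n0\<close> turns the search for the last power below
    \<open>x\<close> into an induction over the naturals.\<close>
  have bracket: "\<exists>m::int. le (e [^] m) x \<and> \<not> le (e [^] (m + 1)) x"
    if e: "e \<in> carrier G" "\<not> le e \<one>" and x: "x \<in> carrier G" for e x
  proof -
    obtain n0 :: nat where n0: "le (inv x) (e [^] n0)" using arch[of e "inv x"] e x by auto
    obtain n1 :: nat where n1: "le x (e [^] n1)" using arch[of e x] e x by auto
    define P where "P k \<longleftrightarrow> le (e [^] (int k - int n0)) x" for k :: nat
    have P0: "P 0"
    proof -
      have "le (inv (e [^] n0) \<otimes> inv x \<otimes> x) (inv (e [^] n0) \<otimes> e [^] n0 \<otimes> x)"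
        using n0 e x left[of "inv x" "e [^] n0" "inv (e [^] n0)"]
          right[of "inv (e [^] n0) \<otimes> inv x" "inv (e [^] n0) \<otimes> e [^] n0" x] by simp
      then have "le (inv (e [^] n0)) x" using e x by (simp add: m_assoc)
      then show ?thesis using e by (simp add: P_def int_pow_neg_int)
    qed
    have notP: "\<not> P (n0 + n1 + 1)"
    proof
      assume "P (n0 + n1 + 1)"
      then have "le (e [^] (int (Suc n1))) x" by (simp add: P_def)
      then have "le (e [^] (Suc n1)) x" by (simp only: int_pow_int)
      then have "le (e [^] n1 \<otimes> e) (e [^] n1)" using trans[of _ x "e [^] n1"] n1 e x by simp
      then have "le (e [^] n1 \<otimes> e) (e [^] n1 \<otimes> \<one>)" using e by simp
      then show False using left'[of "e [^] n1" e \<one>] e by simp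
    qed
    have "\<exists>k. P k \<and> \<not> P (Suc k)"
    proof (rule ccontr)
      assume "\<not> ?thesis"
      then have "P k" for k by (induction k) (use P0 in auto)
      then show False using notP by blast
    qed
    then obtain k where "P k" "\<not> P (Suc k)" by blast
    then show ?thesis by (intro exI[of _ "int k - int n0"]) (simp add: P_def algebra_simps)
  qed
  define c where "c = g \<otimes> h \<otimes> inv (h \<otimes> g)"
  have c: "c \<in> carrier G" "c \<otimes> (h \<otimes> g) = g \<otimes> h"
    using gh by (auto simp: c_def m_assoc)
  have c1: "\<not> le c \<one>"
    using right[of c \<one> "h \<otimes> g"] c gh contra by auto
  \<comment> \<open>Brackets of \<open>g\<close> and \<open>h\<close> between powers of
    \<open>e\<close> bound \<open>g \<otimes> h\<close> from above and \<open>h \<otimes> g\<close>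
    from below by powers whose exponents differ by two, so \<open>c\<close> lies strictly below
    \<open>e \<otimes> e\<close>.\<close>
  have A: "\<not> le (e \<otimes> e) c" if e: "e \<in> carrier G" "\<not> le e \<one>" for e
  proof
    assume le: "le (e \<otimes> e) c"
    obtain m :: int where m: "le (e [^] m) g" "\<not> le (e [^] (m + 1)) g" using bracket[OF e gh(1)] by blast
    obtain n :: int where n: "le (e [^] n) h" "\<not> le (e [^] (n + 1)) h" using bracket[OF e gh(2)] by blast
    have "le (e [^] n \<otimes> e [^] m) (h \<otimes> g)" using mult m n e gh by simp
    then have "le (e \<otimes> e \<otimes> (e [^] n \<otimes> e [^] m)) (c \<otimes> (h \<otimes> g))" using mult[OF le] e c(1) gh by simp
    moreover have "e [^] (m + 1) \<otimes> e [^] (n + 1) = e \<otimes> e \<otimes> (e [^] n \<otimes> e [^] m)"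
    proof -
      have "e \<otimes> e \<otimes> (e [^] n \<otimes> e [^] m) = e [^] (1::int) \<otimes> e [^] (1::int) \<otimes> (e [^] n \<otimes> e [^] m)"
        using e by simp
      also have "\<dots> = e [^] (1 + 1 + (n + m))" using e by (simp only: int_pow_mult)
      also have "\<dots> = e [^] ((m + 1) + (n + 1))" by (simp add: algebra_simps)
      finally show ?thesis using e by (simp only: int_pow_mult)
    qed
    ultimately have *: "le (e [^] (m + 1) \<otimes> e [^] (n + 1)) (g \<otimes> h)" using c by simp
    have "le (g \<otimes> h) (e [^] (m + 1) \<otimes> h)"
      using total[of "e [^] (m + 1)" g] m right e gh by auto
    then have "le (e [^] (m + 1) \<otimes> e [^] (n + 1)) (e [^] (m + 1) \<otimes> h)"
      using trans[OF _ _ _ *] e gh by simp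
    then show False using left' n e gh by (meson int_pow_closed)
  qed
  \<comment> \<open>For \<open>e\<close> strictly between \<one> and \<open>c\<close>, the smaller
    of \<open>d\<close> and \<open>e\<close> has its square at most
    \<open>d \<otimes> e = c\<close>, against \<open>A\<close>. Thus \<open>c\<close> is a least
    positive element.\<close>
  have B: "le e \<one> \<or> le c e" if e: "e \<in> carrier G" for e
  proof (rule ccontr)
    assume "\<not> (le e \<one> \<or> le c e)"
    then have 1: "\<not> le e \<one>" "\<not> le c e" by auto
    define d where "d = c \<otimes> inv e"
    have d: "d \<in> carrier G" "d \<otimes> e = c" using e c by (auto simp: d_def m_assoc)
    have "\<not> le d \<one>" using right[of d \<one> e] d e 1 by auto
    then have "\<not> le (d \<otimes> d) (d \<otimes> e)" "\<not> le (e \<otimes> e) (d \<otimes> e)" using A d e 1 by auto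
    then show False using total[of d e] left[of d e d] right[of e d e] d e by auto
  qed
  \<comment> \<open>Dividing \<open>x\<close> by the largest power of \<open>c\<close> below it
    leaves a remainder smaller than the least positive element. So every element is equivalent to a
    power of \<open>c\<close>, and powers of \<open>c\<close> commute.\<close>
  have C: "\<exists>m::int. le (c [^] m) x \<and> le x (c [^] m)" if x: "x \<in> carrier G" for x
  proof -
    obtain m :: int where m: "le (c [^] m) x" "\<not> le (c [^] (m + 1)) x" using bracket[OF c(1) c1 x] by blast
    have "\<not> le c (inv (c [^] m) \<otimes> x)"
    proof
      assume "le c (inv (c [^] m) \<otimes> x)"
      then have "le (c [^] m \<otimes> c) x"
        using left[of c "inv (c [^] m) \<otimes> x" "c [^] m"] c x by (simp add: mult_inv_cancel)
      moreover have "c [^] m \<otimes> c = c [^] (m + 1)"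
        using c int_pow_mult[of c m 1] by simp
      ultimately show False using m by simp
    qed
    then have "le (inv (c [^] m) \<otimes> x) \<one>" using B[of "inv (c [^] m) \<otimes> x"] c(1) x by auto
    then have "le x (c [^] m)"
      using left[of "inv (c [^] m) \<otimes> x" \<one> "c [^] m"] c x by (simp add: mult_inv_cancel)
    then show ?thesis using m by blast
  qed
  obtain m :: int where m: "le (c [^] m) g" "le g (c [^] m)" using C[OF gh(1)] by blast
  obtain n :: int where n: "le (c [^] n) h" "le h (c [^] n)" using C[OF gh(2)] by blast
  have "le (g \<otimes> h) (c [^] m \<otimes> c [^] n)" "le (c [^] n \<otimes> c [^] m) (h \<otimes> g)"
    using mult m n c gh by auto
  moreover have "c [^] m \<otimes> c [^] n = c [^] n \<otimes> c [^] m"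
    using c by (simp add: int_pow_mult[symmetric] add.commute)
  ultimately show False
    using contra trans[of "g \<otimes> h" "c [^] m \<otimes> c [^] n" "h \<otimes> g"] c gh by auto
qed

end

section \<open>Actions with bounded distortion\<close>

text \<open>The only consequence of the regularity of a local diffeomorphism that is used.\<close>

definition tame_with :: "real \<Rightarrow> real \<Rightarrow> real set \<Rightarrow> (real \<Rightarrow> real) \<Rightarrow> bool" where
  "tame_with e L K s \<longleftrightarrow> (\<forall>a b. b - a < e \<longrightarrow>
     (strict_mono_on (K \<inter> {a..b}) s \<or> strict_antimono_on (K \<inter> {a..b}) s) \<and>
     (\<forall>t\<in>K \<inter> {a..b}. \<forall>z\<in>K \<inter> {a..b}. \<forall>t'\<in>K \<inter> {a..b}. \<forall>z'\<in>K \<inter> {a..b}.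
        \<bar>s t - s z\<bar> * \<bar>t' - z'\<bar> \<le> exp (L * (b - a)) * \<bar>s t' - s z'\<bar> * \<bar>t - z\<bar>))"

definition tame :: "real set \<Rightarrow> (real \<Rightarrow> real) \<Rightarrow> bool" where
  "tame K s \<longleftrightarrow> (\<exists>e>0. \<exists>L\<ge>0. tame_with e L K s)"

lemma tame_withD:
  assumes "tame_with e L K s" "b - a < e"
  shows "strict_mono_on (K \<inter> {a..b}) s \<or> strict_antimono_on (K \<inter> {a..b}) s"
    "t \<in> K \<inter> {a..b} \<Longrightarrow> z \<in> K \<inter> {a..b} \<Longrightarrow> t' \<in> K \<inter> {a..b} \<Longrightarrow> z' \<in> K \<inter> {a..b} \<Longrightarrow>
      \<bar>s t - s z\<bar> * \<bar>t' - z'\<bar> \<le> exp (L * (b - a)) * \<bar>s t' - s z'\<bar> * \<bar>t - z\<bar>"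
  using assms unfolding tame_with_def by blast+

lemma tame_with_mono:
  assumes "tame_with e L K s" "e' \<le> e" "L \<le> L'"
  shows "tame_with e' L' K s"
  unfolding tame_with_def
proof (intro allI impI conjI ballI)
  fix a b assume "b - a < e'"
  then have ab: "b - a < e" using assms by simp
  show "strict_mono_on (K \<inter> {a..b}) s \<or> strict_antimono_on (K \<inter> {a..b}) s"
    by (rule tame_withD(1)[OF assms(1) ab])
  fix t z t' z'
  assume t: "t \<in> K \<inter> {a..b}" and *: "z \<in> K \<inter> {a..b}" "t' \<in> K \<inter> {a..b}" "z' \<in> K \<inter> {a..b}"
  have "\<bar>s t - s z\<bar> * \<bar>t' - z'\<bar> \<le> exp (L * (b - a)) * \<bar>s t' - s z'\<bar> * \<bar>t - z\<bar>"
    by (rule tame_withD(2)[OF assms(1) ab t *])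
  also have "\<dots> \<le> exp (L' * (b - a)) * \<bar>s t' - s z'\<bar> * \<bar>t - z\<bar>"
    using t assms(3) by (intro mult_right_mono) (auto intro!: mult_right_mono)
  finally show "\<bar>s t - s z\<bar> * \<bar>t' - z'\<bar> \<le> exp (L' * (b - a)) * \<bar>s t' - s z'\<bar> * \<bar>t - z\<bar>" .
qed

lemma tame_uniform:
  assumes "finite A" "\<And>s. s \<in> A \<Longrightarrow> tame K (F s)"
  obtains e L where "e > 0" "L \<ge> 0" "\<And>s. s \<in> A \<Longrightarrow> tame_with e L K (F s)"
proof -
  have "\<exists>e>0. \<exists>L\<ge>0. \<forall>s\<in>A. tame_with e L K (F s)"
    using assms
  proof (induction A)
    case empty
    then show ?case by (auto intro: exI[of _ 1])
  next
    case (insert a A)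
    obtain e L where 1: "e > 0" "L \<ge> 0" "\<forall>s\<in>A. tame_with e L K (F s)" using insert by auto
    obtain e' L' where 2: "e' > 0" "L' \<ge> 0" "tame_with e' L' K (F a)"
      using insert.prems[of a] unfolding tame_def by auto
    show ?case
      by (rule exI[of _ "min e e'"], rule conjI, use 1 2 in simp, rule exI[of _ "max L L'"])
        (use 1 2 in \<open>auto intro: tame_with_mono\<close>)
  qed
  then show ?thesis using that by blast
qed

section \<open>Reflection in the origin, which transfers statements about right sides to left
  sides\<close>

lemma uminus_image_Int: "uminus ` K \<inter> {a..b} = uminus ` (K \<inter> {-b..-a})" for K :: "real set"
  by force

lemma strict_mono_on_reflect:
  "strict_mono_on (uminus ` K \<inter> {a..b}) (\<lambda>x. - s (- x)) \<longleftrightarrow> strict_mono_on (K \<inter> {-b..-a}) s"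
  for s :: "real \<Rightarrow> real"
  unfolding uminus_image_Int by (auto simp: monotone_on_def)

lemma tame_reflect:
  assumes "tame K s"
  shows "tame (uminus ` K) (\<lambda>x. - s (- x))"
proof -
  obtain e L where e: "e > 0" "L \<ge> 0" and *: "tame_with e L K s"
    using assms unfolding tame_def by blast
  have "tame_with e L (uminus ` K) (\<lambda>x. - s (- x))" unfolding tame_with_def
  proof (intro conjI allI impI)
    fix a b :: real assume ab: "b - a < e"
    then have ab': "-a - (-b) < e" by simp
    show "strict_mono_on (uminus ` K \<inter> {a..b}) (\<lambda>x. - s (- x)) \<or>
       strict_antimono_on (uminus ` K \<inter> {a..b}) (\<lambda>x. - s (- x))"
      using tame_withD(1)[OF * ab'] unfolding uminus_image_Int by (auto simp: monotone_on_def)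
    show "\<forall>t\<in>uminus ` K \<inter> {a..b}. \<forall>z\<in>uminus ` K \<inter> {a..b}. \<forall>t'\<in>uminus ` K \<inter> {a..b}.
      \<forall>z'\<in>uminus ` K \<inter> {a..b}. \<bar>- s (- t) - - s (- z)\<bar> * \<bar>t' - z'\<bar>
        \<le> exp (L * (b - a)) * \<bar>- s (- t') - - s (- z')\<bar> * \<bar>t - z\<bar>"
      using tame_withD(2)[OF * ab'] unfolding uminus_image_Int
      by (simp add: abs_minus_commute)
  qed
  then show ?thesis using e unfolding tame_def by blast
qed

text \<open>An abstract action instead of a group of maps: the same results are instantiated for the
  reflected set and for subgroups of finite index. \<open>gap_K\<close> is the form in which total
  disconnectedness is used.\<close>

locale lip_action = group G for G (structure) +
  fixes K :: "real set" and act :: "'a \<Rightarrow> real \<Rightarrow> real"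
  assumes compact_K: "compact K"
    and gap_K: "\<And>a b. a \<in> K \<Longrightarrow> b \<in> K \<Longrightarrow> a < b \<Longrightarrow> \<exists>t. a < t \<and> t < b \<and> t \<notin> K"
    and act_in [simp]: "\<And>g x. g \<in> carrier G \<Longrightarrow> x \<in> K \<Longrightarrow> act g x \<in> K"
    and act_one [simp]: "\<And>x. x \<in> K \<Longrightarrow> act \<one> x = x"
    and act_mult: "\<And>g h x. g \<in> carrier G \<Longrightarrow> h \<in> carrier G \<Longrightarrow> x \<in> K \<Longrightarrow>
      act (g \<otimes> h) x = act g (act h x)"
    and act_cont: "\<And>g. g \<in> carrier G \<Longrightarrow> continuous_on K (act g)"
    and act_tame: "\<And>g. g \<in> carrier G \<Longrightarrow> tame K (act g)"
begin

declare nat_pow_Suc [simp del] Group.nat_pow_Suc [simp del]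

lemma closed_K: "closed K" using compact_K compact_imp_closed by blast

lemma act_inv [simp]:
  assumes "g \<in> carrier G" "x \<in> K"
  shows "act (inv g) (act g x) = x" "act g (act (inv g) x) = x"
  using assms act_mult[of "inv g" g x] act_mult[of g "inv g" x] by auto

lemma act_eq_iff [simp]:
  "g \<in> carrier G \<Longrightarrow> x \<in> K \<Longrightarrow> y \<in> K \<Longrightarrow> act g x = act g y \<longleftrightarrow> x = y"
  by (metis act_inv(1))

lemma act_inv_fixed: "g \<in> carrier G \<Longrightarrow> x \<in> K \<Longrightarrow> act g x = x \<Longrightarrow> act (inv g) x = x"
  by (metis act_inv(1))

lemma act_pow_Suc:
  assumes "g \<in> carrier G" "x \<in> K"
  shows "act (g [^] Suc n) x = act g (act (g [^] n) x)" "act (g [^] Suc n) x = act (g [^] n) (act g x)"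
  using assms act_mult[of g "g [^] n" x] act_mult[of "g [^] n" g x] nat_pow_Suc2[of g n] by (auto simp: nat_pow_Suc)

lemma act_pow_fixed: "g \<in> carrier G \<Longrightarrow> x \<in> K \<Longrightarrow> act g x = x \<Longrightarrow> act (g [^] (n::nat)) x = x"
  by (induction n) (simp_all add: act_pow_Suc)

lemma act_pow_add:
  assumes "g \<in> carrier G" "x \<in> K"
  shows "act (g [^] (m + n :: nat)) x = act (g [^] m) (act (g [^] n) x)"
  using assms act_mult by (simp add: nat_pow_mult[symmetric])

lemma act_pow_inv [simp]:
  assumes "g \<in> carrier G" "x \<in> K"
  shows "act (g [^] n) (act (inv g [^] (n::nat)) x) = x" "act (inv g [^] n) (act (g [^] (n::nat)) x) = x"
  using assms by (simp_all add: nat_pow_inv)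

lemma lip_action_reflect: "lip_action G (uminus ` K) (\<lambda>g x. - act g (- x))"
proof unfold_locales
  show "compact (uminus ` K)" by (rule compact_negations[OF compact_K])
  show "\<exists>t. a < t \<and> t < b \<and> t \<notin> uminus ` K"
    if "a \<in> uminus ` K" "b \<in> uminus ` K" "a < b" for a b
  proof -
    have "-b \<in> K" "-a \<in> K" "-b < -a" using that by auto
    then obtain t where "-b < t" "t < -a" "t \<notin> K" using gap_K by blast
    then show ?thesis by (intro exI[of _ "-t"]) auto
  qed
  show "continuous_on (uminus ` K) (\<lambda>x. - act g (- x))" if "g \<in> carrier G" for g
    by (intro continuous_on_minus continuous_on_compose2[OF act_cont[OF that]] continuous_on_id) auto
  show "tame (uminus ` K) (\<lambda>x. - act g (- x))" if "g \<in> carrier G" for g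
    by (rule tame_reflect[OF act_tame[OF that]])
qed (auto simp: act_mult)

lemma lip_action_subgroup:
  assumes "subgroup H G"
  shows "lip_action (G\<lparr>carrier := H\<rparr>) K act"
proof -
  interpret H: group "G\<lparr>carrier := H\<rparr>" by (rule subgroup_imp_group[OF assms])
  have "H \<subseteq> carrier G" by (rule subgroup.subset[OF assms])
  then show ?thesis
    by unfold_locales (simp_all add: compact_K gap_K act_mult act_cont act_tame subset_iff)
qed

text \<open>The two end conditions make \<open>K \<inter> {u..w}\<close> invariant, so that
  monotonicity passes to the iterates.\<close>

lemma pow_mono:
  assumes f: "f \<in> carrier G" and m: "strict_mono_on (K \<inter> {u..w}) (act f)"
    and u: "u \<in> K" "u \<le> act f u" and w: "w \<in> K" "act f w \<le> w"
  shows "strict_mono_on (K \<inter> {u..w}) (act (f [^] (n::nat)))"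
    "x \<in> K \<inter> {u..w} \<Longrightarrow> act (f [^] n) x \<in> K \<inter> {u..w}"
proof -
  have in1: "act f x \<in> K \<inter> {u..w}" if "x \<in> K \<inter> {u..w}" for x
  proof -
    have "act f u \<le> act f x" "act f x \<le> act f w"
      using strict_mono_on_leD[OF m, of u x] strict_mono_on_leD[OF m, of x w] that u w by auto
    then show ?thesis using f that u w by auto
  qed
  have in2: "act (f [^] n) x \<in> K \<inter> {u..w}" if "x \<in> K \<inter> {u..w}" for x and n :: nat
    using that
  proof (induction n)
    case (Suc n)
    then have "act f (act (f [^] n) x) \<in> K \<inter> {u..w}" using in1 by blast
    then show ?case using f that by (simp add: act_pow_Suc)
  qed simp
  then show "x \<in> K \<inter> {u..w} \<Longrightarrow> act (f [^] n) x \<in> K \<inter> {u..w}" .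
  show "strict_mono_on (K \<inter> {u..w}) (act (f [^] n))"
  proof (induction n)
    case 0
    then show ?case by (auto simp: monotone_on_def)
  next
    case (Suc n)
    show ?case
    proof (rule strict_mono_onI)
      fix r s assume rs: "r \<in> K \<inter> {u..w}" "s \<in> K \<inter> {u..w}" "r < s"
      then have "act f (act (f [^] n) r) < act f (act (f [^] n) s)"
        using in2 strict_mono_onD[OF Suc] strict_mono_onD[OF m] by blast
      then show "act (f [^] Suc n) r < act (f [^] Suc n) s"
        using f rs by (simp add: act_pow_Suc)
    qed
  qed
qed

text \<open>Ping-pong between a power \<open>a\<close> of \<open>f\<close>, which crushes the
  interval towards \<open>u\<close>, and \<open>g \<otimes> a\<close>, which crushes it and then
  carries it to the right of \<open>act g u\<close>. The images are disjoint once
  \<open>act a w\<close> lies to the left of \<open>act g u\<close>.\<close>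

lemma crossing:
  assumes f: "f \<in> carrier G" and g: "g \<in> carrier G"
    and u: "u \<in> K" "act f u = u" and w: "w \<in> K" "act f w \<le> w"
    and fm: "strict_mono_on (K \<inter> {u..w}) (act f)"
    and attr: "\<And>y. u < y \<Longrightarrow> \<exists>n::nat. act (f [^] n) w < y"
    and gm: "strict_mono_on (K \<inter> {u..w}) (act g)"
    and gu: "u < act g u" "act g u < w"
  shows "contains_free_subsemigroup_2 G"
proof -
  \<comment> \<open>By continuity at \<open>u\<close>, points closer than \<open>d\<close> to
    \<open>u\<close> are still sent below \<open>w\<close>; this keeps the image under
    \<open>g \<otimes> a\<close> inside the interval.\<close>
  obtain d where d: "d > 0" "\<And>x. x \<in> K \<Longrightarrow> dist x u < d \<Longrightarrow> dist (act g x) (act g u) < w - act g u"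
    using act_cont[OF g] u gu unfolding continuous_on_iff by (metis diff_gt_0_iff_gt)
  obtain n :: nat where n: "act (f [^] n) w < min (u + d) (act g u)"
    using attr[of "min (u + d) (act g u)"] d gu by auto
  have u': "u \<le> act f u" using u by simp
  define a where "a = f [^] n"
  define C where "C = K \<inter> {u..w}"
  have uw: "u \<in> C" "w \<in> C" using u w gu by (auto simp: C_def)
  have a: "a \<in> carrier G" using f by (simp add: a_def)
  have aC: "act a x \<in> K \<inter> {u..act a w}" if "x \<in> C" for x
    using pow_mono(2)[OF f fm u(1) u' w, of x n] that uw a
      strict_mono_on_leD[OF pow_mono(1)[OF f fm u(1) u' w, of n], of x w]
    by (auto simp: C_def a_def)
  have gaC: "act (g \<otimes> a) x \<in> K \<inter> {act g u..w}" if "x \<in> C" for x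
  proof -
    have ax: "act a x \<in> C" "dist (act a x) u < d"
      using aC[OF that] n aC[OF uw(2)] gu by (auto simp: C_def a_def dist_real_def)
    have "act g u \<le> act g (act a x)"
      by (rule strict_mono_on_leD[OF gm]) (use ax uw in \<open>auto simp: C_def\<close>)
    moreover have "act g (act a x) < w"
      using d(2)[of "act a x"] ax by (auto simp: C_def dist_real_def)
    moreover have "x \<in> K" using that by (simp add: C_def)
    ultimately show ?thesis using a g by (simp add: act_mult)
  qed
  show ?thesis
  proof (rule ping_pong_free[where act = act and a = a and b = "g \<otimes> a" and C = C and A = "K \<inter> {u..act a w}" and B = "K \<inter> {act g u..w}"])
    show "K \<inter> {u..act a w} \<subseteq> C" "K \<inter> {act g u..w} \<subseteq> C" "K \<inter> {u..act a w} \<inter> (K \<inter> {act g u..w}) = {}"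
      using n gu by (auto simp: C_def a_def)
    show "C \<noteq> {}" using uw by blast
  qed (use a g aC gaC act_mult in \<open>auto simp: C_def\<close>)
qed

section \<open>Components of the complement of the fixed point set\<close>

text \<open>The orbit of \<open>x\<close> decreases and stays in the closed set \<open>K\<close>, so
  its limit is a fixed point by continuity. On the disconnected set \<open>K\<close> this replaces
  the intermediate value theorem.\<close>

lemma attractor:
  assumes f: "f \<in> carrier G" and \<alpha>: "\<alpha> \<in> K" "\<alpha> \<le> act f \<alpha>" and x: "x \<in> K" "\<alpha> \<le> x" "act f x < x"
    and m: "strict_mono_on (K \<inter> {\<alpha>..x}) (act f)"
  obtains u where "u \<in> K" "\<alpha> \<le> u" "u < x" "act f u = u"
    "\<And>y. u < y \<Longrightarrow> \<exists>n::nat. act (f [^] n) x < y"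
proof -
  define X where "X n = act (f [^] n) x" for n :: nat
  define u where "u = (INF n. X n)"
  have fx: "act f x \<le> x" using x by simp
  have X_in: "X n \<in> K \<inter> {\<alpha>..x}" for n
    unfolding X_def using pow_mono(2)[OF f m \<alpha> x(1) fx, of x n] x by simp
  have X_Suc: "X (Suc n) = act f (X n)" for n
    using f x by (simp add: X_def act_pow_Suc)
  have "X (Suc n) \<le> X n" for n
  proof (induction n)
    case 0
    then show ?case using f x by (simp add: X_def act_pow_Suc)
  next
    case (Suc n)
    then show ?case using strict_mono_on_leD[OF m X_in X_in Suc] by (simp add: X_Suc)
  qed
  then have dec: "decseq X" by (simp add: decseq_SucI)
  have bdd: "bdd_below (range X)" using X_in by (intro bdd_belowI[of _ \<alpha>]) auto
  have lim: "X \<longlonglongrightarrow> u" unfolding u_def by (rule LIMSEQ_decseq_INF[OF bdd dec])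
  have u: "u \<in> K" using closed_sequentially[OF closed_K _ lim] X_in by blast
  have u_le: "u \<le> X n" for n unfolding u_def by (rule cINF_lower[OF bdd]) simp
  have "(\<lambda>n. act f (X n)) \<longlonglongrightarrow> act f u"
    using act_cont[OF f] u X_in lim unfolding continuous_on_sequentially comp_def by blast
  moreover have "(\<lambda>n. act f (X n)) \<longlonglongrightarrow> u"
    using LIMSEQ_Suc[OF lim] by (simp add: X_Suc)
  ultimately have "act f u = u" using LIMSEQ_unique by blast
  moreover have "\<alpha> \<le> u" unfolding u_def using X_in by (intro cINF_greatest) auto
  moreover have "u \<le> act f x" using u_le[of "Suc 0"] X_Suc[of 0] x by (simp add: X_def[of 0])
  then have "u < x" using x by simp
  moreover have "\<exists>n::nat. act (f [^] n) x < y" if "u < y" for y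
    using that cINF_less_iff[OF _ bdd, of y] by (auto simp: u_def X_def)
  ultimately show ?thesis using u that by blast
qed

text \<open>Meant for increasing \<open>f\<close> that moves points between \<open>u\<close> and
  \<open>v\<close> to the left. Convergence of the iterates is required, and not merely absence of
  fixed points, since convergence is what \<open>crossing\<close> consumes.\<close>

definition component :: "'a \<Rightarrow> real \<Rightarrow> real \<Rightarrow> bool" where
  "component f u v \<longleftrightarrow> f \<in> carrier G \<and> u \<in> K \<and> v \<in> K \<and> u < v \<and> act f u = u \<and> act f v = v \<and>
     (\<forall>t\<in>K. u \<le> t \<and> t < v \<longrightarrow> (\<forall>y>u. \<exists>n::nat. act (f [^] n) t < y)) \<and>
     (\<forall>t\<in>K. u < t \<and> t \<le> v \<longrightarrow> (\<forall>y<v. \<exists>n::nat. y < act (inv f [^] n) t))"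

text \<open>\<open>u\<close> is the limit of the orbit of \<open>x\<close> under \<open>f\<close>,
  and \<open>v\<close> the limit under \<open>inv f\<close>, obtained by applying
  \<open>attractor\<close> to the reflected action.\<close>

lemma component_exists:
  assumes f: "f \<in> carrier G" and \<alpha>: "\<alpha> \<in> K" "act f \<alpha> = \<alpha>" and \<beta>: "\<beta> \<in> K" "act f \<beta> = \<beta>"
    and x: "x \<in> K" "\<alpha> \<le> x" "x \<le> \<beta>" "act f x < x"
    and m: "strict_mono_on (K \<inter> {\<alpha>..\<beta>}) (act f)" and m': "strict_mono_on (K \<inter> {\<alpha>..\<beta>}) (act (inv f))"
  obtains u v where "component f u v" "\<alpha> \<le> u" "u < x" "x < v" "v \<le> \<beta>"
proof -
  have sub: "strict_mono_on (K \<inter> {\<alpha>..x}) (act f)" "strict_mono_on (K \<inter> {x..\<beta>}) (act (inv f))"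
    using m m' x by (auto intro: monotone_on_subset)
  obtain u where u: "u \<in> K" "\<alpha> \<le> u" "u < x" "act f u = u"
    "\<And>y. u < y \<Longrightarrow> \<exists>n::nat. act (f [^] n) x < y"
    using attractor[OF f \<alpha>(1) _ x(1,2,4) sub(1)] \<alpha> by auto
  interpret R: lip_action G "uminus ` K" "\<lambda>g x. - act g (- x)" by (rule lip_action_reflect)
  have if': "inv f \<in> carrier G" using f by simp
  have xx: "x < act (inv f) x"
  proof -
    have "act f \<alpha> \<le> act f x" using strict_mono_on_leD[OF m, of \<alpha> x] \<alpha> x by auto
    then have "act (inv f) (act f x) < act (inv f) x"
      using strict_mono_onD[OF m', of "act f x" x] x f \<alpha> by auto
    then show ?thesis using f x by simp
  qed
  obtain v' where v': "v' \<in> uminus ` K" "- \<beta> \<le> v'" "v' < - x" "- act (inv f) (- v') = v'"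
    "\<And>y. v' < y \<Longrightarrow> \<exists>n::nat. - act (inv f [^] n) (- (- x)) < y"
  proof (rule R.attractor[OF if', of "-\<beta>" "-x"])
    show "strict_mono_on (uminus ` K \<inter> {- \<beta>..- x}) (\<lambda>x. - act (inv f) (- x))"
      using sub(2) by (simp add: strict_mono_on_reflect)
  qed (use x xx \<beta> f act_inv_fixed in auto)
  define v where "v = - v'"
  have v: "v \<in> K" "v \<le> \<beta>" "x < v" "act (inv f) v = v"
    "\<And>y. y < v \<Longrightarrow> \<exists>n::nat. y < act (inv f [^] n) x"
    using v' v'(5)[of "- _"] by (auto simp: v_def)
  have fv: "act f v = v" using v f by (metis act_inv(2))
  have mono_n: "act (f [^] n) s \<le> act (f [^] n) t" if "s \<in> K" "t \<in> K" "\<alpha> \<le> s" "s \<le> t" "t \<le> \<beta>" for s t and n :: nat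
    using strict_mono_on_leD[OF pow_mono(1)[OF f m \<alpha>(1) _ \<beta>(1)], of s t n] \<alpha> \<beta> that by auto
  have mono_n': "act (inv f [^] n) s \<le> act (inv f [^] n) t" if "s \<in> K" "t \<in> K" "\<alpha> \<le> s" "s \<le> t" "t \<le> \<beta>" for s t and n :: nat
    using strict_mono_on_leD[OF pow_mono(1)[OF if' m' \<alpha>(1) _ \<beta>(1)], of s t n] \<alpha> \<beta> that f act_inv_fixed by auto
  \<comment> \<open>A point \<open>t\<close> below \<open>v\<close> lies under some backward iterate
    of \<open>x\<close>, so its forward orbit is dominated by a delayed orbit of
    \<open>x\<close>.\<close>
  have "\<exists>n::nat. act (f [^] n) t < y" if t: "t \<in> K" "u \<le> t" "t < v" and y: "u < y" for t y
  proof -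
    obtain i :: nat where i: "t < act (inv f [^] i) x" using v(5) t by blast
    obtain j :: nat where j: "act (f [^] j) x < y" using u(5) y by blast
    have ix: "act (inv f [^] i) x \<in> K" "act (inv f [^] i) x \<le> \<beta>"
      using pow_mono(2)[OF if' m' \<alpha>(1) _ \<beta>(1), of x i] x \<alpha> \<beta> f act_inv_fixed by auto
    have "act (f [^] (j + i)) t \<le> act (f [^] (j + i)) (act (inv f [^] i) x)"
      by (rule mono_n) (use t u i ix in auto)
    also have "\<dots> = act (f [^] j) x" using f x by (simp add: act_pow_add)
    finally show ?thesis using j by (meson le_less_trans)
  qed
  moreover have "\<exists>n::nat. y < act (inv f [^] n) t" if t: "t \<in> K" "u < t" "t \<le> v" and y: "y < v" for t y
  proof -
    obtain i :: nat where i: "act (f [^] i) x < t" using u(5) t by blast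
    obtain j :: nat where j: "y < act (inv f [^] j) x" using v(5) y by blast
    have ix: "act (f [^] i) x \<in> K" "\<alpha> \<le> act (f [^] i) x"
      using pow_mono(2)[OF f m \<alpha>(1) _ \<beta>(1), of x i] x \<alpha> \<beta> f by auto
    have "act (inv f [^] (j + i)) (act (f [^] i) x) \<le> act (inv f [^] (j + i)) t"
      by (rule mono_n') (use t v i ix in auto)
    moreover have "act (inv f [^] (j + i)) (act (f [^] i) x) = act (inv f [^] j) x"
      using f x by (simp add: act_pow_add)
    ultimately show ?thesis using j by (metis less_le_trans)
  qed
  ultimately have "component f u v"
    using f u v fv unfolding component_def by auto
  then show ?thesis using that u v by blast
qed

lemma component_less:
  assumes c: "component f u v" and m: "strict_mono_on (K \<inter> {u..v}) (act f)"
    and t: "t \<in> K" "u < t" "t < v"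
  shows "act f t < t"
proof (rule ccontr)
  assume "\<not> act f t < t"
  then have ft: "t \<le> act f t" by simp
  have f: "f \<in> carrier G" and v: "v \<in> K" "act f v = v" and u: "u \<in> K"
    using c by (auto simp: component_def)
  have m': "strict_mono_on (K \<inter> {t..v}) (act f)" using m t by (auto intro: monotone_on_subset)
  have "t \<le> act (f [^] n) t" for n :: nat
    using pow_mono(2)[OF f m' t(1) ft v(1), of t n] v t by auto
  moreover have "\<exists>n::nat. act (f [^] n) t < t" using c t by (auto simp: component_def)
  ultimately show False by (meson not_le)
qed

lemma component_reflect:
  assumes "component f u v"
  shows "lip_action.component G (uminus ` K) (\<lambda>g x. - act g (- x)) (inv f) (- v) (- u)"
proof -
  interpret R: lip_action G "uminus ` K" "\<lambda>g x. - act g (- x)" by (rule lip_action_reflect)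
  have f: "f \<in> carrier G" and uv: "u \<in> K" "v \<in> K" "u < v" "act f u = u" "act f v = v"
    and 1: "\<And>t y. t \<in> K \<Longrightarrow> u \<le> t \<Longrightarrow> t < v \<Longrightarrow> u < y \<Longrightarrow> \<exists>n::nat. act (f [^] n) t < y"
    and 2: "\<And>t y. t \<in> K \<Longrightarrow> u < t \<Longrightarrow> t \<le> v \<Longrightarrow> y < v \<Longrightarrow> \<exists>n::nat. y < act (inv f [^] n) t"
    using assms by (auto simp: component_def)
  have "\<exists>n::nat. - act (inv f [^] n) (- t) < y" if "t \<in> uminus ` K" "- v \<le> t" "t < - u" "- v < y" for t y
    using 2[of "- t" "- y"] that by (auto simp: minus_less_iff)
  moreover have "\<exists>n::nat. y < - act (f [^] n) (- t)" if "t \<in> uminus ` K" "- v < t" "t \<le> - u" "y < - u" for t y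
    using 1[of "- t" "- y"] that by (auto simp: less_minus_iff)
  ultimately show ?thesis
    using f uv act_inv_fixed unfolding R.component_def by auto
qed

text \<open>\<open>crossing\<close> asks for a right end beyond \<open>act g u\<close> that
  \<open>f\<close> pulls all the way to \<open>u\<close>. Since \<open>f\<close> fixes
  \<open>v\<close>, a backward iterate of \<open>act g u\<close> is taken as that end.\<close>

lemma component_no_crossing_left:
  assumes nf: "\<not> contains_free_subsemigroup_2 G" and c: "component f u v" and g: "g \<in> carrier G"
    and m: "strict_mono_on (K \<inter> {u..v}) (act f)" "strict_mono_on (K \<inter> {u..v}) (act (inv f))"
      "strict_mono_on (K \<inter> {u..v}) (act g)"
  shows "\<not> (u < act g u \<and> act g u < v)"
proof
  assume gu: "u < act g u \<and> act g u < v"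
  have f: "f \<in> carrier G" "inv f \<in> carrier G" and uv: "u \<in> K" "v \<in> K" "u < v" "act f u = u" "act f v = v"
    and attr: "\<And>t y. t \<in> K \<Longrightarrow> u \<le> t \<Longrightarrow> t < v \<Longrightarrow> u < y \<Longrightarrow> \<exists>n::nat. act (f [^] n) t < y"
    and 2: "\<And>t y. t \<in> K \<Longrightarrow> u < t \<Longrightarrow> t \<le> v \<Longrightarrow> y < v \<Longrightarrow> \<exists>n::nat. y < act (inv f [^] n) t"
    using c by (auto simp: component_def)
  have guK: "act g u \<in> K" using g uv by simp
  obtain n :: nat where n: "act g u < act (inv f [^] n) (act g u)" using 2[OF guK, of "act g u"] gu by auto
  define w where "w = act (inv f [^] n) (act g u)"
  have "w \<in> K \<inter> {u..v}"
    unfolding w_def using pow_mono(2)[OF f(2) m(2) uv(1) _ uv(2), of "act g u" n] gu guK uv f act_inv_fixed by auto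
  moreover have "w \<noteq> v"
  proof
    assume "w = v"
    then have "act (f [^] n) w = v" using uv f by (simp add: act_pow_fixed)
    then show False using guK f gu by (simp add: w_def)
  qed
  ultimately have w: "w \<in> K" "u \<le> w" "w < v" by auto
  have wu: "act g u < w" using n by (simp add: w_def)
  then have "act f w < w" using component_less[OF c m(1) w(1)] w gu by auto
  then have "contains_free_subsemigroup_2 G"
    using w wu gu attr
    by (intro crossing[OF f(1) g uv(1,4) w(1), of]) (auto intro: monotone_on_subset[OF m(1)] monotone_on_subset[OF m(3)])
  then show False using nf by blast
qed

lemma component_no_crossing:
  assumes nf: "\<not> contains_free_subsemigroup_2 G" and c: "component f u v" and g: "g \<in> carrier G"
    and m: "strict_mono_on (K \<inter> {u..v}) (act f)" "strict_mono_on (K \<inter> {u..v}) (act (inv f))"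
      "strict_mono_on (K \<inter> {u..v}) (act g)"
  shows "\<not> (u < act g u \<and> act g u < v)" "\<not> (u < act g v \<and> act g v < v)"
proof -
  interpret R: lip_action G "uminus ` K" "\<lambda>g x. - act g (- x)" by (rule lip_action_reflect)
  show "\<not> (u < act g u \<and> act g u < v)" by (rule component_no_crossing_left[OF assms])
  have "f \<in> carrier G" using c by (simp add: component_def)
  then have "\<not> (- v < - act g (- (- v)) \<and> - act g (- (- v)) < - u)"
    by (intro R.component_no_crossing_left[OF nf component_reflect[OF c] g])
      (use m in \<open>simp_all add: strict_mono_on_reflect\<close>)
  then show "\<not> (u < act g v \<and> act g v < v)" by auto
qed

section \<open>Fixed sets, gaps and displacement estimates\<close>

lemma generate_fixes:
  assumes C: "C \<subseteq> carrier G" and x: "x \<in> K" and fx: "\<And>c. c \<in> C \<Longrightarrow> act c x = x"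
    and g: "g \<in> generate G C"
  shows "act g x = x"
  using g
proof (induction g rule: generate.induct)
  case (inv h)
  then show ?case using C x fx by (auto intro: act_inv_fixed)
next
  case (eng h1 h2)
  then have "h1 \<in> carrier G" "h2 \<in> carrier G" using generate_in_carrier[OF C] by blast+
  then show ?case using eng x by (simp add: act_mult)
qed (use x fx in auto)

lemma closed_fixed:
  assumes "g \<in> carrier G" "closed A"
  shows "closed {x \<in> K \<inter> A. act g x = x}"
proof -
  have "continuous_on (K \<inter> A) (\<lambda>x. act g x - x)"
    by (intro continuous_on_diff continuous_on_subset[OF act_cont] continuous_on_id) (use assms in auto)
  then have "closed {x \<in> K \<inter> A. act g x - x = 0}"
    by (rule continuous_closed_preimage_constant) (use closed_K assms in auto)
  then show ?thesis by simp
qed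

text \<open>A point outside \<open>K\<close> separates \<open>a\<close> from \<open>b\<close>; the
  nearest points of the closed set \<open>M\<close> on its two sides are the ends of a gap.\<close>

lemma gap_between:
  assumes M: "closed M" "M \<subseteq> K" and ab: "a \<in> M" "b \<in> M" "a < b"
  obtains c d where "c \<in> M" "d \<in> M" "a \<le> c" "c < d" "d \<le> b" "M \<inter> {c<..<d} = {}"
proof -
  obtain t where t: "a < t" "t < b" "t \<notin> K" using gap_K[of a b] ab M by blast
  define c where "c = Sup (M \<inter> {a..t})"
  define d where "d = Inf (M \<inter> {t..b})"
  have c_in: "c \<in> M \<inter> {a..t}" unfolding c_def
    by (rule closed_contains_Sup) (use ab t M in \<open>auto intro!: closed_Int bdd_above_Int2\<close>)
  have d_in: "d \<in> M \<inter> {t..b}" unfolding d_def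
    by (rule closed_contains_Inf) (use ab t M in \<open>auto intro!: closed_Int bdd_below_Int2\<close>)
  have c_ge: "z \<le> c" if "z \<in> M" "a \<le> z" "z \<le> t" for z
    unfolding c_def by (rule cSup_upper) (use that in auto)
  have d_le: "d \<le> z" if "z \<in> M" "t \<le> z" "z \<le> b" for z
    unfolding d_def by (rule cInf_lower) (use that in auto)
  have "M \<inter> {c<..<d} = {}"
  proof -
    have "\<not> (c < z \<and> z < d)" if "z \<in> M" for z
      using c_ge[of z] d_le[of z] that c_in d_in by (cases "z \<le> t") auto
    then show ?thesis by auto
  qed
  moreover have "c \<noteq> t" "d \<noteq> t" using c_in d_in t M by auto
  ultimately show ?thesis using that[of c d] c_in d_in by auto
qed

text \<open>A displacement shorter than the gap cannot carry an end across it, and the gap contains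
  no point of \<open>K\<close>, so the ends can only move outwards. If \<open>d\<close> did move,
  \<open>act (inv g) d\<close> would fall strictly inside the gap.\<close>

lemma gap_fixed:
  assumes g: "g \<in> carrier G" and cd: "c \<in> K" "d \<in> K" "c < d" "K \<inter> {c<..<d} = {}"
    and I: "a \<le> c" "d \<le> b" "strict_mono_on (K \<inter> {a..b}) (act g)" "strict_mono_on (K \<inter> {a..b}) (act (inv g))"
      "act g c \<in> {a..b}" "act g d \<in> {a..b}"
    and near: "\<bar>act g c - c\<bar> < d - c" "\<bar>act g d - d\<bar> < d - c"
  shows "act g d = d"
proof -
  have K: "act g c \<in> K" "act g d \<in> K" using g cd by auto
  have "act g c < d" "c < act g d" using near by auto
  then have 1: "act g c \<le> c" "d \<le> act g d" using cd K by force+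
  show ?thesis
  proof (rule ccontr)
    assume "act g d \<noteq> d"
    then have dd: "d < act g d" using 1 by simp
    have in_ab: "d \<in> K \<inter> {a..b}" "act g c \<in> K \<inter> {a..b}" "act g d \<in> K \<inter> {a..b}" using I cd K by auto
    have "act (inv g) (act g c) < act (inv g) d"
      by (rule strict_mono_onD[OF I(4) in_ab(2,1)]) (use 1 cd in simp)
    moreover have "act (inv g) d < act (inv g) (act g d)"
      by (rule strict_mono_onD[OF I(4) in_ab(1,3) dd])
    moreover have "act (inv g) d \<in> K" "act (inv g) (act g c) = c" "act (inv g) (act g d) = d"
      using g cd(1,2) by simp_all
    ultimately have "act (inv g) d \<in> K \<inter> {c<..<d}" by simp
    then show False using cd(4) by blast
  qed
qed

text \<open>Fixed ends force mean slope 1 on the interval, so bounded distortion bounds every secant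
  slope from an end. For short intervals the bound is quadratic in the length; it therefore becomes
  smaller than a gap that occupies a fixed proportion of the interval.\<close>

lemma fixed_ends_displacement:
  assumes tw: "tame_with e L K (act g)" and L: "L \<ge> 0"
    and uv: "u \<in> K" "v \<in> K" "u < v" "v - u < e" "act g u = u" "act g v = v"
    and m: "strict_mono_on (K \<inter> {u..v}) (act g)" and z: "z \<in> K" "u \<le> z" "z \<le> v"
  shows "\<bar>act g z - z\<bar> \<le> (exp (L * (v - u)) - 1) * (v - u)"
proof -
  let ?E = "exp (L * (v - u))"
  have gz: "u \<le> act g z" "act g z \<le> v"
    using strict_mono_on_leD[OF m, of u z] strict_mono_on_leD[OF m, of z v] uv z by auto
  have "\<bar>act g z - act g u\<bar> * \<bar>u - v\<bar> \<le> ?E * \<bar>act g u - act g v\<bar> * \<bar>z - u\<bar>"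
    using tame_withD(2)[OF tw uv(4), of z u u v] uv z by simp
  then have "(act g z - u) * (v - u) \<le> (?E * (z - u)) * (v - u)" using uv z gz by (simp add: mult_ac)
  then have 1: "act g z - u \<le> ?E * (z - u)" using uv by simp
  have "\<bar>act g z - act g v\<bar> * \<bar>u - v\<bar> \<le> ?E * \<bar>act g u - act g v\<bar> * \<bar>z - v\<bar>"
    using tame_withD(2)[OF tw uv(4), of z v u v] uv z by simp
  then have "(v - act g z) * (v - u) \<le> (?E * (v - z)) * (v - u)" using uv z gz by (simp add: mult_ac)
  then have 2: "v - act g z \<le> ?E * (v - z)" using uv by simp
  have "act g z - z \<le> (?E - 1) * (z - u)" "z - act g z \<le> (?E - 1) * (v - z)"
    using 1 2 by (simp_all add: algebra_simps)
  moreover have "?E \<ge> 1" using L uv by simp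
  then have "(?E - 1) * (z - u) \<le> (?E - 1) * (v - u)" "(?E - 1) * (v - z) \<le> (?E - 1) * (v - u)"
    using z by (auto intro!: mult_left_mono)
  ultimately show ?thesis by linarith
qed

end

section \<open>The germs at a common fixed point\<close>

locale germ_action = lip_action +
  fixes p :: real
  assumes nf: "\<not> contains_free_subsemigroup_2 G"
    and p_in: "p \<in> K"
    and p_lim: "\<And>e. e > 0 \<Longrightarrow> \<exists>t\<in>K. p < t \<and> t < p + e"
    and p_fixed [simp]: "\<And>g. g \<in> carrier G \<Longrightarrow> act g p = p"
    and p_mono: "\<And>g. g \<in> carrier G \<Longrightarrow> \<exists>e>0. strict_mono_on (K \<inter> {p..p + e}) (act g)"
begin

definition right_nhd :: "real filter" where
  "right_nhd = at p within (K \<inter> {p<..})"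

lemma eventually_right_nhd:
  "eventually P right_nhd \<longleftrightarrow> (\<exists>e>0. \<forall>t\<in>K. p < t \<and> t < p + e \<longrightarrow> P t)"
proof -
  have "(\<forall>x\<in>K \<inter> {p<..}. x \<noteq> p \<and> dist x p < e \<longrightarrow> P x) \<longleftrightarrow> (\<forall>t\<in>K. p < t \<and> t < p + e \<longrightarrow> P t)" for e
    by (auto simp: dist_real_def)
  then show ?thesis unfolding right_nhd_def eventually_at by simp
qed

lemma frequently_right_nhd:
  "frequently P right_nhd \<longleftrightarrow> (\<forall>e>0. \<exists>t\<in>K. p < t \<and> t < p + e \<and> P t)"
  unfolding frequently_def eventually_right_nhd by blast

lemma right_nhd_nontrivial: "right_nhd \<noteq> bot"
proof
  assume "right_nhd = bot"
  then have "eventually (\<lambda>_. False) right_nhd" by simp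
  then show False using p_lim unfolding eventually_right_nhd by blast
qed

lemma eventually_frequently_right: "eventually P right_nhd \<Longrightarrow> frequently P right_nhd"
  using eventually_frequently right_nhd_nontrivial by blast

lemma eventually_below:
  assumes "p < b"
  shows "eventually (\<lambda>t. t \<in> K \<and> p < t \<and> t < b) right_nhd"
  unfolding eventually_right_nhd by (rule exI[of _ "b - p"]) (use assms in auto)

text \<open>Both directions are recorded because the image of the interval under
  \<open>act g\<close> may be shorter than the interval, while monotonicity of the inverse is wanted
  on all of it.\<close>

definition mono_to :: "real \<Rightarrow> 'a \<Rightarrow> bool" where
  "mono_to b g \<longleftrightarrow> strict_mono_on (K \<inter> {p..b}) (act g) \<and> strict_mono_on (K \<inter> {p..b}) (act (inv g))"

lemma mono_to_le: "mono_to b g \<Longrightarrow> b' \<le> b \<Longrightarrow> mono_to b' g"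
  unfolding mono_to_def by (auto intro: monotone_on_subset)

lemma mono_to_inv: "g \<in> carrier G \<Longrightarrow> mono_to b g \<Longrightarrow> mono_to b (inv g)"
  by (simp add: mono_to_def)

lemma mono_to_exists:
  assumes "finite A" "A \<subseteq> carrier G"
  obtains b where "b > p" "\<And>g. g \<in> A \<Longrightarrow> mono_to b g"
proof -
  have "\<exists>b>p. \<forall>g\<in>A. mono_to b g"
    using assms
  proof (induction A)
    case empty
    show ?case by (rule exI[of _ "p + 1"]) simp
  next
    case (insert g A)
    then obtain b where b: "b > p" "\<forall>g\<in>A. mono_to b g" by auto
    obtain e1 where e1: "e1 > 0" "strict_mono_on (K \<inter> {p..p + e1}) (act g)"
      using p_mono[of g] insert by auto
    obtain e2 where e2: "e2 > 0" "strict_mono_on (K \<inter> {p..p + e2}) (act (inv g))"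
      using p_mono[of "inv g"] insert by auto
    have "mono_to (min b (p + min e1 e2)) g"
      unfolding mono_to_def
      by (auto intro!: monotone_on_subset[OF e1(2)] monotone_on_subset[OF e2(2)])
    then show ?case
      using b e1 e2 by (intro exI[of _ "min b (p + min e1 e2)"]) (auto intro: mono_to_le)
  qed
  then show ?thesis using that by blast
qed

lemma mono_to_gt:
  assumes "mono_to b g" "g \<in> carrier G" "t \<in> K" "p < t" "t \<le> b"
  shows "p < act g t" "p < act (inv g) t"
  using assms strict_mono_onD[of "K \<inter> {p..b}" "act g" p t]
    strict_mono_onD[of "K \<inter> {p..b}" "act (inv g)" p t] p_in
  by (auto simp: mono_to_def)

lemma mono_toD:
  assumes "mono_to b g" "s \<in> K" "t \<in> K" "p \<le> s" "s < t" "t \<le> b"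
  shows "act g s < act g t" "act (inv g) s < act (inv g) t"
  using assms strict_mono_onD[of "K \<inter> {p..b}" "act g" s t]
    strict_mono_onD[of "K \<inter> {p..b}" "act (inv g)" s t]
  by (auto simp: mono_to_def)

lemma act_right_nhd:
  assumes g: "g \<in> carrier G"
  shows "filterlim (act g) right_nhd right_nhd"
  unfolding filterlim_iff
proof (intro allI impI)
  fix P assume "eventually P right_nhd"
  then obtain e where e: "e > 0" "\<And>t. t \<in> K \<Longrightarrow> p < t \<Longrightarrow> t < p + e \<Longrightarrow> P t"
    unfolding eventually_right_nhd by blast
  obtain b where b: "b > p" "mono_to b g" using mono_to_exists[of "{g}"] g by auto
  obtain d where d: "d > 0" "\<And>t. t \<in> K \<Longrightarrow> dist t p < d \<Longrightarrow> dist (act g t) (act g p) < e"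
    using act_cont[OF g] p_in e unfolding continuous_on_iff by metis
  have "P (act g t)" if "t \<in> K" "p < t" "t < p + min d (b - p)" for t
  proof -
    have "dist t p < d" "t \<le> b" using that by (auto simp: dist_real_def)
    then have "\<bar>act g t - p\<bar> < e" "p < act g t"
      using d(2)[OF that(1)] mono_to_gt(1)[OF b(2) g that(1,2)] g by (auto simp: dist_real_def)
    then show ?thesis using that g by (intro e(2)) auto
  qed
  then show "eventually (\<lambda>t. P (act g t)) right_nhd"
    unfolding eventually_right_nhd using d b by (intro exI[of _ "min d (b - p)"]) auto
qed

lemma eventually_act:
  "g \<in> carrier G \<Longrightarrow> eventually P right_nhd \<Longrightarrow> eventually (\<lambda>t. P (act g t)) right_nhd"
  using act_right_nhd unfolding filterlim_iff by blast

lemma eventually_mono: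
  assumes g: "g \<in> carrier G" and b: "p < b"
  shows "eventually (\<lambda>t. t \<in> K \<and> p < t \<and> t < b \<and> act g t \<in> K \<and> p < act g t \<and> act g t < b) right_nhd"
  using eventually_conj[OF eventually_below[OF b] eventually_act[OF g eventually_below[OF b]]]
  by (simp add: conj_assoc)

section \<open>Elements whose fixed points accumulate at \<open>p\<close>: the normal subgroup N of
  the overview\<close>

definition elliptic :: "'a set" where
  "elliptic = {g \<in> carrier G. frequently (\<lambda>t. act g t = t) right_nhd}"

lemma elliptic_inv: "g \<in> elliptic \<Longrightarrow> inv g \<in> elliptic"
proof -
  assume g: "g \<in> elliptic"
  then have "g \<in> carrier G" "frequently (\<lambda>t. act g t = t) right_nhd" by (simp_all add: elliptic_def)
  moreover from this have "frequently (\<lambda>t. act (inv g) t = t) right_nhd"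
    unfolding frequently_right_nhd using act_inv_fixed by blast
  ultimately show "inv g \<in> elliptic" by (simp add: elliptic_def)
qed

text \<open>Suppose \<open>x\<close> is fixed by \<open>A\<close> but not by \<open>g\<close>, and
  let \<open>u\<close> be the left end of the component around \<open>x\<close> of \<open>g\<close>
  or its inverse. Each \<open>h\<close> in \<open>A\<close> fixes \<open>x\<close>, so
  \<open>act h u\<close> stays to the left of \<open>x\<close>; unable to enter the component, it is
  at most \<open>u\<close>. The same bound for \<open>inv h\<close> shows that \<open>h\<close>
  fixes \<open>u\<close>.\<close>

lemma common_fixed:
  assumes "finite A" "A \<subseteq> elliptic"
  shows "frequently (\<lambda>t. \<forall>g\<in>A. act g t = t) right_nhd"
  using assms
proof (induction A)
  case empty
  then show ?case by (simp add: right_nhd_nontrivial)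
next
  case (insert g A)
  have gA: "g \<in> carrier G" "A \<subseteq> carrier G" "g \<in> elliptic" using insert by (auto simp: elliptic_def)
  have IH: "frequently (\<lambda>t. \<forall>g\<in>A. act g t = t) right_nhd" using insert by simp
  show ?case unfolding frequently_right_nhd
  proof (intro allI impI)
    fix e :: real assume e: "e > 0"
    obtain b where b: "b > p" "\<And>h. h \<in> insert g A \<Longrightarrow> mono_to b h"
      using mono_to_exists[of "insert g A"] insert gA by blast
    obtain \<beta> where \<beta>: "\<beta> \<in> K" "p < \<beta>" "\<beta> < p + min e (b - p)" "act g \<beta> = \<beta>"
      using gA(3) e b unfolding elliptic_def frequently_right_nhd by (auto dest!: spec[of _ "min e (b - p)"])
    obtain x where x: "x \<in> K" "p < x" "x < \<beta>" "\<forall>h\<in>A. act h x = x"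
      using IH \<beta> unfolding frequently_right_nhd by (auto dest!: spec[of _ "\<beta> - p"])
    show "\<exists>t\<in>K. p < t \<and> t < p + e \<and> (\<forall>g\<in>insert g A. act g t = t)"
    proof (cases "act g x = x")
      case True
      then show ?thesis using x \<beta> by auto
    next
      case False
      obtain \<alpha> where \<alpha>: "\<alpha> \<in> K" "p < \<alpha>" "\<alpha> < x" "act g \<alpha> = \<alpha>"
        using gA(3) x unfolding elliptic_def frequently_right_nhd by (auto dest!: spec[of _ "x - p"])
      have mg: "mono_to \<beta> g" using b(2)[of g] \<beta> by (auto intro: mono_to_le)
      \<comment> \<open>\<open>k\<close> is whichever of \<open>g\<close> and \<open>inv g\<close>
        moves \<open>x\<close> to the left, as \<open>component_exists\<close> requires.\<close>
      have "\<exists>k. k \<in> carrier G \<and> act k x < x \<and> mono_to \<beta> k \<and> act k \<alpha> = \<alpha> \<and> act k \<beta> = \<beta> \<and>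
          (\<forall>t\<in>K. act k t = t \<longrightarrow> act g t = t)"
      proof (cases "act g x < x")
        case True
        then show ?thesis using gA mg \<alpha> \<beta> by blast
      next
        case gx: False
        have "act g x < act g \<beta>" 
          by (rule mono_toD(1)[OF mg x(1) \<beta>(1) less_imp_le[OF x(2)] x(3) order_refl])
        then have gx': "act g x \<le> \<beta>" "x < act g x" using \<beta>(4) gx False by auto
        have "act (inv g) x < act (inv g) (act g x)"
          by (rule mono_toD(2)[OF mg x(1) _ less_imp_le[OF x(2)] gx'(2,1)]) (use gA x in simp)
        moreover have "act g t = t" if "t \<in> K" "act (inv g) t = t" for t
          using act_inv(2)[OF gA(1) that(1)] that by simp
        ultimately show ?thesis
          using gA(1) mg \<alpha>(1,4) \<beta>(1,4) x(1)
          by (intro exI[of _ "inv g"]) (simp add: mono_to_inv act_inv_fixed)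
      qed
      then obtain k where k: "k \<in> carrier G" "act k x < x" "mono_to \<beta> k" "act k \<alpha> = \<alpha>" "act k \<beta> = \<beta>"
        "\<And>t. t \<in> K \<Longrightarrow> act k t = t \<Longrightarrow> act g t = t" by blast
      have "strict_mono_on (K \<inter> {\<alpha>..\<beta>}) (act k)" "strict_mono_on (K \<inter> {\<alpha>..\<beta>}) (act (inv k))"
        using k(3) \<alpha> unfolding mono_to_def by (auto intro: monotone_on_subset)
      then obtain u v where uv: "component k u v" "\<alpha> \<le> u" "u < x" "x < v" "v \<le> \<beta>"
        using component_exists[OF k(1) \<alpha>(1) k(4) \<beta>(1) k(5) x(1) _ _ k(2)] \<alpha> x by auto
      have u: "u \<in> K" "act k u = u" "p < u" using uv \<alpha> by (auto simp: component_def)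
      have mono_uv: "strict_mono_on (K \<inter> {u..v}) (act h)" if "mono_to \<beta> h" for h
        using that uv \<alpha> unfolding mono_to_def by (auto intro: monotone_on_subset)
      have "act h u = u" if h: "h \<in> A" for h
      proof -
        have hG: "h \<in> carrier G" using h gA by blast
        have mh: "mono_to \<beta> h" using b(2)[of h] h \<beta> by (auto intro: mono_to_le)
        have le: "act h' u \<le> u" if h': "h' \<in> carrier G" "mono_to \<beta> h'" "act h' x = x" for h'
        proof -
          have "act h' u < act h' x"
            by (rule mono_toD(1)[OF h'(2) u(1) x(1) less_imp_le[OF u(3)] uv(3) less_imp_le[OF x(3)]])
          moreover have "\<not> (u < act h' u \<and> act h' u < v)"
            using component_no_crossing(1)[OF nf uv(1) h'(1) mono_uv mono_uv mono_uv]
              k(1,3) h'(2) mono_to_inv by blast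
          ultimately show ?thesis using h'(3) uv by auto
        qed
        have 1: "act h u \<le> u" using le[OF hG mh] x h by blast
        have hx: "act (inv h) x = x" using act_inv_fixed[OF hG x(1)] x h by blast
        have "act (inv h) u \<le> u" using le[OF _ mono_to_inv[OF hG mh] hx] hG by blast
        moreover have hu: "act h (act (inv h) u) = u" using hG u by simp
        moreover have "\<not> act (inv h) u < u"
        proof
          assume less: "act (inv h) u < u"
          have u\<beta>: "u \<le> \<beta>" using uv x by simp
          have "act h (act (inv h) u) < act h u"
            by (rule mono_toD(1)[OF mh _ u(1) _ less u\<beta>])
              (use hG u mono_to_gt(2)[OF mh hG u(1,3) u\<beta>] in simp_all)
          then show False using 1 hu by simp
        qed
        ultimately have "act (inv h) u = u" by linarith
        then show ?thesis using hu by simp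
      qed
      then show ?thesis using u k(6) uv x \<beta> by (intro bexI[of _ u]) auto
    qed
  qed
qed

text \<open>Fixed points of two elements may accumulate at \<open>p\<close> without coinciding;
  closure under products rests on the case of two elements in \<open>common_fixed\<close>.\<close>

lemma subgroup_elliptic: "subgroup elliptic G"
proof (rule subgroupI)
  show "elliptic \<subseteq> carrier G" by (auto simp: elliptic_def)
  have "\<one> \<in> elliptic"
    using p_lim by (auto simp: elliptic_def frequently_right_nhd)
  then show "elliptic \<noteq> {}" by blast
  show "inv g \<in> elliptic" if "g \<in> elliptic" for g by (rule elliptic_inv[OF that])
  show "g \<otimes> h \<in> elliptic" if gh: "g \<in> elliptic" "h \<in> elliptic" for g h
  proof -
    have c: "g \<in> carrier G" "h \<in> carrier G" using gh by (auto simp: elliptic_def)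
    have "frequently (\<lambda>t. \<forall>k\<in>{g, h}. act k t = t) right_nhd"
      by (rule common_fixed) (use gh in auto)
    then have "frequently (\<lambda>t. act (g \<otimes> h) t = t) right_nhd"
      unfolding frequently_right_nhd using c by (simp add: act_mult) (metis act_mult)
    then show ?thesis using c by (simp add: elliptic_def)
  qed
qed

lemma elliptic_conj:
  assumes k: "k \<in> carrier G" and g: "g \<in> elliptic"
  shows "k \<otimes> g \<otimes> inv k \<in> elliptic"
proof -
  have gG: "g \<in> carrier G" using g by (simp add: elliptic_def)
  have "\<exists>t\<in>K. p < t \<and> t < p + e \<and> act (k \<otimes> g \<otimes> inv k) t = t" if e: "e > 0" for e
  proof -
    have "frequently (\<lambda>t. act g t = t \<and> t \<in> K \<and> p < t \<and> t < p + e \<and> act k t \<in> K \<and> p < act k t \<and> act k t < p + e) right_nhd"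
      by (rule frequently_eventually_frequently[OF _ eventually_mono[OF k]])
        (use g e in \<open>auto simp: elliptic_def\<close>)
    then obtain t where t: "act g t = t" "t \<in> K" "p < act k t" "act k t < p + e"
      using frequently_ex by blast
    have "act (k \<otimes> g \<otimes> inv k) (act k t) = act k t"
      using t k gG by (simp add: act_mult)
    then show ?thesis using t k by (intro bexI[of _ "act k t"]) auto
  qed
  then show ?thesis using k gG by (simp add: elliptic_def frequently_right_nhd)
qed

text \<open>A point moved to the right below a point moved to the left traps a decreasing orbit,
  whose limit is the fixed point sought.\<close>

lemma no_sign_change:
  assumes g: "g \<in> carrier G" and m: "mono_to b g"
    and xy: "t \<in> K" "x \<in> K" "p < t" "t < x" "x \<le> b" and sg: "t < act g t" "act g x < x"
  obtains z where "z \<in> K" "t < z" "z < x" "act g z = z"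
proof -
  have "strict_mono_on (K \<inter> {t..x}) (act g)"
    using m xy unfolding mono_to_def by (auto intro: monotone_on_subset)
  then obtain u where u: "u \<in> K" "t \<le> u" "u < x" "act g u = u"
    using attractor[OF g xy(1) _ xy(2) _ sg(2)] xy sg by auto
  then show ?thesis using that[of u] sg by (cases "u = t") auto
qed

text \<open>A non-elliptic element has no fixed points in some interval to the right of
  \<open>p\<close>. If it moves one point there to the left, \<open>no_sign_change\<close> makes it
  move all points closer to \<open>p\<close> to the left as well.\<close>

lemma trichotomy:
  assumes g: "g \<in> carrier G"
  shows "g \<in> elliptic \<or> eventually (\<lambda>t. act g t < t) right_nhd \<or> eventually (\<lambda>t. t < act g t) right_nhd"
proof (cases "g \<in> elliptic")
  case False
  then have "eventually (\<lambda>t. act g t \<noteq> t) right_nhd" using g by (simp add: elliptic_def frequently_def)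
  then obtain e where e: "e > 0" "\<And>t. t \<in> K \<Longrightarrow> p < t \<Longrightarrow> t < p + e \<Longrightarrow> act g t \<noteq> t"
    unfolding eventually_right_nhd by blast
  obtain b where b: "b > p" "mono_to b g" using mono_to_exists[of "{g}"] g by auto
  show ?thesis
  proof (cases "\<exists>x\<in>K. p < x \<and> x < min b (p + e) \<and> act g x < x")
    case True
    then obtain x where x: "x \<in> K" "p < x" "x < min b (p + e)" "act g x < x" by blast
    have "act g t < t" if t: "t \<in> K" "p < t" "t < x" for t
    proof (rule ccontr)
      assume "\<not> act g t < t"
      then have "t < act g t" using e(2)[of t] t x by force
      then obtain z where "z \<in> K" "t < z" "z < x" "act g z = z"
        using no_sign_change[OF g b(2) t(1) x(1) t(2,3) _ _ x(4)] x by auto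
      then show False using e(2)[of z] t x by auto
    qed
    then have "eventually (\<lambda>t. act g t < t) right_nhd"
      unfolding eventually_right_nhd using x by (intro exI[of _ "x - p"]) auto
    then show ?thesis by blast
  next
    case False
    then have "t < act g t" if "t \<in> K" "p < t" "t < min b (p + e)" for t
      using e(2)[of t] that by force
    then have "eventually (\<lambda>t. t < act g t) right_nhd"
      unfolding eventually_right_nhd using b e by (intro exI[of _ "min b (p + e) - p"]) auto
    then show ?thesis by blast
  qed
qed blast

lemma expanding_inv:
  assumes g: "g \<in> carrier G" and ev: "eventually (\<lambda>t. t < act g t) right_nhd"
  shows "eventually (\<lambda>t. act (inv g) t < t) right_nhd"
proof -
  have ig: "inv g \<in> carrier G" using g by simp
  show ?thesis
    using eventually_act[OF ig ev] eventually_below[of "p + 1", OF less_add_one]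
    by eventually_elim (use g in auto)
qed

section \<open>Contractions, and triviality of elliptic elements in their presence\<close>

definition contraction :: "'a \<Rightarrow> real \<Rightarrow> bool" where
  "contraction f b \<longleftrightarrow> f \<in> carrier G \<and> p < b \<and> mono_to b f \<and> (\<forall>t\<in>K. p < t \<and> t \<le> b \<longrightarrow> act f t < t)"

lemma contraction_exists:
  assumes g: "g \<in> carrier G" and ev: "eventually (\<lambda>t. act g t < t) right_nhd"
  obtains b where "contraction g b"
proof -
  obtain e where e: "e > 0" "\<And>t. t \<in> K \<Longrightarrow> p < t \<Longrightarrow> t < p + e \<Longrightarrow> act g t < t"
    using ev unfolding eventually_right_nhd by blast
  obtain b where b: "b > p" "mono_to b g" using mono_to_exists[of "{g}"] g by auto
  have "contraction g (min b (p + e / 2))"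
    unfolding contraction_def using g b e by (auto intro: mono_to_le)
  then show ?thesis using that by blast
qed

lemma contraction_pow:
  assumes f: "contraction f b" and t: "t \<in> K" "p < t" "t \<le> b"
  shows "act (f [^] (n::nat)) t \<in> K" "p < act (f [^] n) t" "act (f [^] n) t \<le> t"
proof -
  have fG: "f \<in> carrier G" and m: "mono_to b f" and lt: "\<And>s. s \<in> K \<Longrightarrow> p < s \<Longrightarrow> s \<le> b \<Longrightarrow> act f s < s"
    using f by (auto simp: contraction_def)
  show "act (f [^] n) t \<in> K" using fG t by simp
  have "p < act (f [^] n) t \<and> act (f [^] n) t \<le> t"
  proof (induction n)
    case 0
    then show ?case using t by simp
  next
    case (Suc n)
    then have "p < act f (act (f [^] n) t)" "act f (act (f [^] n) t) < act (f [^] n) t"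
      using mono_to_gt(1)[OF m fG, of "act (f [^] n) t"] lt[of "act (f [^] n) t"] t fG by auto
    then show ?case using Suc fG t by (simp add: act_pow_Suc(1))
  qed
  then show "p < act (f [^] n) t" "act (f [^] n) t \<le> t" by auto
qed

lemma contraction_pow_less:
  assumes f: "contraction f b" and t: "t \<in> K" "p < t" "t \<le> b" and n: "0 < (n::nat)"
  shows "act (f [^] n) t < t"
proof -
  obtain m where m: "n = Suc m" using n by (cases n) auto
  have "act (f [^] Suc m) t = act f (act (f [^] m) t)"
    using f t by (simp add: contraction_def act_pow_Suc)
  also have "\<dots> < act (f [^] m) t"
    using contraction_pow[OF f t, of m] f t unfolding contraction_def by auto
  finally show ?thesis using contraction_pow(3)[OF f t, of m] m by simp
qed

lemma contraction_tendsto: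
  assumes f: "contraction f b" and t: "t \<in> K" "p < t" "t \<le> b" and y: "p < y"
  obtains n :: nat where "act (f [^] n) t < y"
proof -
  have fG: "f \<in> carrier G" and m: "mono_to b f" and lt: "\<And>s. s \<in> K \<Longrightarrow> p < s \<Longrightarrow> s \<le> b \<Longrightarrow> act f s < s"
    using f by (auto simp: contraction_def)
  have "strict_mono_on (K \<inter> {p..t}) (act f)"
    using m t unfolding mono_to_def by (auto intro: monotone_on_subset)
  then obtain u where u: "u \<in> K" "p \<le> u" "u < t" "act f u = u"
    "\<And>y. u < y \<Longrightarrow> \<exists>n::nat. act (f [^] n) t < y"
    using attractor[OF fG p_in _ t(1) _ lt[OF t]] t fG by auto
  have "u = p" using lt[of u] u t by force
  then show ?thesis using u(5)[of y] y that by blast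
qed

lemma contraction_notin_elliptic:
  assumes f: "contraction f b" and n: "0 < (n::nat)"
  shows "f [^] n \<notin> elliptic"
proof
  assume "f [^] n \<in> elliptic"
  then have "frequently (\<lambda>t. act (f [^] n) t = t) right_nhd" by (simp add: elliptic_def)
  moreover have "0 < b - p" using f by (simp add: contraction_def)
  ultimately obtain t where t: "t \<in> K" "p < t" "t < p + (b - p)" "act (f [^] n) t = t"
    unfolding frequently_right_nhd by blast
  then show False using contraction_pow_less[OF f t(1,2) _ n] by simp
qed

text \<open>The identity is obtained on the whole interval of the contraction, the same for all
  \<open>c\<close>. This uniformity is what later turns commuting germs into commutation on one
  neighbourhood.\<close>

lemma elliptic_trivial:
  assumes f: "contraction f b" and c: "c \<in> elliptic" and t: "t \<in> K" "p \<le> t" "t \<le> b"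
  shows "act c t = t"
proof -
  have fG: "f \<in> carrier G" and pb: "p < b" and mf: "mono_to b f"
    and f_less: "\<And>s. s \<in> K \<Longrightarrow> p < s \<Longrightarrow> s \<le> b \<Longrightarrow> act f s < s"
    using f by (auto simp: contraction_def)
  have cG: "c \<in> carrier G" using c by (simp add: elliptic_def)
  obtain C where C: "finite C" "C \<subseteq> elliptic" "c \<in> C"
    and up: "\<And>x. x \<in> generate G C \<Longrightarrow> f \<otimes> x \<otimes> inv f \<in> generate G C"
    and down: "\<And>x. x \<in> generate G C \<Longrightarrow> inv f \<otimes> x \<otimes> f \<in> generate G C"
    using conj_pow_normalized[OF fG cG nf subgroup_elliptic c elliptic_conj contraction_notin_elliptic[OF f]] by blast
  define M where "M = generate G C"
  have CG: "C \<subseteq> carrier G" using C by (auto simp: elliptic_def)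
  have MG: "m \<in> carrier G" if "m \<in> M" for m using generate_in_carrier[OF CG] that by (simp add: M_def)
  define Fix where "Fix = {x \<in> K. \<forall>m\<in>M. act m x = x}"
  have Fix_I: "x \<in> Fix" if "x \<in> K" "\<And>m. m \<in> C \<Longrightarrow> act m x = x" for x
    using generate_fixes[OF CG that] that(1) by (auto simp: Fix_def M_def)
  have Fix_K: "x \<in> K" if "x \<in> Fix" for x using that by (simp add: Fix_def)
  have Fix_up: "act f x \<in> Fix" if x: "x \<in> Fix" for x
  proof -
    have "act m (act f x) = act f x" if m: "m \<in> M" for m
    proof -
      have "act (inv f \<otimes> m \<otimes> f) x = x" using down m x by (auto simp: Fix_def M_def)
      then have "act f (act (inv f \<otimes> m \<otimes> f) x) = act f x" by simp
      then show ?thesis using MG[OF m] fG Fix_K[OF x] by (simp add: act_mult)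
    qed
    then show ?thesis using Fix_K[OF x] fG by (simp add: Fix_def)
  qed
  have Fix_down: "x \<in> Fix" if x: "x \<in> K" "act f x \<in> Fix" for x
  proof -
    have "act m x = x" if m: "m \<in> M" for m
    proof -
      have "act (f \<otimes> m \<otimes> inv f) (act f x) = act f x" using up m x by (auto simp: Fix_def M_def)
      then show ?thesis using MG[OF m] fG x by (simp add: act_mult)
    qed
    then show ?thesis using x by (simp add: Fix_def)
  qed
  have Fix_up_n: "act (f [^] n) x \<in> Fix" if "x \<in> Fix" for x and n :: nat
  proof (induction n)
    case 0
    then show ?case using that Fix_K[OF that] by simp
  next
    case (Suc n)
    have "act (f [^] Suc n) x = act f (act (f [^] n) x)"
      by (rule act_pow_Suc(1)[OF fG Fix_K[OF that]])
    then show ?case using Fix_up[OF Suc] by simp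
  qed
  have Fix_down_n: "x \<in> Fix" if x: "x \<in> K" "act (f [^] n) x \<in> Fix" for x and n :: nat
    using x(2)
  proof (induction n)
    case 0
    then show ?case using x(1) by simp
  next
    case (Suc n)
    have "act (f [^] n) x \<in> K" using fG x(1) by simp
    moreover have "act f (act (f [^] n) x) \<in> Fix"
      using Suc.prems act_pow_Suc(1)[OF fG x(1)] by simp
    ultimately show ?case using Fix_down Suc.IH by blast
  qed
  \<comment> \<open>Finiteness of \<open>C\<close> gives one pair of distortion constants for
    \<open>f\<close> and all generators of \<open>M\<close>.\<close>
  have "\<And>g. g \<in> insert f C \<Longrightarrow> tame K (act g)" using CG fG act_tame by blast
  then obtain e L where eL: "e > 0" "L \<ge> 0" "\<And>g. g \<in> insert f C \<Longrightarrow> tame_with e L K (act g)"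
    using tame_uniform[OF finite.insertI[OF C(1)], of f K act] by blast
  obtain b' where b': "b' > p" "\<And>g. g \<in> C \<Longrightarrow> mono_to b' g"
    using mono_to_exists[OF C(1) CG] by blast
  obtain \<beta> where \<beta>: "\<beta> \<in> K" "p < \<beta>" "\<beta> < p + min (min (b - p) (b' - p)) e" "\<forall>g\<in>C. act g \<beta> = \<beta>"
    using common_fixed[OF C(1,2)] pb b'(1) eL(1) unfolding frequently_right_nhd
    by (metis (no_types, lifting) diff_gt_0_iff_gt min_less_iff_conj)
  have \<beta>b: "\<beta> \<le> b" "\<beta> \<le> b'" "\<beta> - p < e" using \<beta> by auto
  have \<beta>_Fix: "\<beta> \<in> Fix" using Fix_I \<beta> by blast
  have p_Fix: "p \<in> Fix" by (rule Fix_I) (use p_in CG in auto)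
  have main: "x \<in> Fix" if x: "x \<in> K" "p \<le> x" "x \<le> \<beta>" for x
  proof (rule ccontr)
    assume xF: "x \<notin> Fix"
    have cl: "closed (Fix \<inter> A)" if "closed A" for A
    proof -
      have "closed (\<Inter>m\<in>M. {x \<in> K \<inter> A. act m x = x})"
        using closed_fixed[OF MG that] by blast
      moreover have "M \<noteq> {}" using generate.one by (auto simp: M_def)
      then have "(\<Inter>m\<in>M. {x \<in> K \<inter> A. act m x = x}) = Fix \<inter> A" by (auto simp: Fix_def)
      ultimately show ?thesis by simp
    qed
    \<comment> \<open>\<open>u\<close> and \<open>v\<close> will be the ends of the component around
      \<open>x\<close> of the complement of \<open>Fix\<close>.\<close>
    define u where "u = Sup (Fix \<inter> {p..x})"
    define v where "v = Inf (Fix \<inter> {x..\<beta>})"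
    have ne: "Fix \<inter> {p..x} \<noteq> {}" "Fix \<inter> {x..\<beta>} \<noteq> {}" using p_Fix \<beta>_Fix x by auto
    have u_in: "u \<in> Fix \<inter> {p..x}" unfolding u_def
      by (rule closed_contains_Sup[OF ne(1)]) (auto intro: cl)
    have v_in: "v \<in> Fix \<inter> {x..\<beta>}" unfolding v_def
      by (rule closed_contains_Inf[OF ne(2)]) (auto intro: cl)
    have u_ge: "z \<le> u" if "z \<in> Fix" "p \<le> z" "z \<le> x" for z
      unfolding u_def by (rule cSup_upper) (use that in auto)
    have v_le: "v \<le> z" if "z \<in> Fix" "x \<le> z" "z \<le> \<beta>" for z
      unfolding v_def by (rule cInf_lower) (use that in auto)
    have uv: "u \<in> K" "v \<in> K" "p \<le> u" "u < x" "x < v" "v \<le> \<beta>" "u \<in> Fix" "v \<in> Fix"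
      using u_in v_in xF Fix_K by (auto simp: less_le)
    \<comment> \<open>The gap lies between \<open>u\<close> and \<open>x\<close>: once its right end
      \<open>d0\<close> is shown to be in \<open>Fix\<close>, the maximality of \<open>u\<close> is
      contradicted.\<close>
    obtain c0 d0 where cd0: "c0 \<in> K" "d0 \<in> K" "u \<le> c0" "c0 < d0" "d0 \<le> x"
      and gap0: "K \<inter> {c0<..<d0} = {}"
      using gap_between[OF closed_K subset_refl uv(1) x(1) uv(4)] by blast
    define F where "F n = act (f [^] n)" for n :: nat
    have F_Suc: "F (Suc n) z = act f (F n z)" if "z \<in> K" for n z
      using fG that by (simp add: F_def act_pow_Suc(1))
    have F_Suc2: "F (Suc n) z = F n (act f z)" if "z \<in> K" for n z
      using fG that by (simp add: F_def act_pow_Suc(2))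
    have F_0: "F 0 z = z" if "z \<in> K" for z using that by (simp add: F_def)
    have F_K: "F n z \<in> K" if "z \<in> K" for n z using that fG by (simp add: F_def)
    have F_p: "F n p = p" for n using fG p_in by (simp add: F_def)
    have F_in: "p \<le> F n z" "F n z \<le> z" if "z \<in> K" "p \<le> z" "z \<le> b" for n z
      using contraction_pow[OF f, of z n] that F_p[of n] by (cases "z = p"; simp add: F_def)+
    have F_mono: "F n y < F n z" if "y \<in> K" "z \<in> K" "p \<le> y" "y < z" "z \<le> b" for n y z
    proof (induction n)
      case 0
      then show ?case using that by (simp add: F_0)
    next
      case (Suc n)
      have "F n z \<le> b" using F_in(2)[of z n] that by simp
      then show ?case
        using mono_toD(1)[OF mf F_K[OF that(1)] F_K[OF that(2)] _ Suc] F_in(1)[of y n] that by (simp add: F_Suc)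
    qed
    \<comment> \<open>\<open>act f v\<close> is again in \<open>Fix\<close> and below
      \<open>v\<close>, hence outside the component. So the successive images of the component do
      not overlap, and their lengths \<open>a n\<close> have a bounded sum.\<close>
    have fv: "act f v \<le> u"
    proof -
      have lt: "act f v < v" using f_less[of v] uv \<beta>b x by auto
      have ge: "p \<le> act f v" using mono_to_gt(1)[OF mf fG, of v] uv \<beta>b x by auto
      have F1: "act f v \<in> Fix" by (rule Fix_up[OF uv(8)])
      have "act f v \<le> x" using v_le[OF F1] lt uv by force
      then show ?thesis using u_ge[OF F1 ge] by simp
    qed
    define a where "a n = F n v - F n u" for n
    define \<delta> where "\<delta> n = F n d0 - F n c0" for n
    have vb: "v \<le> b" "x \<le> b" "p \<le> v" "p < v" using uv \<beta>b x by auto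
    have a_pos: "a n > 0" for n using F_mono[of u v n] uv vb by (simp add: a_def)
    have \<delta>_pos: "\<delta> n > 0" for n using F_mono[of c0 d0 n] cd0 uv vb by (simp add: \<delta>_def)
    have step: "F (Suc n) v \<le> F n u" for n
    proof -
      have "F n (act f v) \<le> F n u"
      proof (cases "act f v = u")
        case False
        then have "act f v < u" using fv by simp
        then show ?thesis
          using F_mono[of "act f v" u n] mono_to_gt(1)[OF mf fG uv(2)] uv vb fG by auto
      qed simp
      then show ?thesis using F_Suc2 uv by simp
    qed
    have sum_le: "(\<Sum>i<n. a i) \<le> v - F n v" for n
    proof (induction n)
      case 0
      then show ?case using uv by (simp add: F_0)
    next
      case (Suc n)
      then show ?case using step[of n] by (simp add: a_def)
    qed
    have sum_le': "(\<Sum>i<n. a i) \<le> \<beta> - p" for n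
      using sum_le[of n] F_in(1)[of v n] uv vb by auto
    have a_e: "a n < e" for n
    proof -
      have "F n v \<le> v" "p \<le> F n u" using F_in(2)[of v n] F_in(1)[of u n] uv vb by auto
      then show ?thesis using uv \<beta>b by (simp add: a_def)
    qed
    \<comment> \<open>The share \<open>\<delta> n / a n\<close> of the gap in the
      \<open>n\<close>-th image loses at most a factor \<open>exp (L * a n)\<close> at the next
      step, and these factors multiply to the exponential of the summed lengths.\<close>
    have ratio: "\<delta> 0 * a n \<le> exp (L * (\<Sum>i<n. a i)) * \<delta> n * a 0" for n
    proof (induction n)
      case 0
      then show ?case by simp
    next
      case (Suc n)
      have ord: "F n u \<le> F n c0" "F n c0 < F n d0" "F n d0 < F n v"
        using F_mono[of u c0 n] F_mono[of c0 d0 n] F_mono[of d0 v n] cd0 uv vb by (cases "u = c0"; force)+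
      have in_I: "F n u \<in> K \<inter> {F n u..F n v}" "F n v \<in> K \<inter> {F n u..F n v}"
        "F n c0 \<in> K \<inter> {F n u..F n v}" "F n d0 \<in> K \<inter> {F n u..F n v}"
        using ord F_K cd0 uv by auto
      have tf: "tame_with e L K (act f)" using eL by blast
      have "F n v - F n u < e" using a_e[of n] by (simp add: a_def)
      from tame_withD(2)[OF tf this in_I(2,1,4,3)]
      have "a (Suc n) * \<delta> n \<le> exp (L * a n) * \<delta> (Suc n) * a n"
        using a_pos[of n] a_pos[of "Suc n"] \<delta>_pos[of n] \<delta>_pos[of "Suc n"] F_Suc uv cd0
        by (simp add: a_def \<delta>_def)
      then have "\<delta> 0 * (a (Suc n) * \<delta> n) \<le> \<delta> 0 * (exp (L * a n) * \<delta> (Suc n) * a n)"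
        using \<delta>_pos[of 0] by (intro mult_left_mono) auto
      also have "\<dots> = exp (L * a n) * \<delta> (Suc n) * (\<delta> 0 * a n)" by (simp add: mult_ac)
      also have "\<dots> \<le> exp (L * a n) * \<delta> (Suc n) * (exp (L * (\<Sum>i<n. a i)) * \<delta> n * a 0)"
        using Suc \<delta>_pos[of "Suc n"] by (intro mult_left_mono) auto
      also have "\<dots> = (exp (L * (\<Sum>i<Suc n. a i)) * \<delta> (Suc n) * a 0) * \<delta> n"
        by (simp add: algebra_simps exp_add)
      finally have "(\<delta> 0 * a (Suc n)) * \<delta> n \<le> (exp (L * (\<Sum>i<Suc n. a i)) * \<delta> (Suc n) * a 0) * \<delta> n"
        by (simp add: mult_ac)
      then show ?case using \<delta>_pos[of n] by simp
    qed
    define E where "E = exp (L * (\<beta> - p))"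
    \<comment> \<open>A lower bound, valid for all \<open>n\<close>, for the share of the gap in the
      \<open>n\<close>-th image.\<close>
    define \<kappa> where "\<kappa> = \<delta> 0 / (E * a 0)"
    have \<kappa>_pos: "\<kappa> > 0" using \<delta>_pos a_pos by (simp add: \<kappa>_def E_def)
    have \<kappa>: "\<kappa> * a n \<le> \<delta> n" for n
    proof -
      have "exp (L * (\<Sum>i<n. a i)) \<le> E" unfolding E_def using sum_le' eL by (simp add: mult_left_mono)
      then have "exp (L * (\<Sum>i<n. a i)) * (\<delta> n * a 0) \<le> E * (\<delta> n * a 0)"
        using \<delta>_pos[of n] a_pos[of 0] by (intro mult_right_mono) auto
      then have "\<delta> 0 * a n \<le> E * (\<delta> n * a 0)" using ratio[of n] by (simp add: mult_ac)
      moreover have "E * a 0 > 0" using a_pos by (simp add: E_def)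
      ultimately show ?thesis unfolding \<kappa>_def by (simp add: field_simps)
    qed
    \<comment> \<open>For \<open>a k\<close> below this value, \<open>exp (L * a k) - 1\<close> is
      less than \<open>\<kappa>\<close>. The denominator is \<open>L + 1\<close> since
      \<open>L\<close> may be 0.\<close>
    define \<eta> where "\<eta> = ln (1 + \<kappa>) / (L + 1)"
    have \<eta>: "\<eta> > 0" using \<kappa>_pos eL by (simp add: \<eta>_def)
    have "\<exists>k. a k < \<eta>"
    proof (rule ccontr)
      assume "\<not> ?thesis"
      then have ge: "\<eta> \<le> a n" for n by (simp add: not_less)
      obtain n :: nat where n: "\<beta> - p < real n * \<eta>" using reals_Archimedean3[OF \<eta>] by blast
      have "real n * \<eta> = (\<Sum>i<n. \<eta>)" by simp
      also have "\<dots> \<le> (\<Sum>i<n. a i)" by (rule sum_mono) (use ge in auto)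
      finally show False using sum_le'[of n] n by simp
    qed
    then obtain k where k: "a k < \<eta>" by blast
    have small: "exp (L * a k) - 1 < \<kappa>"
    proof -
      have "(L + 1) * a k < ln (1 + \<kappa>)" using k eL by (simp add: \<eta>_def field_simps)
      moreover have "L * a k \<le> (L + 1) * a k" using a_pos[of k] by (simp add: algebra_simps)
      ultimately have "exp (L * a k) < exp (ln (1 + \<kappa>))" by simp
      then show ?thesis using \<kappa>_pos by simp
    qed
    have gap_n: "K \<inter> {F n c0<..<F n d0} = {}" for n
    proof (induction n)
      case 0
      then show ?case using gap0 cd0 by (simp add: F_0)
    next
      case (Suc n)
      show ?case
      proof (rule ccontr)
        assume "K \<inter> {F (Suc n) c0<..<F (Suc n) d0} \<noteq> {}"
        then obtain z where "z \<in> K \<inter> {F (Suc n) c0<..<F (Suc n) d0}" by blast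
        then have z: "z \<in> K" "F (Suc n) c0 < z" "z < F (Suc n) d0" by auto
        have "F (Suc n) d0 \<le> b" "p \<le> F (Suc n) c0"
          using F_in(2)[of d0 "Suc n"] F_in(1)[of c0 "Suc n"] cd0 uv vb by auto
        then have "act (inv f) (F (Suc n) c0) < act (inv f) z" "act (inv f) z < act (inv f) (F (Suc n) d0)"
          using mono_toD(2)[OF mf _ _ _ z(2)] mono_toD(2)[OF mf _ _ _ z(3)] z F_K cd0 by auto
        then have "act (inv f) z \<in> K \<inter> {F n c0<..<F n d0}"
          using F_Suc[of c0 n] F_Suc[of d0 n] cd0 z fG F_K by simp
        then show False using Suc by blast
      qed
    qed
    have "act g (F k d0) = F k d0" if g: "g \<in> C" for g
    proof -
      have gG: "g \<in> carrier G" using g CG by blast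
      have mg: "mono_to \<beta> g" using b'(2)[OF g] \<beta>b by (auto intro: mono_to_le)
      have tg: "tame_with e L K (act g)" using eL g by blast
      have ord: "F k u \<le> F k c0" "F k c0 < F k d0" "F k d0 < F k v"
        using F_mono[of u c0 k] F_mono[of c0 d0 k] F_mono[of d0 v k] cd0 uv vb by (cases "u = c0"; force)+
      have bd: "p \<le> F k u" "F k v \<le> \<beta>" using F_in(1)[of u k] F_in(2)[of v k] uv vb by auto
      have sm: "strict_mono_on (K \<inter> {F k u..F k v}) (act g)" "strict_mono_on (K \<inter> {F k u..F k v}) (act (inv g))"
        using mg bd unfolding mono_to_def by (auto intro: monotone_on_subset)
      have fixed: "act g (F k u) = F k u" "act g (F k v) = F k v"
        using Fix_up_n[OF uv(7), of k] Fix_up_n[OF uv(8), of k] g generate.incl[of g C G]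
        by (auto simp: Fix_def F_def M_def)
      have ae: "F k v - F k u < e" using a_e[of k] by (simp add: a_def)
      have disp: "\<bar>act g z - z\<bar> < F k d0 - F k c0" if z: "z \<in> K" "F k u \<le> z" "z \<le> F k v" for z
      proof -
        have "\<bar>act g z - z\<bar> \<le> (exp (L * a k) - 1) * a k"
          using fixed_ends_displacement[OF tg eL(2) F_K[OF uv(1)] F_K[OF uv(2)] _ ae fixed sm(1) z] a_pos[of k]
          by (simp add: a_def)
        also have "\<dots> < \<kappa> * a k" using small a_pos[of k] by simp
        also have "\<dots> \<le> \<delta> k" by (rule \<kappa>)
        finally show ?thesis by (simp add: \<delta>_def)
      qed
      have im: "act g z \<in> {F k u..F k v}" if z: "z \<in> K" "F k u \<le> z" "z \<le> F k v" for z
        using strict_mono_on_leD[OF sm(1), of "F k u" z] strict_mono_on_leD[OF sm(1), of z "F k v"] z fixed F_K uv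
        by auto
      show ?thesis
        by (rule gap_fixed[OF gG F_K[OF cd0(1)] F_K[OF cd0(2)] ord(2) gap_n ord(1) less_imp_le[OF ord(3)] sm])
          (use ord im disp F_K cd0 in auto)
    qed
    then have "F k d0 \<in> Fix" using Fix_I F_K cd0 by blast
    \<comment> \<open>\<open>f\<close> normalises \<open>M\<close>, so a common fixed point far
      along the orbit of \<open>f\<close> pulls back to the original gap.\<close>
    then have "d0 \<in> Fix" using Fix_down_n cd0 by (simp add: F_def)
    then have "d0 \<le> u" using u_ge cd0 uv by auto
    then show False using cd0 by simp
  qed
  \<comment> \<open>\<open>main\<close> reaches only up to \<open>\<beta>\<close>; the contraction
    carries any point of \<open>{p..b}\<close> below \<open>\<beta>\<close>, and
    \<open>Fix_down_n\<close> brings the conclusion back.\<close>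
  have "t \<in> Fix"
  proof (cases "t = p")
    case False
    then obtain n :: nat where n: "act (f [^] n) t < \<beta>"
      using contraction_tendsto[OF f t(1) _ t(3) \<beta>(2)] t by force
    then have "act (f [^] n) t \<in> Fix"
      using contraction_pow[OF f t(1) _ t(3), of n] False t by (intro main) auto
    then show ?thesis using Fix_down_n t by blast
  qed (use p_Fix in simp)
  then show ?thesis using C(3) generate.incl[of c C G] by (auto simp: Fix_def M_def)
qed

section \<open>The Archimedean order on germs at \<open>p\<close>\<close>

definition germ_le :: "'a \<Rightarrow> 'a \<Rightarrow> bool" where
  "germ_le g h \<longleftrightarrow> eventually (\<lambda>t. act g t \<le> act h t) right_nhd"

lemma germ_le_trans: "germ_le g h \<Longrightarrow> germ_le h k \<Longrightarrow> germ_le g k"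
  unfolding germ_le_def
proof -
  assume "eventually (\<lambda>t. act g t \<le> act h t) right_nhd" "eventually (\<lambda>t. act h t \<le> act k t) right_nhd"
  then show "eventually (\<lambda>t. act g t \<le> act k t) right_nhd" by eventually_elim simp
qed

lemma germ_le_left:
  assumes c: "g \<in> carrier G" "h \<in> carrier G" "k \<in> carrier G" and le: "germ_le g h"
  shows "germ_le (k \<otimes> g) (k \<otimes> h)"
proof -
  obtain b where b: "b > p" "mono_to b k" using mono_to_exists[of "{k}"] c by auto
  show ?thesis unfolding germ_le_def
    using eventually_mono[OF c(1) b(1)] eventually_mono[OF c(2) b(1)] le[unfolded germ_le_def]
  proof eventually_elim
    case (elim t)
    then have "act k (act g t) \<le> act k (act h t)"
      using mono_toD(1)[OF b(2), of "act g t" "act h t"] by (cases "act g t = act h t") auto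
    then show ?case using elim c by (simp add: act_mult)
  qed
qed

lemma germ_le_right:
  assumes c: "g \<in> carrier G" "h \<in> carrier G" "k \<in> carrier G" and le: "germ_le g h"
  shows "germ_le (g \<otimes> k) (h \<otimes> k)"
  unfolding germ_le_def
  using eventually_act[OF c(3) le[unfolded germ_le_def]] eventually_below[of "p + 1", OF less_add_one]
  by eventually_elim (use c in \<open>simp add: act_mult\<close>)

text \<open>By left invariance it is enough to compare \<open>inv h \<otimes> g\<close> with \<one>.
  In the elliptic case of the trichotomy this element is the identity near \<open>p\<close>, by
  \<open>elliptic_trivial\<close>.\<close>

lemma germ_le_total:
  assumes f: "contraction f b" and c: "g \<in> carrier G" "h \<in> carrier G"
  shows "germ_le g h \<or> germ_le h g"
proof -
  define q where "q = inv h \<otimes> g"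
  have q: "q \<in> carrier G" "h \<otimes> q = g" using c by (auto simp: q_def mult_inv_cancel)
  have pb: "p < b" using f by (simp add: contraction_def)
  have "germ_le q \<one> \<or> germ_le \<one> q"
  proof -
    consider "q \<in> elliptic" | "eventually (\<lambda>t. act q t < t) right_nhd" | "eventually (\<lambda>t. t < act q t) right_nhd"
      using trichotomy[OF q(1)] by blast
    then show ?thesis
    proof cases
      case 1
      have "germ_le q \<one>" unfolding germ_le_def
        using eventually_below[OF pb] by eventually_elim (use elliptic_trivial[OF f 1] in auto)
      then show ?thesis by blast
    next
      case 2
      have "germ_le q \<one>" unfolding germ_le_def
        using 2 eventually_below[OF pb] by eventually_elim auto
      then show ?thesis by blast
    next
      case 3
      have "germ_le \<one> q" unfolding germ_le_def
        using 3 eventually_below[OF pb] by eventually_elim auto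
      then show ?thesis by blast
    qed
  qed
  then show ?thesis using germ_le_left[of q \<one> h] germ_le_left[of \<one> q h] q c by auto
qed

text \<open>\<open>act (inv f)\<close> is known to be increasing only up to \<open>b\<close>. From a
  point at most \<open>act (f [^] n) t0\<close>, each of the \<open>n\<close> backward steps starts
  at or below \<open>t0\<close>, so all of them stay in that range.\<close>

lemma contraction_inv_pow_mono:
  assumes f: "contraction f b" and t0: "t0 \<in> K" "p < t0" "t0 \<le> b"
  shows "strict_mono_on (K \<inter> {p..act (f [^] (n::nat)) t0}) (act (inv f [^] n))"
    "x \<in> K \<Longrightarrow> p \<le> x \<Longrightarrow> x \<le> act (f [^] n) t0 \<Longrightarrow> p \<le> act (inv f [^] n) x \<and> act (inv f [^] n) x \<le> t0"
proof -
  have fG: "f \<in> carrier G" "inv f \<in> carrier G" and mf: "mono_to b f"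
    using f by (auto simp: contraction_def)
  have T: "act (f [^] i) t0 \<in> K" "p < act (f [^] i) t0" "act (f [^] i) t0 \<le> b" for i :: nat
    using contraction_pow[OF f t0, of i] t0 by auto
  have one: "p \<le> act (inv f) x \<and> act (inv f) x \<le> act (f [^] i) t0"
    if x: "x \<in> K" "p \<le> x" "x \<le> act (f [^] Suc i) t0" for x and i :: nat
  proof -
    have sm: "strict_mono_on (K \<inter> {p..b}) (act (inv f))" using mf by (simp add: mono_to_def)
    have "act (inv f) p \<le> act (inv f) x"
      by (rule strict_mono_on_leD[OF sm]) (use x T[of "Suc i"] p_in in auto)
    moreover have "act (inv f) x \<le> act (inv f) (act (f [^] Suc i) t0)"
      by (rule strict_mono_on_leD[OF sm]) (use x T[of "Suc i"] in auto)
    moreover have "act (inv f) (act (f [^] Suc i) t0) = act (f [^] i) t0"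
      using fG t0 by (simp add: act_pow_Suc(1))
    ultimately show ?thesis using fG by simp
  qed
  show range: "p \<le> act (inv f [^] n) x \<and> act (inv f [^] n) x \<le> t0"
    if "x \<in> K" "p \<le> x" "x \<le> act (f [^] n) t0" for x and n :: nat
    using that
  proof (induction n arbitrary: x)
    case 0
    then show ?case using t0 by simp
  next
    case (Suc n)
    have "p \<le> act (inv f) x \<and> act (inv f) x \<le> act (f [^] n) t0" by (rule one[OF Suc.prems])
    then show ?case using Suc.IH[of "act (inv f) x"] Suc.prems fG by (simp add: act_pow_Suc(2))
  qed
  show "strict_mono_on (K \<inter> {p..act (f [^] n) t0}) (act (inv f [^] n))"
  proof (induction n)
    case 0
    then show ?case by (auto simp: monotone_on_def)
  next
    case (Suc n)
    show ?case
    proof (rule strict_mono_onI)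
      fix r s assume rs: "r \<in> K \<inter> {p..act (f [^] Suc n) t0}" "s \<in> K \<inter> {p..act (f [^] Suc n) t0}" "r < s"
      have "act (inv f) r < act (inv f) s"
        by (rule mono_toD(2)[OF mf]) (use rs T[of "Suc n"] in auto)
      moreover have "act (inv f) r \<in> K \<inter> {p..act (f [^] n) t0}" "act (inv f) s \<in> K \<inter> {p..act (f [^] n) t0}"
        using one[of r n] one[of s n] rs fG by auto
      ultimately have "act (inv f [^] n) (act (inv f) r) < act (inv f [^] n) (act (inv f) s)"
        using strict_mono_onD[OF Suc] by blast
      then show "act (inv f [^] Suc n) r < act (inv f [^] Suc n) s"
        using rs fG by (simp add: act_pow_Suc(2))
    qed
  qed
qed

text \<open>If \<open>q\<close> contracts towards \<open>p\<close> but expands at \<open>t0\<close>, the component of \<open>q\<close> at \<open>p\<close> has a right end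
  which every contraction moves into the component.\<close>

lemma expands_near:
  assumes c: "contraction c b" and t0: "t0 \<in> K" "p < t0" "t0 \<le> b"
    and q: "q \<in> carrier G" "mono_to t0 q" and qt: "act (inv q) t0 < t0"
  shows "\<not> eventually (\<lambda>t. act q t < t) right_nhd"
proof
  assume "eventually (\<lambda>t. act q t < t) right_nhd"
  then obtain b' where b': "contraction q b'" using contraction_exists[OF q(1)] by blast
  obtain y where y: "y \<in> K" "p < y" "y < min t0 b'"
    using p_lim[of "min t0 b' - p"] t0 b' by (auto simp: contraction_def)
  have qy: "act q z < z" if "z \<in> K" "p < z" "z \<le> y" for z
    using b' that y by (auto simp: contraction_def)
  have iq: "inv q \<in> carrier G" using q by simp
  have "act (inv q) (act q y) < act (inv q) y"
    by (rule mono_toD(2)[OF q(2)]) (use q y qy[of y] mono_to_gt(1)[OF q(2,1) y(1,2)] in auto)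
  then have y': "y \<le> act (inv q) y" using q y by simp
  have "strict_mono_on (K \<inter> {y..t0}) (act (inv q))"
    using q(2) y unfolding mono_to_def by (auto intro: monotone_on_subset)
  then obtain u where u: "u \<in> K" "y \<le> u" "u < t0" "act (inv q) u = u"
    using attractor[OF iq y(1) y' t0(1) _ qt] y by auto
  have qu: "act q u = u" using act_inv(2)[OF q(1) u(1)] u(4) by simp
  have mu: "strict_mono_on (K \<inter> {p..u}) (act q)" "strict_mono_on (K \<inter> {p..u}) (act (inv q))"
    using q(2) u unfolding mono_to_def by (auto intro: monotone_on_subset)
  obtain u' v' where uv: "component q u' v'" "p \<le> u'" "u' < y" "y < v'" "v' \<le> u"
    using component_exists[OF q(1) p_in _ u(1) qu y(1) _ u(2) _ mu] q y qy[of y] by auto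
  have u'p: "u' = p"
  proof (rule ccontr)
    assume "u' \<noteq> p"
    then have "act q u' < u'" using qy[of u'] uv by (auto simp: component_def)
    then show False using uv by (auto simp: component_def)
  qed
  have v': "v' \<in> K" using uv by (simp add: component_def)
  have cG: "c \<in> carrier G" and mc: "mono_to b c" using c by (auto simp: contraction_def)
  have "act c v' < v'" "p < act c v'"
    using c v' uv y u t0 mono_to_gt(1)[OF mc cG v'] by (auto simp: contraction_def)
  moreover have "\<not> (p < act c v' \<and> act c v' < v')"
  proof (rule component_no_crossing(2)[OF nf uv(1)[unfolded u'p] cG])
    show "strict_mono_on (K \<inter> {p..v'}) (act q)" "strict_mono_on (K \<inter> {p..v'}) (act (inv q))"
      using mu uv by (auto intro: monotone_on_subset)
    show "strict_mono_on (K \<inter> {p..v'}) (act c)"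
      using mc uv u t0 unfolding mono_to_def by (auto intro: monotone_on_subset)
  qed
  ultimately show False by blast
qed

text \<open>With \<open>c'\<close> and \<open>h\<close> the contracting inverses of \<open>e\<close>
  and \<open>g\<close>, a power of \<open>c'\<close> overtakes \<open>h\<close> at
  \<open>t0\<close>. Then the inverse of \<open>q = e [^] n \<otimes> inv g\<close> moves
  \<open>t0\<close> to the left, which excludes that \<open>q\<close> is elliptic or, by
  \<open>expands_near\<close>, contracting at \<open>p\<close>; so \<open>q\<close> expands, that
  is, \<open>g\<close> is below \<open>e [^] n\<close>.\<close>

lemma germ_archimedean:
  assumes f: "contraction f b" and c: "e \<in> carrier G" "g \<in> carrier G" and e: "\<not> germ_le e \<one>"
  shows "\<exists>n::nat. germ_le g (e [^] n)"
proof (cases "germ_le g \<one>")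
  case True
  then show ?thesis by (intro exI[of _ 0]) simp
next
  case g: False
  have expand: "eventually (\<lambda>t. t < act x t) right_nhd" if x: "x \<in> carrier G" "\<not> germ_le x \<one>" for x
  proof -
    have pb: "p < b" using f by (simp add: contraction_def)
    have "x \<notin> elliptic"
    proof
      assume "x \<in> elliptic"
      then have "eventually (\<lambda>t. act x t \<le> act \<one> t) right_nhd"
        using eventually_below[OF pb] elliptic_trivial[OF f] by (elim eventually_rev_mp) (auto intro!: always_eventually)
      then show False using x by (simp add: germ_le_def)
    qed
    moreover have "\<not> eventually (\<lambda>t. act x t < t) right_nhd"
    proof
      assume "eventually (\<lambda>t. act x t < t) right_nhd"
      then have "eventually (\<lambda>t. act x t \<le> act \<one> t) right_nhd"
        using eventually_below[OF pb] by eventually_elim auto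
      then show False using x by (simp add: germ_le_def)
    qed
    ultimately show ?thesis using trichotomy[OF x(1)] by blast
  qed
  define c' h where "c' = inv e" and "h = inv g"
  have cG: "c' \<in> carrier G" "h \<in> carrier G" using c by (auto simp: c'_def h_def)
  obtain b1 where b1: "contraction c' b1"
    using contraction_exists[OF cG(1)] expanding_inv[OF c(1) expand[OF c(1) e]] by (auto simp: c'_def)
  obtain b2 where b2: "contraction h b2"
    using contraction_exists[OF cG(2)] expanding_inv[OF c(2) expand[OF c(2) g]] by (auto simp: h_def)
  have bb: "p < b" "p < b1" "p < b2" using f b1 b2 by (auto simp: contraction_def)
  obtain t0 where t0: "t0 \<in> K" "p < t0" "t0 < min b (min b1 b2)"
    using p_lim[of "min b (min b1 b2) - p"] bb by auto
  have t01: "t0 \<le> b" "t0 \<le> b1" "t0 \<le> b2" using t0 by auto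
  have mh: "mono_to b2 h" using b2 by (simp add: contraction_def)
  have ht0: "p < act h t0" "act h t0 < t0" "act h t0 \<in> K"
    using b2 t0 t01 mono_to_gt(1)[OF mh cG(2) t0(1,2) t01(3)] cG by (auto simp: contraction_def)
  obtain n1 :: nat where n1: "act (c' [^] n1) t0 < act h t0"
    using contraction_tendsto[OF b1 t0(1,2) t01(2) ht0(1)] by blast
  \<comment> \<open>The least exponent gives \<open>act h t0 \<le> act (c' [^] j) t0\<close> for
    \<open>j = n - 1\<close>. So \<open>j\<close> backward steps from points below
    \<open>act h t0\<close> end at or below \<open>t0\<close>, where one more application of
    \<open>act (inv c')\<close> is still increasing.\<close>
  define n where "n = (LEAST n::nat. act (c' [^] n) t0 < act h t0)"
  have n: "act (c' [^] n) t0 < act h t0" unfolding n_def by (rule LeastI[of _ n1]) (rule n1)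
  have "n \<noteq> 0"
  proof
    assume "n = 0"
    then show False using n ht0(2) t0(1) by simp
  qed
  then obtain j where j: "n = Suc j" by (cases n) auto
  have j': "act h t0 \<le> act (c' [^] j) t0"
    using not_less_Least[of j "\<lambda>n::nat. act (c' [^] n) t0 < act h t0"] j by (simp add: n_def[symmetric])
  define q where "q = inv c' [^] n \<otimes> h"
  have qG: "q \<in> carrier G" using cG by (simp add: q_def)
  have inv_q: "inv q = inv h \<otimes> c' [^] n" using cG by (simp add: q_def inv_mult_group nat_pow_inv[symmetric])
  have icG: "inv c' \<in> carrier G" using cG by simp
  have mc: "mono_to b1 c'" using b1 by (simp add: contraction_def)
  have smh: "strict_mono_on (K \<inter> {p..b2}) (act h)" "strict_mono_on (K \<inter> {p..b2}) (act (inv h))"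
    using mh by (auto simp: mono_to_def)
  have smc: "strict_mono_on (K \<inter> {p..b1}) (act c')" "strict_mono_on (K \<inter> {p..b1}) (act (inv c'))"
    using mc by (auto simp: mono_to_def)
  have pow_c: "strict_mono_on (K \<inter> {p..t0}) (act (c' [^] n))"
    and pow_c_in: "\<And>x. x \<in> K \<inter> {p..t0} \<Longrightarrow> act (c' [^] n) x \<in> K \<inter> {p..t0}"
  proof -
    have 1: "strict_mono_on (K \<inter> {p..t0}) (act c')" using smc(1) t01 by (auto intro: monotone_on_subset)
    have 2: "p \<le> act c' p" "act c' t0 \<le> t0" using cG b1 t0 t01 by (auto simp: contraction_def)
    show "strict_mono_on (K \<inter> {p..t0}) (act (c' [^] n))"
      by (rule pow_mono(1)[OF cG(1) 1 p_in 2(1) t0(1) 2(2)])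
    show "act (c' [^] n) x \<in> K \<inter> {p..t0}" if "x \<in> K \<inter> {p..t0}" for x
      by (rule pow_mono(2)[OF cG(1) 1 p_in 2(1) t0(1) 2(2) that])
  qed
  have inv_j: "act (inv c' [^] n) x = act (inv c') (act (inv c' [^] j) x)" if "x \<in> K" for x
    using j icG that by (simp add: act_pow_Suc(1))
  have inv_n_mono: "act (inv c' [^] n) x < act (inv c' [^] n) y"
    if xy: "x \<in> K" "y \<in> K" "p \<le> x" "x < y" "y \<le> act h t0" for x y
  proof -
    have "act (inv c' [^] j) x < act (inv c' [^] j) y"
      by (rule strict_mono_onD[OF contraction_inv_pow_mono(1)[OF b1 t0(1,2) t01(2)]]) (use xy j' in auto)
    moreover have "p \<le> act (inv c' [^] j) x" "act (inv c' [^] j) y \<le> t0"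
      using contraction_inv_pow_mono(2)[OF b1 t0(1,2) t01(2), of x j]
        contraction_inv_pow_mono(2)[OF b1 t0(1,2) t01(2), of y j] xy j' by auto
    ultimately have "act (inv c') (act (inv c' [^] j) x) < act (inv c') (act (inv c' [^] j) y)"
      using xy icG t01 by (intro mono_toD(2)[OF mc]) auto
    then show ?thesis using inv_j xy by simp
  qed
  have mq: "mono_to t0 q" unfolding mono_to_def
  proof
    show "strict_mono_on (K \<inter> {p..t0}) (act q)"
    proof (rule strict_mono_onI)
      fix r s assume rs: "r \<in> K \<inter> {p..t0}" "s \<in> K \<inter> {p..t0}" "r < s"
      have "act h r < act h s" by (rule strict_mono_onD[OF smh(1)]) (use rs t01 in auto)
      moreover have "act h s \<le> act h t0" by (rule strict_mono_on_leD[OF smh(1)]) (use rs t0 t01 in auto)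
      moreover have "act h p \<le> act h r" by (rule strict_mono_on_leD[OF smh(1)]) (use rs t0 t01 p_in in auto)
      ultimately have "act (inv c' [^] n) (act h r) < act (inv c' [^] n) (act h s)"
        using rs cG by (intro inv_n_mono) auto
      then show "act q r < act q s" using rs cG icG by (simp add: q_def act_mult)
    qed
    show "strict_mono_on (K \<inter> {p..t0}) (act (inv q))"
    proof (rule strict_mono_onI)
      fix r s assume rs: "r \<in> K \<inter> {p..t0}" "s \<in> K \<inter> {p..t0}" "r < s"
      have 1: "act (c' [^] n) r < act (c' [^] n) s" by (rule strict_mono_onD[OF pow_c]) (use rs in auto)
      have "act (inv h) (act (c' [^] n) r) < act (inv h) (act (c' [^] n) s)"
        by (rule strict_mono_onD[OF smh(2) _ _ 1]) (use pow_c_in[OF rs(1)] pow_c_in[OF rs(2)] t01 in auto)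
      then show "act (inv q) r < act (inv q) s" using rs cG by (simp add: inv_q act_mult)
    qed
  qed
  have "act (inv h) (act (c' [^] n) t0) < act (inv h) (act h t0)"
    by (rule strict_mono_onD[OF smh(2) _ _ n]) (use pow_c_in[of t0] t0 t01 ht0 in auto)
  then have qt0: "act (inv q) t0 < t0" using cG t0 by (simp add: inv_q act_mult)
  have "q \<notin> elliptic"
  proof
    assume "q \<in> elliptic"
    then have "act (inv q) t0 = t0"
      using elliptic_trivial[OF f elliptic_inv t0(1)] t0 t01 by auto
    then show False using qt0 by simp
  qed
  moreover have "\<not> eventually (\<lambda>t. act q t < t) right_nhd"
    by (rule expands_near[OF b1 t0(1,2) t01(2) qG mq qt0])
  ultimately have ev: "eventually (\<lambda>t. t < act q t) right_nhd" using trichotomy[OF qG] by blast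
  have "germ_le \<one> q" unfolding germ_le_def
    using ev eventually_below[OF bb(1)] by eventually_elim auto
  then have "germ_le (g \<otimes> \<one>) (g \<otimes> q)" "germ_le \<one> q" using germ_le_left[of \<one> q g] qG c by auto
  then have "germ_le (\<one> \<otimes> g) (q \<otimes> g)" using germ_le_right[of \<one> q g] qG c by auto
  moreover have "q \<otimes> g = e [^] n" using c by (simp add: q_def c'_def h_def m_assoc)
  ultimately show ?thesis using c by auto
qed

lemma germ_commute:
  assumes S: "finite S" "S \<subseteq> carrier G" "generate G S = carrier G"
    and ev: "eventually (\<lambda>t. \<exists>s\<in>S. act s t \<noteq> t) right_nhd"
  obtains b where "p < b" "\<And>g h t. g \<in> carrier G \<Longrightarrow> h \<in> carrier G \<Longrightarrow> t \<in> K \<Longrightarrow> p \<le> t \<Longrightarrow> t \<le> b \<Longrightarrow>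
    act (g \<otimes> h) t = act (h \<otimes> g) t"
proof -
  have "\<not> S \<subseteq> elliptic"
  proof
    assume "S \<subseteq> elliptic"
    then have "frequently (\<lambda>t. \<forall>s\<in>S. act s t = t) right_nhd" by (rule common_fixed[OF S(1)])
    then show False using ev by (simp add: frequently_def)
  qed
  then obtain s where s: "s \<in> S" "s \<notin> elliptic" by blast
  have sG: "s \<in> carrier G" using s S by blast
  have "\<exists>f b. contraction f b"
    using trichotomy[OF sG] s(2) contraction_exists[OF sG] contraction_exists[of "inv s"]
      expanding_inv[OF sG] sG by (metis inv_closed)
  then obtain f b where f: "contraction f b" by blast
  have pb: "p < b" using f by (simp add: contraction_def)
  have le: "germ_le (g \<otimes> h) (h \<otimes> g)" if "g \<in> carrier G" "h \<in> carrier G" for g h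
  proof (rule archimedean_commute[where le = germ_le, OF _ _ _ _ _ that])
    show "germ_le x z" if "germ_le x y" "germ_le y z" for x y z
      by (rule germ_le_trans[OF that])
    show "germ_le x y \<or> germ_le y x" if "x \<in> carrier G" "y \<in> carrier G" for x y
      by (rule germ_le_total[OF f that])
    show "germ_le (z \<otimes> x) (z \<otimes> y)"
      if "x \<in> carrier G" "y \<in> carrier G" "z \<in> carrier G" "germ_le x y" for x y z
      by (rule germ_le_left[OF that])
    show "germ_le (x \<otimes> z) (y \<otimes> z)"
      if "x \<in> carrier G" "y \<in> carrier G" "z \<in> carrier G" "germ_le x y" for x y z
      by (rule germ_le_right[OF that])
    show "\<exists>n::nat. germ_le x (e [^] n)"
      if "e \<in> carrier G" "x \<in> carrier G" "\<not> germ_le e \<one>" for e x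
      by (rule germ_archimedean[OF f that])
  qed
  show ?thesis
  proof (rule that[OF pb])
    fix g h t assume c: "g \<in> carrier G" "h \<in> carrier G" and t: "t \<in> K" "p \<le> t" "t \<le> b"
    \<comment> \<open>Comparison in both directions gives \<open>act k t = t\<close> only on a
      neighbourhood depending on \<open>g\<close> and \<open>h\<close>. That makes \<open>k\<close>
      elliptic, and \<open>elliptic_trivial\<close> extends the identity to \<open>{p..b}\<close>,
      which depends on neither.\<close>
    define k where "k = inv (h \<otimes> g) \<otimes> (g \<otimes> h)"
    have kG: "k \<in> carrier G" using c by (simp add: k_def)
    have "eventually (\<lambda>t. act k t = t) right_nhd"
      using le[OF c, unfolded germ_le_def] le[OF c(2,1), unfolded germ_le_def] eventually_below[OF pb]
    proof eventually_elim
      case (elim t)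
      then have "act (g \<otimes> h) t = act (h \<otimes> g) t" by simp
      moreover have "act k t = act (inv (h \<otimes> g)) (act (g \<otimes> h) t)"
        using elim c unfolding k_def by (intro act_mult) auto
      ultimately show ?case using elim c by (simp del: inv_mult_group)
    qed
    then have "k \<in> elliptic" using kG eventually_frequently_right by (simp add: elliptic_def)
    then have "act k t = t" using elliptic_trivial[OF f] t by blast
    then have "act (h \<otimes> g) (act k t) = act (h \<otimes> g) t" by simp
    moreover have "act (h \<otimes> g) (act k t) = act ((h \<otimes> g) \<otimes> k) t"
      using c kG t by (intro act_mult[symmetric]) auto
    moreover have "(h \<otimes> g) \<otimes> k = g \<otimes> h" using c unfolding k_def by (intro mult_inv_cancel) auto
    ultimately show "act (g \<otimes> h) t = act (h \<otimes> g) t" by simp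
  qed
qed

end

section \<open>Commutation near a point fixed by the whole group\<close>

context lip_action
begin

lemma germ_actionI:
  assumes "\<not> contains_free_subsemigroup_2 G" "p \<in> K" "\<And>e. e > 0 \<Longrightarrow> \<exists>t\<in>K. p < t \<and> t < p + e"
    "\<And>g. g \<in> carrier G \<Longrightarrow> act g p = p"
    "\<And>g. g \<in> carrier G \<Longrightarrow> \<exists>e>0. strict_mono_on (K \<inter> {p..p + e}) (act g)"
  shows "germ_action G K act p"
  by unfold_locales (use assms in auto)

text \<open>When common fixed points accumulate at \<open>p\<close>, the action near \<open>p\<close> splits into actions on
  intervals, to the left ends of which the germ case applies.\<close>

lemma local_commute_interval:
  assumes nf: "\<not> contains_free_subsemigroup_2 G"
    and S: "finite S" "S \<subseteq> carrier G" "generate G S = carrier G"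
    and p: "p \<in> K" "\<And>g. g \<in> carrier G \<Longrightarrow> act g p = p"
    and b: "b \<in> K" "p < b" "\<And>g. g \<in> carrier G \<Longrightarrow> act g b = b"
    and m: "\<And>g. g \<in> carrier G \<Longrightarrow> strict_mono_on (K \<inter> {p..b}) (act g)"
    and gh: "g \<in> carrier G" "h \<in> carrier G" and y: "y \<in> K" "p \<le> y" "y \<le> b"
  shows "act (g \<otimes> h) y = act (h \<otimes> g) y"
proof (cases "\<forall>k\<in>carrier G. act k y = y")
  case True
  then show ?thesis using gh by simp
next
  case False
  have range: "p \<le> act k z \<and> act k z \<le> b" if "k \<in> carrier G" "z \<in> K" "p \<le> z" "z \<le> b" for k z
    using strict_mono_on_leD[OF m[OF that(1)], of p z] strict_mono_on_leD[OF m[OF that(1)], of z b] that p b by auto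
  have mono: "act k s \<le> act k t" if "k \<in> carrier G" "s \<in> K" "t \<in> K" "p \<le> s" "s \<le> t" "t \<le> b" for k s t
    using strict_mono_on_leD[OF m[OF that(1)], of s t] that by auto
  define Orb where "Orb = (\<lambda>k. act k y) ` carrier G"
  \<comment> \<open>The infimum of the orbit is fixed by the group and approached by the orbit, so
    commutation near \<open>a\<close> can be carried back to \<open>y\<close>.\<close>
  define a where "a = Inf Orb"
  have O_ne: "Orb \<noteq> {}" by (auto simp: Orb_def)
  have O_sub: "Orb \<subseteq> K \<inter> {p..b}" using range y by (auto simp: Orb_def)
  then have O_bdd: "bdd_below Orb" by (meson bdd_below_Icc bdd_below_mono le_infE)
  have yO: "y \<in> Orb" using y unfolding Orb_def by (intro image_eqI[of _ _ \<one>]) auto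
  have "a \<in> closure Orb" unfolding a_def by (rule closure_contains_Inf[OF O_ne O_bdd])
  then have aK: "a \<in> K \<inter> {p..b}"
    using closure_minimal[OF O_sub closed_Int[OF closed_K closed_atLeastAtMost]] by blast
  have a_le: "a \<le> z" if "z \<in> Orb" for z unfolding a_def by (rule cInf_lower[OF that O_bdd])
  have O_act: "act k z \<in> Orb" if kz: "k \<in> carrier G" "z \<in> Orb" for k z
  proof -
    obtain l where l: "l \<in> carrier G" "z = act l y" using kz(2) unfolding Orb_def by blast
    then have "act k z = act (k \<otimes> l) y" using kz y by (simp add: act_mult)
    then show ?thesis using kz l unfolding Orb_def by (intro image_eqI[of _ _ "k \<otimes> l"]) auto
  qed
  have le_a: "act k a \<le> a" if k: "k \<in> carrier G" for k
    unfolding a_def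
  proof (rule cInf_greatest[OF O_ne])
    fix z assume z: "z \<in> Orb"
    then have kz: "act (inv k) z \<in> Orb" using O_act k by simp
    have "act k a \<le> act k (act (inv k) z)"
      by (rule mono[OF k]) (use aK kz O_sub a_le[OF kz] in auto)
    then show "act k (Inf Orb) \<le> z" using k z O_sub by (auto simp: a_def)
  qed
  have a_fixed: "act k a = a" if k: "k \<in> carrier G" for k
  proof -
    have "act (inv k) a \<le> a" by (rule le_a) (use k in simp)
    then have "act k (act (inv k) a) \<le> act k a"
      by (intro mono[OF k]) (use aK k range[of "inv k" a] in auto)
    then show ?thesis using le_a[OF k] k aK by simp
  qed
  have a_less: "a < z" if z: "z \<in> Orb" for z
  proof (rule ccontr)
    assume "\<not> a < z"
    then have za: "z = a" using a_le[OF z] by simp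
    obtain l where l: "l \<in> carrier G" "z = act l y" using z by (auto simp: Orb_def)
    then have "act l y = act l a" using za a_fixed by simp
    then have "y = a" using l y aK by simp
    then show False using False a_fixed by blast
  qed
  have near: "\<exists>z\<in>Orb. z < x" if "a < x" for x
    using that cInf_less_iff[OF O_ne O_bdd, of x] by (auto simp: a_def)
  have yb: "y < b" using False b y by (metis le_less)
  have ay: "a < y" by (rule a_less[OF yO])
  interpret A: germ_action G K act a
  proof (rule germ_actionI[OF nf])
    show "a \<in> K" using aK by simp
    show "\<exists>t\<in>K. a < t \<and> t < a + e" if "e > 0" for e
      using near[of "a + e"] that a_less O_sub by force
    show "\<exists>e>0. strict_mono_on (K \<inter> {a..a + e}) (act k)" if "k \<in> carrier G" for k
      using m[OF that] aK ay yb by (intro exI[of _ "b - a"]) (auto intro: monotone_on_subset)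
  qed (rule a_fixed)
  \<comment> \<open>A common fixed point between \<open>a\<close> and \<open>y\<close> would be a
    lower bound of the orbit larger than its infimum; hence \<open>germ_commute\<close> applies at
    \<open>a\<close>.\<close>
  have "\<exists>s\<in>S. act s t \<noteq> t" if t: "t \<in> K" "a < t" "t < y" for t
  proof (rule ccontr)
    assume "\<not> ?thesis"
    then have "act k t = t" if "k \<in> carrier G" for k
      using generate_fixes[OF S(2) t(1), of k] S(3) that by auto
    then have "t \<le> act k y" if "k \<in> carrier G" for k
      using mono[OF that t(1) y(1)] t aK yb that by auto
    then have "t \<le> a" unfolding a_def by (intro cInf_greatest[OF O_ne]) (auto simp: Orb_def)
    then show False using t by simp
  qed
  then have "eventually (\<lambda>t. \<exists>s\<in>S. act s t \<noteq> t) A.right_nhd"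
    unfolding A.eventually_right_nhd using ay by (intro exI[of _ "y - a"]) auto
  then obtain c where c: "a < c" "\<And>g h t. g \<in> carrier G \<Longrightarrow> h \<in> carrier G \<Longrightarrow> t \<in> K \<Longrightarrow> a \<le> t \<Longrightarrow> t \<le> c \<Longrightarrow>
    act (g \<otimes> h) t = act (h \<otimes> g) t"
    using A.germ_commute[OF S] by blast
  obtain z where z: "z \<in> Orb" "z < c" using near[OF c(1)] by blast
  obtain k where k: "k \<in> carrier G" "z = act k y" using z by (auto simp: Orb_def)
  \<comment> \<open>At \<open>z = act k y\<close> the conjugates by \<open>k\<close> commute, which
    is commutation of \<open>g\<close> and \<open>h\<close> at \<open>y\<close>.\<close>
  let ?g = "k \<otimes> g \<otimes> inv k" and ?h = "k \<otimes> h \<otimes> inv k"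
  have "act (?g \<otimes> ?h) z = act (?h \<otimes> ?g) z"
    using c(2)[of ?g ?h z] z k gh O_sub a_less[OF z(1)] by auto
  moreover have "act (?g \<otimes> ?h) z = act k (act (g \<otimes> h) y)" "act (?h \<otimes> ?g) z = act k (act (h \<otimes> g) y)"
    using k gh y by (simp_all add: act_mult)
  ultimately show ?thesis using k gh y by simp
qed

text \<open>Three cases: \<open>p\<close> is isolated in \<open>K\<close> from the right; near
  \<open>p\<close> the generators have no common fixed point, so \<open>germ_commute\<close>
  applies; or such points accumulate, and one of them closes off an interval for
  \<open>local_commute_interval\<close>.\<close>

lemma local_commute_right:
  assumes nf: "\<not> contains_free_subsemigroup_2 G" and fg: "finitely_generated_group G"
    and p: "p \<in> K" "\<And>g. g \<in> carrier G \<Longrightarrow> act g p = p"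
    and m: "\<And>g. g \<in> carrier G \<Longrightarrow> \<exists>e>0. strict_mono_on (K \<inter> {p..p + e}) (act g)"
  obtains b where "p < b" "\<And>g h t. g \<in> carrier G \<Longrightarrow> h \<in> carrier G \<Longrightarrow> t \<in> K \<Longrightarrow> p \<le> t \<Longrightarrow> t \<le> b \<Longrightarrow>
    act (g \<otimes> h) t = act (h \<otimes> g) t"
proof (cases "\<forall>e>0. \<exists>t\<in>K. p < t \<and> t < p + e")
  case False
  then obtain e where e: "e > 0" "\<And>t. t \<in> K \<Longrightarrow> \<not> (p < t \<and> t < p + e)" by blast
  show ?thesis
  proof (rule that[of "p + e / 2"])
    fix g h t assume *: "g \<in> carrier G" "h \<in> carrier G" "t \<in> K" "p \<le> t" "t \<le> p + e / 2"
    then have "t = p" using e(2)[of t] e(1) by (auto simp: field_simps)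
    then show "act (g \<otimes> h) t = act (h \<otimes> g) t" using p * by simp
  qed (use e in simp)
next
  case True
  obtain S where S: "finite S" "S \<subseteq> carrier G" "generate G S = carrier G"
    using fg by (auto simp: finitely_generated_group_def)
  interpret A: germ_action G K act p
    by (rule germ_actionI[OF nf p(1) _ p(2) m]) (use True in auto)
  show ?thesis
  proof (cases "eventually (\<lambda>t. \<exists>s\<in>S. act s t \<noteq> t) A.right_nhd")
    case True
    then show ?thesis using A.germ_commute[OF S] that by blast
  next
    case False
    then have fr: "frequently (\<lambda>t. \<forall>s\<in>S. act s t = t) A.right_nhd" by (simp add: frequently_def)
    obtain b0 where b0: "b0 > p" "\<And>g. g \<in> S \<Longrightarrow> A.mono_to b0 g" using A.mono_to_exists[OF S(1,2)] by blast
    obtain b where b: "b \<in> K" "p < b" "b < p + (b0 - p)" "\<forall>s\<in>S. act s b = b"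
      using fr b0(1) unfolding A.frequently_right_nhd by (metis diff_gt_0_iff_gt)
    have fixed: "act g b = b" if "g \<in> carrier G" for g
      using generate_fixes[OF S(2) b(1), of g] b(4) S(3) that by auto
    \<comment> \<open>\<open>m\<close> alone gives an interval depending on the element. Since the
      generators are increasing on one interval whose ends they fix, all products are increasing on
      that same interval.\<close>
    have mono: "strict_mono_on (K \<inter> {p..b}) (act g)" if "g \<in> generate G S" for g
      using that
    proof (induction g rule: generate.induct)
      case one
      then show ?case by (auto simp: monotone_on_def)
    next
      case (incl h)
      then show ?case using A.mono_to_le[OF b0(2)[OF incl], of b] b by (simp add: A.mono_to_def)
    next
      case (inv h)
      then show ?case using A.mono_to_le[OF b0(2)[OF inv], of b] b by (simp add: A.mono_to_def)
    next
      case (eng h1 h2)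
      have c: "h1 \<in> carrier G" "h2 \<in> carrier G" using eng(1,2) S(3) by auto
      show ?case
      proof (rule strict_mono_onI)
        fix r s assume rs: "r \<in> K \<inter> {p..b}" "s \<in> K \<inter> {p..b}" "r < s"
        have in_I: "act h2 x \<in> K \<inter> {p..b}" if "x \<in> K \<inter> {p..b}" for x
          using strict_mono_on_leD[OF eng(4), of p x] strict_mono_on_leD[OF eng(4), of x b]
            that p(1) p(2)[OF c(2)] fixed[OF c(2)] b c by auto
        have "act h1 (act h2 r) < act h1 (act h2 s)"
          by (rule strict_mono_onD[OF eng(3)]) (use in_I rs strict_mono_onD[OF eng(4)] in blast)+
        then show "act (h1 \<otimes> h2) r < act (h1 \<otimes> h2) s" using c rs by (simp add: act_mult)
      qed
    qed
    show ?thesis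
    proof (rule that[OF b(2)])
      fix g h t assume "g \<in> carrier G" "h \<in> carrier G" "t \<in> K" "p \<le> t" "t \<le> b"
      then show "act (g \<otimes> h) t = act (h \<otimes> g) t"
        by (intro local_commute_interval[OF nf S p b(1,2) fixed]) (use mono S(3) in auto)
    qed
  qed
qed

lemma local_commute:
  assumes nf: "\<not> contains_free_subsemigroup_2 G" and fg: "finitely_generated_group G"
    and p: "p \<in> K" "\<And>g. g \<in> carrier G \<Longrightarrow> act g p = p"
    and m: "\<And>g. g \<in> carrier G \<Longrightarrow> \<exists>e>0. strict_mono_on (K \<inter> {p - e..p + e}) (act g)"
  obtains e where "e > 0" "\<And>g h t. g \<in> carrier G \<Longrightarrow> h \<in> carrier G \<Longrightarrow> t \<in> K \<Longrightarrow> \<bar>t - p\<bar> < e \<Longrightarrow>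
    act (g \<otimes> h) t = act (h \<otimes> g) t"
proof -
  interpret R: lip_action G "uminus ` K" "\<lambda>g x. - act g (- x)" by (rule lip_action_reflect)
  have mr: "\<exists>e>0. strict_mono_on (K \<inter> {p..p + e}) (act g)" if g: "g \<in> carrier G" for g
  proof -
    obtain e where e: "e > 0" "strict_mono_on (K \<inter> {p - e..p + e}) (act g)" using m[OF g] by blast
    have "strict_mono_on (K \<inter> {p..p + e}) (act g)"
      by (rule monotone_on_subset[OF e(2)]) (use e(1) in auto)
    then show ?thesis using e(1) by blast
  qed
  obtain b1 where b1: "p < b1" "\<And>g h t. g \<in> carrier G \<Longrightarrow> h \<in> carrier G \<Longrightarrow> t \<in> K \<Longrightarrow> p \<le> t \<Longrightarrow> t \<le> b1 \<Longrightarrow>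
    act (g \<otimes> h) t = act (h \<otimes> g) t"
    using local_commute_right[OF nf fg p mr] by blast
  have ml: "\<exists>e>0. strict_mono_on (uminus ` K \<inter> {- p..- p + e}) (\<lambda>x. - act g (- x))" if g: "g \<in> carrier G" for g
  proof -
    obtain e where e: "e > 0" "strict_mono_on (K \<inter> {p - e..p + e}) (act g)" using m[OF g] by blast
    have "strict_mono_on (K \<inter> {p - e..p}) (act g)"
      by (rule monotone_on_subset[OF e(2)]) (use e(1) in auto)
    then show ?thesis using e(1) by (intro exI[of _ e]) (simp add: strict_mono_on_reflect)
  qed
  obtain b2 where b2: "- p < b2" "\<And>g h t. g \<in> carrier G \<Longrightarrow> h \<in> carrier G \<Longrightarrow> t \<in> uminus ` K \<Longrightarrow> - p \<le> t \<Longrightarrow> t \<le> b2 \<Longrightarrow>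
    - act (g \<otimes> h) (- t) = - act (h \<otimes> g) (- t)"
    using R.local_commute_right[OF nf fg _ _ ml] p by auto
  show ?thesis
  proof (rule that[of "min (b1 - p) (b2 + p)"])
    fix g h t assume *: "g \<in> carrier G" "h \<in> carrier G" "t \<in> K" "\<bar>t - p\<bar> < min (b1 - p) (b2 + p)"
    show "act (g \<otimes> h) t = act (h \<otimes> g) t"
    proof (cases "p \<le> t")
      case True
      then show ?thesis using b1(2)[OF *(1-3)] * by auto
    next
      case False
      then show ?thesis using b2(2)[OF *(1,2), of "- t"] * by auto
    qed
  qed (use b1 b2 in auto)
qed

end

section \<open>Infinite minimal sets\<close>

text \<open>Gaps are pairs in either orientation, so that order-reversing elements act on them
  coordinatewise.\<close>

definition gap_of :: "real set \<Rightarrow> real \<times> real \<Rightarrow> bool" where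
  "gap_of M q \<longleftrightarrow> fst q \<in> M \<and> snd q \<in> M \<and> fst q \<noteq> snd q \<and>
     (\<forall>z\<in>M. \<not> (min (fst q) (snd q) < z \<and> z < max (fst q) (snd q)))"

definition gap_length :: "real \<times> real \<Rightarrow> real" where
  "gap_length q = \<bar>fst q - snd q\<bar>"

lemma gap_length_pos: "gap_of M q \<Longrightarrow> gap_length q > 0"
  by (simp add: gap_of_def gap_length_def)

lemma gap_of_swap: "gap_of M (y, x) \<longleftrightarrow> gap_of M (x, y)"
  by (auto simp: gap_of_def min.commute max.commute)

text \<open>The gaps are disjoint open intervals inside \<open>{lo..hi}\<close>; Lebesgue measure is
  additive on them.\<close>

lemma sum_gap_length_ordered:
  assumes Q: "finite Q" "\<And>q. q \<in> Q \<Longrightarrow> gap_of M q \<and> fst q < snd q" and M: "M \<subseteq> {lo..hi}" "lo \<le> hi"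
  shows "(\<Sum>q\<in>Q. gap_length q) \<le> hi - lo"
proof -
  let ?I = "\<lambda>q::real \<times> real. {fst q<..<snd q}"
  have disj: "pairwise (\<lambda>x y. disjnt (?I x) (?I y)) Q"
  proof (rule pairwiseI)
    fix x y assume xy: "x \<in> Q" "y \<in> Q" "x \<noteq> y"
    note gx = Q(2)[OF xy(1)] and gy = Q(2)[OF xy(2)]
    show "disjnt (?I x) (?I y)"
    proof (rule ccontr)
      assume "\<not> disjnt (?I x) (?I y)"
      then obtain z where "z \<in> ?I x" "z \<in> ?I y" unfolding disjnt_def by blast
      then have z: "fst x < z" "z < snd x" "fst y < z" "z < snd y" by auto
      have "\<not> fst x < fst y" "\<not> fst y < fst x" "\<not> snd x < snd y" "\<not> snd y < snd x"
        using gx gy z unfolding gap_of_def by force+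
      then show False using xy(3) by (simp add: prod_eq_iff)
    qed
  qed
  have "(\<Sum>q\<in>Q. gap_length q) = (\<Sum>q\<in>Q. measure lborel (?I q))"
  proof (rule sum.cong)
    show "gap_length q = measure lborel (?I q)" if "q \<in> Q" for q
      using Q(2)[OF that] by (simp add: gap_length_def)
  qed simp
  also have "\<dots> = measure lborel (\<Union>q\<in>Q. ?I q)"
  proof (rule measure_UNION'[symmetric, OF Q(1) _ disj])
    show "?I q \<in> fmeasurable lborel" if "q \<in> Q" for q
      using Q(2)[OF that] by (simp add: fmeasurable_def)
  qed
  also have "\<dots> \<le> measure lborel {lo..hi}"
  proof (rule measure_mono_fmeasurable)
    show "(\<Union>q\<in>Q. ?I q) \<subseteq> {lo..hi}"
    proof
      fix z assume "z \<in> (\<Union>q\<in>Q. ?I q)"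
      then obtain q where q: "q \<in> Q" "fst q < z" "z < snd q" by auto
      then have "fst q \<in> {lo..hi}" "snd q \<in> {lo..hi}" using Q(2)[OF q(1)] M by (auto simp: gap_of_def)
      then show "z \<in> {lo..hi}" using q by auto
    qed
  qed (use Q in \<open>auto simp: fmeasurable_def emeasure_lborel_Icc_eq\<close>)
  finally show ?thesis using M by simp
qed

text \<open>The factor 2 allows each gap to occur in both orientations.\<close>

lemma sum_gap_length:
  assumes Q: "finite Q" "\<And>q. q \<in> Q \<Longrightarrow> gap_of M q" and M: "M \<subseteq> {lo..hi}" "lo \<le> hi"
  shows "(\<Sum>q\<in>Q. gap_length q) \<le> 2 * (hi - lo)"
proof -
  let ?A = "{q \<in> Q. fst q < snd q}" and ?B = "{q \<in> Q. snd q < fst q}"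
  have inj: "inj_on prod.swap ?B" by (meson inj_on_subset inj_swap subset_UNIV)
  have "fst q < snd q \<or> snd q < fst q" if "q \<in> Q" for q
    using Q(2)[OF that] by (auto simp: gap_of_def)
  then have "Q = ?A \<union> ?B" by blast
  then have "(\<Sum>q\<in>Q. gap_length q) = (\<Sum>q\<in>?A \<union> ?B. gap_length q)" by simp
  also have "\<dots> = (\<Sum>q\<in>?A. gap_length q) + (\<Sum>q\<in>?B. gap_length q)"
    using Q by (intro sum.union_disjoint) auto
  also have "(\<Sum>q\<in>?B. gap_length q) = (\<Sum>q\<in>prod.swap ` ?B. gap_length q)"
    by (simp add: sum.reindex[OF inj] gap_length_def abs_minus_commute)
  also have "\<dots> \<le> hi - lo"
    by (rule sum_gap_length_ordered[OF _ _ M])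
      (use Q gap_of_swap in auto)
  also have "(\<Sum>q\<in>?A. gap_length q) \<le> hi - lo"
    by (rule sum_gap_length_ordered[OF _ _ M]) (use Q in auto)
  finally show ?thesis by simp
qed

lemma finite_long_gaps:
  assumes M: "M \<subseteq> {lo..hi}" and r: "r > 0"
  shows "finite {q. gap_of M q \<and> r \<le> gap_length q}"
proof (rule ccontr)
  assume inf: "infinite {q. gap_of M q \<and> r \<le> gap_length q}"
  have lohi: "lo \<le> hi"
  proof -
    obtain q where "gap_of M q" using inf by (metis (mono_tags, lifting) infinite_imp_nonempty Collect_empty_eq)
    then have "fst q \<in> {lo..hi}" using M by (auto simp: gap_of_def)
    then show ?thesis by simp
  qed
  obtain n :: nat where n: "2 * (hi - lo) < real n * r" using reals_Archimedean3[OF r] by blast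
  obtain Q where Q: "Q \<subseteq> {q. gap_of M q \<and> r \<le> gap_length q}" "finite Q" "card Q = n"
    using infinite_arbitrarily_large[OF inf] by blast
  have "real n * r = (\<Sum>q\<in>Q. r)" using Q by simp
  also have "\<dots> \<le> (\<Sum>q\<in>Q. gap_length q)" by (rule sum_mono) (use Q in auto)
  also have "\<dots> \<le> 2 * (hi - lo)" by (rule sum_gap_length[OF Q(2) _ M lohi]) (use Q in auto)
  finally show False using n by simp
qed

text \<open>A shortest path repeats no vertex, since a loop could be cut out. Along a path of gaps,
  distinctness is what bounds the sum of the lengths.\<close>

lemma rtrancl_simple_path:
  assumes "(a, b) \<in> R\<^sup>*"
  obtains f :: "nat \<Rightarrow> 'a" and n where "f 0 = a" "f n = b" "\<And>i. i < n \<Longrightarrow> (f i, f (Suc i)) \<in> R"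
    "inj_on f {..n}"
proof -
  define n where "n = (LEAST n. (a, b) \<in> R ^^ n)"
  have ex: "\<exists>n. (a, b) \<in> R ^^ n" using assms rtrancl_imp_relpow by metis
  have n: "(a, b) \<in> R ^^ n" unfolding n_def using LeastI_ex[OF ex] .
  obtain f where f: "f 0 = a" "f n = b" "\<And>i. i < n \<Longrightarrow> (f i, f (Suc i)) \<in> R"
    using n unfolding relpow_fun_conv by blast
  have seg: "(f i, f (i + k)) \<in> R ^^ k" if "i + k \<le> n" for i k
    using that f(3) unfolding relpow_fun_conv by (intro exI[of _ "\<lambda>j. f (i + j)"]) auto
  have no: "f i \<noteq> f j" if ij: "i < j" "j \<le> n" for i j
  proof
    assume eq: "f i = f j"
    have "(a, f i) \<in> R ^^ i" using seg[of 0 i] ij f by simp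
    moreover have "(f j, b) \<in> R ^^ (n - j)" using seg[of j "n - j"] ij f by simp
    ultimately have "(a, b) \<in> R ^^ (i + (n - j))" using eq by (auto simp: relpow_add)
    then have "n \<le> i + (n - j)" unfolding n_def by (rule Least_le)
    then show False using ij by simp
  qed
  have "inj_on f {..n}"
    by (rule inj_onI) (metis atMost_iff linorder_neqE_nat no)
  then show ?thesis using that f by blast
qed

section \<open>Pushing neighbourhoods along paths of gaps\<close>

context lip_action
begin

lemma uniform_continuity:
  assumes "finite A" "A \<subseteq> carrier G" "r > 0"
  obtains d where "d > 0" "\<And>g x y. g \<in> A \<Longrightarrow> x \<in> K \<Longrightarrow> y \<in> K \<Longrightarrow> \<bar>x - y\<bar> < d \<Longrightarrow> \<bar>act g x - act g y\<bar> < r"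
proof -
  have "\<exists>d>0. \<forall>g\<in>A. \<forall>x\<in>K. \<forall>y\<in>K. \<bar>x - y\<bar> < d \<longrightarrow> \<bar>act g x - act g y\<bar> < r"
    using assms(1,2)
  proof (induction A)
    case empty
    show ?case by (rule exI[of _ 1]) simp
  next
    case (insert g A)
    then obtain d where d: "d > 0" "\<forall>g\<in>A. \<forall>x\<in>K. \<forall>y\<in>K. \<bar>x - y\<bar> < d \<longrightarrow> \<bar>act g x - act g y\<bar> < r" by auto
    have "uniformly_continuous_on K (act g)"
      using compact_uniformly_continuous[OF act_cont compact_K] insert by auto
    then obtain d' where d': "d' > 0" "\<forall>x\<in>K. \<forall>y\<in>K. \<bar>y - x\<bar> < d' \<longrightarrow> \<bar>act g y - act g x\<bar> < r"
      using assms(3) unfolding uniformly_continuous_on_def dist_real_def by metis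
    have "\<forall>h\<in>insert g A. \<forall>x\<in>K. \<forall>y\<in>K. \<bar>x - y\<bar> < min d d' \<longrightarrow> \<bar>act h x - act h y\<bar> < r"
      using d(2) d'(2) by auto
    then show ?case using d(1) d'(1) by (intro exI[of _ "min d d'"]) simp
  qed
  then show ?thesis using that by blast
qed

text \<open>A point \<open>z\<close> of \<open>M\<close> between the images would pull back to a
  point of \<open>M\<close> near the gap but not inside it. The interval spanned by the three points
  is shorter than \<open>e\<close>, so \<open>act s\<close> is monotone there and cannot place
  \<open>z\<close> between the images.\<close>

lemma gap_image:
  assumes M: "M \<subseteq> K" "\<And>g x. g \<in> carrier G \<Longrightarrow> x \<in> M \<Longrightarrow> act g x \<in> M"
    and s: "s \<in> carrier G" and tw: "tame_with e L K (act s)"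
    and r: "\<And>x y. x \<in> K \<Longrightarrow> y \<in> K \<Longrightarrow> \<bar>x - y\<bar> < r \<Longrightarrow> \<bar>act (inv s) x - act (inv s) y\<bar> < e / 2"
    and q: "gap_of M (x, y)" "\<bar>x - y\<bar> < e / 2" "\<bar>act s x - act s y\<bar> < r"
  shows "gap_of M (act s x, act s y)"
proof -
  have xy: "x \<in> M" "y \<in> M" "x \<in> K" "y \<in> K" "x \<noteq> y" using q M by (auto simp: gap_of_def)
  have e: "e > 0" using q(2) by linarith
  have False if z: "z \<in> M" "min (act s x) (act s y) < z" "z < max (act s x) (act s y)" for z
  proof -
    define w where "w = act (inv s) z"
    have zK: "z \<in> K" using z M by blast
    have w: "w \<in> M" "w \<in> K" "act s w = z" using M s z zK by (auto simp: w_def)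
    have "\<bar>z - act s x\<bar> < r" using z q(3) by linarith
    then have "\<bar>w - x\<bar> < e / 2" using r[OF zK, of "act s x"] xy s by (simp add: w_def)
    define I where "I = {min x (min y w)..max x (max y w)}"
    have I: "x \<in> K \<inter> I" "y \<in> K \<inter> I" "w \<in> K \<inter> I" using xy w by (auto simp: I_def)
    have "max x (max y w) - min x (min y w) < e"
      using \<open>\<bar>w - x\<bar> < e / 2\<close> q(2) by linarith
    then have "strict_mono_on (K \<inter> I) (act s) \<or> strict_antimono_on (K \<inter> I) (act s)"
      unfolding I_def by (rule tame_withD(1)[OF tw])
    moreover have "\<not> (min x y < w \<and> w < max x y)" using q(1) w by (auto simp: gap_of_def)
    then have "w \<le> x \<and> w \<le> y \<or> x \<le> w \<and> y \<le> w" by linarith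
    ultimately have "z \<le> act s x \<and> z \<le> act s y \<or> act s x \<le> z \<and> act s y \<le> z"
    proof (elim disjE)
      assume m: "strict_mono_on (K \<inter> I) (act s)" and "w \<le> x \<and> w \<le> y"
      then show ?thesis using strict_mono_on_leD[OF m] I w by metis
    next
      assume m: "strict_mono_on (K \<inter> I) (act s)" and "x \<le> w \<and> y \<le> w"
      then show ?thesis using strict_mono_on_leD[OF m] I w by metis
    next
      assume m: "strict_antimono_on (K \<inter> I) (act s)" and "w \<le> x \<and> w \<le> y"
      then show ?thesis using monotone_onD[OF m] I w by (metis le_less)
    next
      assume m: "strict_antimono_on (K \<inter> I) (act s)" and "x \<le> w \<and> y \<le> w"
      then show ?thesis using monotone_onD[OF m] I w by (metis le_less)
    qed
    then show False using z by linarith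
  qed
  then show ?thesis using xy M s unfolding gap_of_def by auto
qed

text \<open>Pushing a neighbourhood of \<open>x0\<close> along a path of distinct gaps; the total length of the gaps
  bounds the distortion.\<close>

lemma path_distortion:
  fixes x0 y0 :: real
  assumes M: "M \<subseteq> K" "M \<subseteq> {lo..hi}" "lo \<le> hi" and S: "S \<subseteq> carrier G" and L: "L \<ge> 0"
    and tw: "\<And>s. s \<in> S \<Longrightarrow> tame_with e L K (act s)"
    and f: "f 0 = (x0, y0)" "inj_on f {..n}"
      "\<And>i. i \<le> n \<Longrightarrow> gap_of M (f i) \<and> gap_length (f i) < e / 2"
      "\<And>i. i < n \<Longrightarrow> \<exists>s\<in>S. f (Suc i) = (act s (fst (f i)), act s (snd (f i)))"
  obtains g where "g \<in> carrier G" "f n = (act g x0, act g y0)"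
    "\<And>t. t \<in> K \<Longrightarrow> \<bar>t - x0\<bar> \<le> exp (- (4 * L * (hi - lo))) * \<bar>x0 - y0\<bar> \<Longrightarrow>
       \<bar>act g t - act g x0\<bar> \<le> gap_length (f n)"
proof -
  let ?l = "\<lambda>i. gap_length (f i)"
  \<comment> \<open>The gaps of the path have total length at most \<open>2 * (hi - lo)\<close>, and
    each step distorts an interval of twice the gap length; \<open>B\<close> bounds the accumulated
    distortion.\<close>
  define B where "B = exp (4 * L * (hi - lo))"
  have xy: "x0 \<in> K" "y0 \<in> K" "x0 \<noteq> y0" using f(3)[of 0] f(1) M by (auto simp: gap_of_def)
  have sum_le: "(\<Sum>i<k. ?l i) \<le> 2 * (hi - lo)" if "k \<le> n" for k
  proof -
    have "inj_on f {..<k}" by (rule inj_on_subset[OF f(2)]) (use that in auto)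
    then have "(\<Sum>i<k. ?l i) = (\<Sum>q\<in>f ` {..<k}. gap_length q)" by (simp add: sum.reindex)
    also have "\<dots> \<le> 2 * (hi - lo)"
      by (rule sum_gap_length[OF _ _ M(2,3)]) (use f(3) that in auto)
    finally show ?thesis .
  qed
  have "\<exists>g\<in>carrier G. f k = (act g x0, act g y0) \<and>
      (\<forall>t\<in>K. \<bar>t - x0\<bar> * B \<le> \<bar>x0 - y0\<bar> \<longrightarrow>
        \<bar>act g t - act g x0\<bar> * \<bar>x0 - y0\<bar> \<le> exp (2 * L * (\<Sum>i<k. ?l i)) * \<bar>t - x0\<bar> * ?l k)"
    if "k \<le> n" for k
    using that
  proof (induction k)
    case 0
    have "?l 0 = \<bar>x0 - y0\<bar>" using f(1) by (simp add: gap_length_def)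
    then show ?case using f(1) xy by (intro bexI[of _ \<one>]) auto
  next
    case (Suc k)
    then obtain g where g: "g \<in> carrier G" "f k = (act g x0, act g y0)"
      and IH: "\<And>t. t \<in> K \<Longrightarrow> \<bar>t - x0\<bar> * B \<le> \<bar>x0 - y0\<bar> \<Longrightarrow>
        \<bar>act g t - act g x0\<bar> * \<bar>x0 - y0\<bar> \<le> exp (2 * L * (\<Sum>i<k. ?l i)) * \<bar>t - x0\<bar> * ?l k"
      by auto
    obtain s where s: "s \<in> S" "f (Suc k) = (act s (act g x0), act s (act g y0))"
      using f(4)[of k] Suc.prems g(2) by auto
    have sG: "s \<in> carrier G" using s S by blast
    have lk: "?l k > 0" "?l k < e / 2" 
      using f(3)[of k] Suc.prems gap_length_pos[of M "f k"] by auto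
    have lk_eq: "?l k = \<bar>act g x0 - act g y0\<bar>" "?l (Suc k) = \<bar>act s (act g x0) - act s (act g y0)\<bar>"
      using g s by (auto simp: gap_length_def)
    have main: "\<bar>act s (act g t) - act s (act g x0)\<bar> * \<bar>x0 - y0\<bar>
        \<le> exp (2 * L * (\<Sum>i<Suc k. ?l i)) * \<bar>t - x0\<bar> * ?l (Suc k)"
      if t: "t \<in> K" "\<bar>t - x0\<bar> * B \<le> \<bar>x0 - y0\<bar>" for t
    proof -
      define D where "D = \<bar>act g t - act g x0\<bar>"
      have IH': "D * \<bar>x0 - y0\<bar> \<le> exp (2 * L * (\<Sum>i<k. ?l i)) * \<bar>t - x0\<bar> * ?l k"
        unfolding D_def by (rule IH[OF t])
      have "2 * L * (\<Sum>i<k. ?l i) \<le> 4 * L * (hi - lo)"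
        using mult_left_mono[OF sum_le[of k], of "2 * L"] Suc.prems L by (simp add: algebra_simps)
      then have "exp (2 * L * (\<Sum>i<k. ?l i)) \<le> B" by (simp add: B_def)
      then have "exp (2 * L * (\<Sum>i<k. ?l i)) * (\<bar>t - x0\<bar> * ?l k) \<le> B * (\<bar>t - x0\<bar> * ?l k)"
        using lk by (intro mult_right_mono) auto
      also have "\<dots> = (\<bar>t - x0\<bar> * B) * ?l k" by simp
      also have "\<dots> \<le> \<bar>x0 - y0\<bar> * ?l k" using t lk by (intro mult_right_mono) auto
      finally have "D * \<bar>x0 - y0\<bar> \<le> ?l k * \<bar>x0 - y0\<bar>" using IH' by (simp add: mult_ac)
      \<comment> \<open>The image of \<open>t\<close> is no farther from the image of
        \<open>x0\<close> than the current gap is long, so an interval of length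
        \<open>2 * ?l k\<close> contains all points compared in the next step.\<close>
      then have D: "D \<le> ?l k" using xy by simp
      define a b where "a = act g x0 - ?l k" and "b = act g x0 + ?l k"
      have in_I: "act g t \<in> K \<inter> {a..b}" "act g x0 \<in> K \<inter> {a..b}" "act g y0 \<in> K \<inter> {a..b}"
        using D lk(1) g(1) t(1) xy unfolding a_def b_def D_def lk_eq(1) by auto
      have ba: "b - a = 2 * ?l k" by (simp add: a_def b_def)
      then have "b - a < e" using lk by simp
      from tame_withD(2)[OF tw[OF s(1)] this in_I(1,2,2,3)]
      have 1: "\<bar>act s (act g t) - act s (act g x0)\<bar> * ?l k \<le> exp (L * (2 * ?l k)) * ?l (Suc k) * D"
        unfolding ba lk_eq D_def .
      have "(\<bar>act s (act g t) - act s (act g x0)\<bar> * \<bar>x0 - y0\<bar>) * ?l k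
          = (\<bar>act s (act g t) - act s (act g x0)\<bar> * ?l k) * \<bar>x0 - y0\<bar>" by simp
      also have "\<dots> \<le> (exp (L * (2 * ?l k)) * ?l (Suc k) * D) * \<bar>x0 - y0\<bar>"
        using 1 by (intro mult_right_mono) auto
      also have "\<dots> = exp (L * (2 * ?l k)) * ?l (Suc k) * (D * \<bar>x0 - y0\<bar>)" by simp
      also have "\<dots> \<le> exp (L * (2 * ?l k)) * ?l (Suc k) * (exp (2 * L * (\<Sum>i<k. ?l i)) * \<bar>t - x0\<bar> * ?l k)"
        using IH' by (intro mult_left_mono) (auto simp: gap_length_def)
      also have "\<dots> = (exp (2 * L * (\<Sum>i<Suc k. ?l i)) * \<bar>t - x0\<bar> * ?l (Suc k)) * ?l k"
        by (simp add: algebra_simps exp_add)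
      finally show ?thesis using lk by simp
    qed
    show ?case
      by (rule bexI[of _ "s \<otimes> g"]) (use main g sG xy s in \<open>auto simp: act_mult\<close>)
  qed
  from this[of n] obtain g where g: "g \<in> carrier G" "f n = (act g x0, act g y0)"
    and est: "\<And>t. t \<in> K \<Longrightarrow> \<bar>t - x0\<bar> * B \<le> \<bar>x0 - y0\<bar> \<Longrightarrow>
        \<bar>act g t - act g x0\<bar> * \<bar>x0 - y0\<bar> \<le> exp (2 * L * (\<Sum>i<n. ?l i)) * \<bar>t - x0\<bar> * ?l n"
    by auto
  show ?thesis
  proof (rule that[OF g])
    fix t assume t: "t \<in> K" "\<bar>t - x0\<bar> \<le> exp (- (4 * L * (hi - lo))) * \<bar>x0 - y0\<bar>"
    then have "\<bar>t - x0\<bar> * B \<le> exp (- (4 * L * (hi - lo))) * \<bar>x0 - y0\<bar> * B"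
      by (intro mult_right_mono) (auto simp: B_def)
    also have "\<dots> = (exp (- (4 * L * (hi - lo))) * B) * \<bar>x0 - y0\<bar>" by simp
    also have "exp (- (4 * L * (hi - lo))) * B = 1" unfolding B_def mult_exp_exp by simp
    also have "1 * \<bar>x0 - y0\<bar> = \<bar>x0 - y0\<bar>" by simp
    finally have tB: "\<bar>t - x0\<bar> * B \<le> \<bar>x0 - y0\<bar>" .
    have "2 * L * (\<Sum>i<n. ?l i) \<le> 4 * L * (hi - lo)"
      using mult_left_mono[OF sum_le[of n], of "2 * L"] L by (simp add: algebra_simps)
    then have "exp (2 * L * (\<Sum>i<n. ?l i)) \<le> B" by (simp add: B_def)
    then have "exp (2 * L * (\<Sum>i<n. ?l i)) * (\<bar>t - x0\<bar> * ?l n) \<le> B * (\<bar>t - x0\<bar> * ?l n)"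
      by (intro mult_right_mono) (auto simp: gap_length_def)
    also have "\<dots> = (\<bar>t - x0\<bar> * B) * ?l n" by simp
    also have "\<dots> \<le> \<bar>x0 - y0\<bar> * ?l n" using tB by (intro mult_right_mono) (auto simp: gap_length_def)
    finally have "\<bar>act g t - act g x0\<bar> * \<bar>x0 - y0\<bar> \<le> ?l n * \<bar>x0 - y0\<bar>"
      using est[OF t(1) tB] by (simp add: mult_ac)
    then show "\<bar>act g t - act g x0\<bar> \<le> ?l n" using xy by simp
  qed
qed

lemma generate_invariant:
  assumes S: "S \<subseteq> carrier G" and A: "A \<subseteq> K" "\<And>s x. s \<in> S \<union> m_inv G ` S \<Longrightarrow> x \<in> A \<Longrightarrow> act s x \<in> A"
    and g: "g \<in> generate G S" and x: "x \<in> A"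
  shows "act g x \<in> A"
  using g x
proof (induction g arbitrary: x rule: generate.induct)
  case one
  then show ?case using A(1) by auto
next
  case (eng h1 h2)
  then have "h1 \<in> carrier G" "h2 \<in> carrier G" using generate_in_carrier[OF S] by blast+
  then show ?case using eng A(1) act_mult[of h1 h2 x] by auto
qed (use A(2) in auto)

text \<open>The orbit of some short gap, followed through short gaps only, is infinite: otherwise a finite
  invariant set would appear, or all but finitely many short gaps would be reached from the
  finitely many long ones.\<close>

lemma contracting_neighbourhood:
  assumes fg: "finitely_generated_group G" and M: "M \<subseteq> K" "closed M" "infinite M"
    and inv: "\<And>g x. g \<in> carrier G \<Longrightarrow> x \<in> M \<Longrightarrow> act g x \<in> M"
    and orb: "\<And>x. x \<in> M \<Longrightarrow> infinite ((\<lambda>g. act g x) ` carrier G)"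
  obtains x d where "x \<in> M" "d > 0"
    "\<And>r. r > 0 \<Longrightarrow> \<exists>g\<in>carrier G. \<forall>t\<in>M. \<bar>t - x\<bar> \<le> d \<longrightarrow> \<bar>act g t - act g x\<bar> < r"
proof -
  obtain S0 where S0: "finite S0" "S0 \<subseteq> carrier G" "generate G S0 = carrier G"
    using fg by (auto simp: finitely_generated_group_def)
  define S where "S = S0 \<union> m_inv G ` S0"
  have S: "finite S" "S \<subseteq> carrier G" using S0 by (auto simp: S_def)
  have S_inv: "inv s \<in> S" if "s \<in> S" for s using that S0(2) by (auto simp: S_def)
  obtain lo hi where lohi: "M \<subseteq> {lo..hi}" "lo \<le> hi"
  proof -
    have "bounded M" using compact_K M(1) by (meson bounded_subset compact_imp_bounded)
    then obtain B where B: "\<And>x. x \<in> M \<Longrightarrow> \<bar>x\<bar> \<le> B" unfolding bounded_iff by auto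
    have "M \<subseteq> {- \<bar>B\<bar>..\<bar>B\<bar>}"
    proof
      fix x assume "x \<in> M"
      then have "\<bar>x\<bar> \<le> B" by (rule B)
      then show "x \<in> {- \<bar>B\<bar>..\<bar>B\<bar>}" by auto
    qed
    then show ?thesis by (rule that) simp
  qed
  have "\<And>s. s \<in> S \<Longrightarrow> tame K (act s)" using S act_tame by blast
  then obtain e L where eL: "e > 0" "L \<ge> 0" "\<And>s. s \<in> S \<Longrightarrow> tame_with e L K (act s)"
    using tame_uniform[OF S(1), of K act] by blast
  obtain r where r: "r > 0" "\<And>s x y. s \<in> S \<Longrightarrow> x \<in> K \<Longrightarrow> y \<in> K \<Longrightarrow> \<bar>x - y\<bar> < r \<Longrightarrow> \<bar>act s x - act s y\<bar> < e / 2"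
    using uniform_continuity[OF S, of "e / 2"] eL(1) by auto
  obtain d where d: "d > 0" "\<And>s x y. s \<in> S \<Longrightarrow> x \<in> K \<Longrightarrow> y \<in> K \<Longrightarrow> \<bar>x - y\<bar> < d \<Longrightarrow> \<bar>act s x - act s y\<bar> < r"
    using uniform_continuity[OF S r(1)] by auto
  \<comment> \<open>Gaps shorter than \<open>h\<close> meet the smallness conditions of
    \<open>gap_image\<close> for every generator and that of \<open>path_distortion\<close>.\<close>
  define h where "h = min d (e / 2)"
  have h: "h > 0" "h \<le> d" "h \<le> e / 2" using d eL by (auto simp: h_def)
  define ap where "ap s q = (act s (fst q), act s (snd q))" for s q
  define Short where "Short = {q. gap_of M q \<and> gap_length q < h}"
  define Long where "Long = {q. gap_of M q \<and> h \<le> gap_length q}"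
  have ap_gap: "gap_of M (ap s q)" if s: "s \<in> S" and q: "q \<in> Short" for s q
    unfolding ap_def
  proof (rule gap_image[OF M(1) inv _ eL(3)[OF s], of r])
    have "\<bar>fst q - snd q\<bar> < h" using q by (simp add: Short_def gap_length_def)
    moreover have "fst q \<in> K" "snd q \<in> K" using q M by (auto simp: Short_def gap_of_def)
    ultimately show "\<bar>act s (fst q) - act s (snd q)\<bar> < r" "\<bar>fst q - snd q\<bar> < e / 2"
      using d(2)[OF s] h by auto
    show "\<bar>act (inv s) x - act (inv s) y\<bar> < e / 2" if "x \<in> K" "y \<in> K" "\<bar>x - y\<bar> < r" for x y
      by (rule r(2)[OF S_inv[OF s] that])
  qed (use s S q in \<open>auto simp: Short_def\<close>)
  have ap_inv: "ap (inv s) (ap s q) = q" if "s \<in> S" "gap_of M q" for s q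
    using that S M by (auto simp: ap_def gap_of_def prod_eq_iff subset_iff)
  have fin_long: "finite {q. gap_of M q \<and> \<rho> \<le> gap_length q}" if "\<rho> > 0" for \<rho>
    by (rule finite_long_gaps[OF lohi(1) that])
  have ex_short: "\<exists>q. gap_of M q \<and> gap_length q < \<rho>" if \<rho>: "\<rho> > 0" for \<rho>
  proof -
    have "compact M"
    using compact_Int_closed[OF compact_K M(2)] by (simp add: Int_absorb1[OF M(1)])
    then obtain z where z: "z \<in> M" "z islimpt M"
      using M(3) unfolding compact_eq_Bolzano_Weierstrass by blast
    obtain x where x: "x \<in> M" "x \<noteq> z" "\<bar>x - z\<bar> < \<rho>"
      using z(2) \<rho> unfolding islimpt_approachable dist_real_def by blast
    define a b where "a = min x z" and "b = max x z"
    have ab: "a \<in> M" "b \<in> M" "a < b" "b - a < \<rho>" using x z by (auto simp: a_def b_def min_def max_def)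
    obtain c c' where c: "c \<in> M" "c' \<in> M" "a \<le> c" "c < c'" "c' \<le> b" "M \<inter> {c<..<c'} = {}"
      using gap_between[OF M(2,1) ab(1-3)] by blast
    have "\<not> (c < y \<and> y < c')" if "y \<in> M" for y using c(6) that by auto
    then have "gap_of M (c, c')" using c(1,2,4) by (auto simp: gap_of_def)
    moreover have "gap_length (c, c') < \<rho>" using c ab by (simp add: gap_length_def)
    ultimately show ?thesis by blast
  qed
  have inf_Short: "infinite Short"
  proof
    assume fin: "finite Short"
    have ne: "Short \<noteq> {}" using ex_short[OF h(1)] by (auto simp: Short_def)
    define \<rho> where "\<rho> = Min (gap_length ` Short)"
    have "\<rho> \<in> gap_length ` Short" unfolding \<rho>_def by (rule Min_in) (use fin ne in auto)
    then have "0 < \<rho>" "\<rho> < h" by (auto simp: Short_def intro: gap_length_pos)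
    then obtain q where q: "gap_of M q" "gap_length q < \<rho>" using ex_short by blast
    then have "q \<in> Short" using \<open>\<rho> < h\<close> by (simp add: Short_def)
    then have "\<rho> \<le> gap_length q" unfolding \<rho>_def using fin by (intro Min_le) auto
    then show False using q by simp
  qed
  define R where "R = {(q, q'). q \<in> Short \<and> q' \<in> Short \<and> (\<exists>s\<in>S. q' = ap s q)}"
  have "sym R" unfolding sym_def
  proof (intro allI impI)
    fix q q' assume "(q, q') \<in> R"
    then obtain s where s: "q \<in> Short" "q' \<in> Short" "s \<in> S" "q' = ap s q" by (auto simp: R_def)
    then have "q = ap (inv s) q'" using ap_inv by (simp add: Short_def)
    then show "(q', q) \<in> R" using s S_inv by (auto simp: R_def)
  qed
  then have symR: "sym (R\<^sup>*)" by (rule sym_rtrancl)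
  \<comment> \<open>The short gaps from which some generator exits to a long gap. They are preimages
    of finitely many long gaps under finitely many generators.\<close>
  define Ex where "Ex = {q \<in> Short. \<exists>s\<in>S. ap s q \<notin> Short}"
  have fin_Ex: "finite Ex"
  proof (rule finite_subset)
    show "finite ((\<lambda>(s, q). ap (inv s) q) ` (S \<times> Long))"
      using S(1) fin_long[OF h(1)] by (simp add: Long_def)
    show "Ex \<subseteq> (\<lambda>(s, q). ap (inv s) q) ` (S \<times> Long)"
    proof
      fix q assume "q \<in> Ex"
      then obtain s where s: "q \<in> Short" "s \<in> S" "ap s q \<notin> Short" by (auto simp: Ex_def)
      have "ap s q \<in> Long" using s ap_gap[OF s(2,1)] by (auto simp: Short_def Long_def)
      moreover have "q = ap (inv s) (ap s q)" using ap_inv s by (simp add: Short_def)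
      ultimately show "q \<in> (\<lambda>(s, q). ap (inv s) q) ` (S \<times> Long)"
        using s(2) by (intro image_eqI[of _ _ "(s, ap s q)"]) auto
    qed
  qed
  have stays: "q' \<in> Short" if "(q, q') \<in> R\<^sup>*" "q \<in> Short" for q q'
    using that by (induction rule: rtrancl_induct) (auto simp: R_def)
  have "\<exists>q\<in>Short. infinite {q'. (q, q') \<in> R\<^sup>*}"
  proof (rule ccontr)
    assume "\<not> ?thesis"
    then have fin: "finite {q'. (q, q') \<in> R\<^sup>*}" if "q \<in> Short" for q using that by blast
    \<comment> \<open>A class under \<open>R\<close> that avoids \<open>Ex\<close> is closed under
      all generators; were it finite, the first ends of its gaps would contain an infinite
      orbit.\<close>
    have "\<exists>b\<in>Ex. (b, q) \<in> R\<^sup>*" if q: "q \<in> Short" for q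
    proof (rule ccontr)
      assume no: "\<not> ?thesis"
      define C where "C = {q'. (q, q') \<in> R\<^sup>*}"
      have C_step: "ap s q' \<in> C" if "s \<in> S" "q' \<in> C" for s q'
      proof -
        have 1: "(q, q') \<in> R\<^sup>*" "q' \<in> Short" using that(2) stays q by (auto simp: C_def)
        have "(q', q) \<in> R\<^sup>*" using symR 1(1) by (rule symD)
        then have "q' \<notin> Ex" using no by blast
        then have "(q', ap s q') \<in> R" using 1(2) that(1) by (auto simp: Ex_def R_def)
        then show ?thesis using 1 by (auto simp: C_def)
      qed
      define A where "A = fst ` C"
      have qM: "fst q \<in> M" using q by (auto simp: Short_def gap_of_def)
      have "A \<subseteq> K" using stays[OF _ q] M(1) by (force simp: A_def C_def Short_def gap_of_def)
      moreover have "act s x \<in> A" if "s \<in> S0 \<union> m_inv G ` S0" "x \<in> A" for s x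
      proof -
        obtain q' where "q' \<in> C" "x = fst q'" using \<open>x \<in> A\<close> by (auto simp: A_def)
        then show ?thesis using C_step[of s q'] that(1) by (force simp: A_def S_def ap_def)
      qed
      moreover have "fst q \<in> A" by (auto simp: A_def C_def)
      ultimately have "(\<lambda>g. act g (fst q)) ` carrier G \<subseteq> A"
        using generate_invariant[OF S0(2)] S0(3) by blast
      moreover have "finite A" using fin[OF q] by (simp add: A_def C_def)
      ultimately show False using orb[OF qM] finite_subset by blast
    qed
    then have "Short \<subseteq> (\<Union>b\<in>Ex. {q'. (b, q') \<in> R\<^sup>*})" by blast
    moreover have "finite (\<Union>b\<in>Ex. {q'. (b, q') \<in> R\<^sup>*})" using fin_Ex fin by (auto simp: Ex_def)
    ultimately show False using inf_Short finite_subset by blast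
  qed
  then obtain q0 where q0: "q0 \<in> Short" "infinite {q'. (q0, q') \<in> R\<^sup>*}" by blast
  define x0 y0 where "x0 = fst q0" and "y0 = snd q0"
  have xy: "x0 \<in> M" "x0 \<noteq> y0" using q0 by (auto simp: x0_def y0_def Short_def gap_of_def)
  define \<delta> where "\<delta> = exp (- (4 * L * (hi - lo))) * \<bar>x0 - y0\<bar>"
  show ?thesis
  proof (rule that[OF xy(1), of \<delta>])
    show "\<delta> > 0" using xy by (simp add: \<delta>_def)
    fix \<rho> :: real assume \<rho>: "\<rho> > 0"
    \<comment> \<open>Infinitely many gaps can be reached from \<open>q0\<close> and only finitely
      many have length at least \<open>\<rho>\<close>, so some path ends at a gap as short as
      desired.\<close>
    have "\<not> {q'. (q0, q') \<in> R\<^sup>*} \<subseteq> {q. gap_of M q \<and> \<rho> \<le> gap_length q}"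
      using fin_long[OF \<rho>] q0(2) finite_subset by blast
    then obtain q where q: "(q0, q) \<in> R\<^sup>*" "\<not> (gap_of M q \<and> \<rho> \<le> gap_length q)" by blast
    have "q \<in> Short" using stays q(1) q0(1) by blast
    then have q_len: "gap_length q < \<rho>" using q(2) by (auto simp: Short_def)
    obtain f n where f: "f 0 = q0" "f n = q" "\<And>i. i < n \<Longrightarrow> (f i, f (Suc i)) \<in> R" "inj_on f {..n}"
      using rtrancl_simple_path[OF q(1)] by blast
    have f_Short: "f i \<in> Short" if "i \<le> n" for i
    proof (cases i)
      case 0
      then show ?thesis using f(1) q0 by simp
    next
      case (Suc j)
      then show ?thesis using f(3)[of j] that by (simp add: R_def)
    qed
    obtain g where g: "g \<in> carrier G" "\<And>t. t \<in> K \<Longrightarrow> \<bar>t - x0\<bar> \<le> \<delta> \<Longrightarrow> \<bar>act g t - act g x0\<bar> \<le> gap_length (f n)"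
    proof (rule path_distortion[OF M(1) lohi S(2) eL(2,3), of f x0 y0 n])
      show "f 0 = (x0, y0)" using f(1) by (simp add: x0_def y0_def)
      show "gap_of M (f i) \<and> gap_length (f i) < e / 2" if "i \<le> n" for i
        using f_Short[OF that] h by (auto simp: Short_def)
      show "\<exists>s\<in>S. f (Suc i) = (act s (fst (f i)), act s (snd (f i)))" if "i < n" for i
        using f(3)[OF that] by (auto simp: R_def ap_def)
    qed (use f(4) that in \<open>auto simp: \<delta>_def\<close>)
    show "\<exists>g\<in>carrier G. \<forall>t\<in>M. \<bar>t - x0\<bar> \<le> \<delta> \<longrightarrow> \<bar>act g t - act g x0\<bar> < \<rho>"
      using g M(1) q_len f(2) by (intro bexI[of _ g]) force+
  qed
qed

text \<open>By minimality and compactness, subsets of \<open>M\<close> of small enough diameter can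
  be moved into any prescribed open set meeting \<open>M\<close>. After the contraction of a
  neighbourhood \<open>C\<close> of \<open>x\<close>, this yields two maps of \<open>C\<close> into
  disjoint balls inside it, around \<open>x\<close> and around another point
  \<open>y\<close>.\<close>

lemma infinite_minimal_free:
  assumes fg: "finitely_generated_group G" and M: "M \<subseteq> K" "closed M" "infinite M"
    and inv: "\<And>g x. g \<in> carrier G \<Longrightarrow> x \<in> M \<Longrightarrow> act g x \<in> M"
    and dense: "\<And>x U. x \<in> M \<Longrightarrow> open U \<Longrightarrow> U \<inter> M \<noteq> {} \<Longrightarrow> \<exists>g\<in>carrier G. act g x \<in> U"
  shows "contains_free_subsemigroup_2 G"
proof -
  have compM: "compact M"
    using compact_Int_closed[OF compact_K M(2)] by (simp add: Int_absorb1[OF M(1)])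
  have orb: "infinite ((\<lambda>g. act g x) ` carrier G)" if x: "x \<in> M" for x
  proof
    assume fin: "finite ((\<lambda>g. act g x) ` carrier G)"
    have "M \<subseteq> (\<lambda>g. act g x) ` carrier G"
    proof (rule ccontr)
      assume "\<not> ?thesis"
      then have "- ((\<lambda>g. act g x) ` carrier G) \<inter> M \<noteq> {}" by blast
      moreover have "open (- ((\<lambda>g. act g x) ` carrier G))"
        using fin by (intro open_Compl finite_imp_closed)
      ultimately show False using dense[OF x] by blast
    qed
    then show False using fin M(3) finite_subset by blast
  qed
  obtain x d where x: "x \<in> M" and d: "d > 0" and contr:
    "\<And>r. r > 0 \<Longrightarrow> \<exists>g\<in>carrier G. \<forall>t\<in>M. \<bar>t - x\<bar> \<le> d \<longrightarrow> \<bar>act g t - act g x\<bar> < r"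
    using contracting_neighbourhood[OF fg M inv orb] by blast
  \<comment> \<open>An accumulation point of \<open>M\<close> is moved close to \<open>x\<close>
    together with a nearby point of \<open>M\<close>; at least one of the two images differs from
    \<open>x\<close>.\<close>
  obtain y where y: "y \<in> M" "y \<noteq> x" "\<bar>y - x\<bar> < d"
  proof -
    obtain z where z: "z \<in> M" "z islimpt M"
      using compM M(3) unfolding compact_eq_Bolzano_Weierstrass by blast
    have "x \<in> ball x d \<inter> M" using x d by simp
    then obtain g where g: "g \<in> carrier G" "act g z \<in> ball x d"
      using dense[OF z(1) open_ball] by blast
    have "continuous_on M (act g)" by (rule continuous_on_subset[OF act_cont[OF g(1)] M(1)])
    moreover have "d - dist x (act g z) > 0" using g by simp
    ultimately obtain e where e: "e > 0" "\<And>w. w \<in> M \<Longrightarrow> dist w z < e \<Longrightarrow> dist (act g w) (act g z) < d - dist x (act g z)"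
      using z(1) unfolding continuous_on_iff by metis
    obtain w where w: "w \<in> M" "w \<noteq> z" "dist w z < e"
      using z(2) e(1) unfolding islimpt_approachable by blast
    have "dist x (act g w) \<le> dist x (act g z) + dist (act g w) (act g z)"
      by (metis dist_commute dist_triangle)
    then have "dist x (act g w) < d" using e(2)[OF w(1,3)] by linarith
    moreover have "act g w \<noteq> act g z"
      using w(2) act_eq_iff[OF g(1) subsetD[OF M(1) w(1)] subsetD[OF M(1) z(1)]] by simp
    moreover have "act g w \<in> M" "act g z \<in> M" using inv g w z by auto
    ultimately show ?thesis
      using that[of "act g w"] that[of "act g z"] g(2) by (cases "act g w = x") (auto simp: dist_real_def)
  qed
  \<comment> \<open>The open sets carried into \<open>U\<close> by some element cover
    \<open>M\<close>; a Lebesgue number of this cover is a radius that works at every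
    centre.\<close>
  have leb: "\<exists>r>0. \<forall>z\<in>M. \<exists>g\<in>carrier G. \<forall>w\<in>M. \<bar>w - z\<bar> < r \<longrightarrow> act g w \<in> U"
    if U: "open U" "U \<inter> M \<noteq> {}" for U
  proof -
    define \<U> where "\<U> = {V. open V \<and> (\<exists>g\<in>carrier G. \<forall>w\<in>M \<inter> V. act g w \<in> U)}"
    have "M \<subseteq> \<Union>\<U>"
    proof
      fix z assume z: "z \<in> M"
      obtain g where g: "g \<in> carrier G" "act g z \<in> U" using dense[OF z U] by blast
      have "continuous_on M (act g)" by (rule continuous_on_subset[OF act_cont[OF g(1)] M(1)])
      then obtain V where V: "open V" "V \<inter> M = act g -` U \<inter> M"
        using U(1) unfolding continuous_on_open_invariant by metis
      then have "V \<in> \<U>" using g(1) by (auto simp: \<U>_def)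
      moreover have "z \<in> V" using V g z by blast
      ultimately show "z \<in> \<Union>\<U>" by blast
    qed
    moreover have "\<And>V. V \<in> \<U> \<Longrightarrow> open V" by (simp add: \<U>_def)
    ultimately obtain r where r: "r > 0" "\<And>z. z \<in> M \<Longrightarrow> \<exists>V\<in>\<U>. ball z r \<subseteq> V"
      using Heine_Borel_lemma[OF compM, of \<U>] by blast
    have "\<exists>g\<in>carrier G. \<forall>w\<in>M. \<bar>w - z\<bar> < r \<longrightarrow> act g w \<in> U" if z: "z \<in> M" for z
    proof -
      obtain V g where V: "ball z r \<subseteq> V" "g \<in> carrier G" "\<forall>w\<in>M \<inter> V. act g w \<in> U"
        using r(2)[OF z] by (auto simp: \<U>_def)
      have "act g w \<in> U" if "w \<in> M" "\<bar>w - z\<bar> < r" for w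
        using that V(1,3) by (auto simp: subset_iff dist_real_def abs_minus_commute)
      then show ?thesis using V(2) by blast
    qed
    then show ?thesis using r(1) by blast
  qed
  \<comment> \<open>The first bound makes the balls around \<open>x\<close> and \<open>y\<close>
    disjoint, the second keeps both within distance \<open>d\<close> of \<open>x\<close>.\<close>
  define \<rho> where "\<rho> = min (\<bar>y - x\<bar> / 2) (d - \<bar>y - x\<bar>)"
  have "\<rho> > 0" using y by (simp add: \<rho>_def)
  moreover have "\<rho> \<le> \<bar>y - x\<bar> / 2" "\<rho> \<le> d - \<bar>y - x\<bar>"
    unfolding \<rho>_def by (rule min.cobounded1, rule min.cobounded2)
  ultimately have \<rho>: "\<rho> > 0" "\<rho> \<le> \<bar>y - x\<bar> / 2" "\<rho> \<le> d - \<bar>y - x\<bar>" by simp_all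
  obtain r1 where r1: "r1 > 0" "\<And>z. z \<in> M \<Longrightarrow> \<exists>g\<in>carrier G. \<forall>w\<in>M. \<bar>w - z\<bar> < r1 \<longrightarrow> act g w \<in> ball x \<rho>"
    using leb[of "ball x \<rho>"] x \<rho>(1) by force
  obtain r2 where r2: "r2 > 0" "\<And>z. z \<in> M \<Longrightarrow> \<exists>g\<in>carrier G. \<forall>w\<in>M. \<bar>w - z\<bar> < r2 \<longrightarrow> act g w \<in> ball y \<rho>"
    using leb[of "ball y \<rho>"] y \<rho>(1) by force
  obtain g where g: "g \<in> carrier G" "\<And>t. t \<in> M \<Longrightarrow> \<bar>t - x\<bar> \<le> d \<Longrightarrow> \<bar>act g t - act g x\<bar> < min r1 r2"
    using contr[of "min r1 r2"] r1 r2 by auto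
  have gx: "act g x \<in> M" using inv g x by blast
  obtain h1 where h1: "h1 \<in> carrier G" "\<And>w. w \<in> M \<Longrightarrow> \<bar>w - act g x\<bar> < r1 \<Longrightarrow> act h1 w \<in> ball x \<rho>"
    using r1(2)[OF gx] by blast
  obtain h2 where h2: "h2 \<in> carrier G" "\<And>w. w \<in> M \<Longrightarrow> \<bar>w - act g x\<bar> < r2 \<Longrightarrow> act h2 w \<in> ball y \<rho>"
    using r2(2)[OF gx] by blast
  define C where "C = {t \<in> M. \<bar>t - x\<bar> \<le> d}"
  have CK: "t \<in> K" if "t \<in> C" for t using that M by (auto simp: C_def)
  have gC: "act g t \<in> M" "\<bar>act g t - act g x\<bar> < r1" "\<bar>act g t - act g x\<bar> < r2" if "t \<in> C" for t
    using g(2)[of t] inv g(1) that by (auto simp: C_def)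
  show ?thesis
  proof (rule ping_pong_free[where act = act and C = C and a = "h1 \<otimes> g" and b = "h2 \<otimes> g"
        and A = "ball x \<rho> \<inter> M" and B = "ball y \<rho> \<inter> M"])
    show "act (h1 \<otimes> g) t \<in> ball x \<rho> \<inter> M" if t: "t \<in> C" for t
    proof -
      have "act (h1 \<otimes> g) t = act h1 (act g t)" by (rule act_mult[OF h1(1) g(1) CK[OF t]])
      then show ?thesis using h1(2)[OF gC(1,2)[OF t]] inv[OF h1(1) gC(1)[OF t]] by simp
    qed
    show "act (h2 \<otimes> g) t \<in> ball y \<rho> \<inter> M" if t: "t \<in> C" for t
    proof -
      have "act (h2 \<otimes> g) t = act h2 (act g t)" by (rule act_mult[OF h2(1) g(1) CK[OF t]])
      then show ?thesis using h2(2)[OF gC(1,3)[OF t]] inv[OF h2(1) gC(1)[OF t]] by simp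
    qed
    show "ball x \<rho> \<inter> M \<subseteq> C" "ball y \<rho> \<inter> M \<subseteq> C" "ball x \<rho> \<inter> M \<inter> (ball y \<rho> \<inter> M) = {}"
      using \<rho> by (auto simp: C_def dist_real_def)
    show "C \<noteq> {}" using x d by (auto simp: C_def)
  qed (use h1 h2 g CK act_mult in auto)
qed

section \<open>Virtually commuting actions\<close>

lemma continuous_at_point:
  assumes "g \<in> carrier G" "p \<in> K" "r > 0"
  obtains d where "d > 0" "\<And>x. x \<in> K \<Longrightarrow> \<bar>x - p\<bar> \<le> d \<Longrightarrow> \<bar>act g x - act g p\<bar> \<le> r"
proof -
  obtain d where d: "d > 0" "\<And>x. x \<in> K \<Longrightarrow> dist x p < d \<Longrightarrow> dist (act g x) (act g p) < r"
    using act_cont[OF assms(1)] assms(2,3) unfolding continuous_on_iff by metis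
  show ?thesis
    by (rule that[of "d / 2"]) (use d in \<open>force simp: dist_real_def\<close>)+
qed

definition increasing_at :: "real \<Rightarrow> 'a \<Rightarrow> bool" where
  "increasing_at p g \<longleftrightarrow> (\<exists>e>0. strict_mono_on (K \<inter> {p - e..p + e}) (act g))"

definition oriented_stabilizer :: "real \<Rightarrow> 'a set" where
  "oriented_stabilizer p = {g \<in> carrier G. act g p = p \<and> increasing_at p g}"

text \<open>By tameness an element is increasing or decreasing near \<open>p\<close>, so any one
  pair of nearby points decides which.\<close>

lemma less_iff_increasing_at:
  assumes g: "g \<in> carrier G"
  obtains e where "e > 0" "\<And>r s. r \<in> K \<inter> {p - e..p + e} \<Longrightarrow> s \<in> K \<inter> {p - e..p + e} \<Longrightarrow> r < s \<Longrightarrow>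
    act g r < act g s \<longleftrightarrow> increasing_at p g"
proof (cases "increasing_at p g")
  case True
  then obtain d where d: "d > 0" "strict_mono_on (K \<inter> {p - d..p + d}) (act g)"
    unfolding increasing_at_def by blast
  show ?thesis
    by (rule that[OF d(1)]) (simp add: True strict_mono_onD[OF d(2)])
next
  case False
  obtain e L where e: "e > 0" "tame_with e L K (act g)" using act_tame[OF g] unfolding tame_def by blast
  define d where "d = e / 3"
  have d: "d > 0" using e(1) by (simp add: d_def)
  have "strict_mono_on (K \<inter> {p - d..p + d}) (act g) \<or> strict_antimono_on (K \<inter> {p - d..p + d}) (act g)"
    by (rule tame_withD(1)[OF e(2)]) (use e(1) in \<open>simp add: d_def\<close>)
  then have anti: "strict_antimono_on (K \<inter> {p - d..p + d}) (act g)"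
    using False d unfolding increasing_at_def by blast
  have "\<not> act g r < act g s" if "r \<in> K \<inter> {p - d..p + d}" "s \<in> K \<inter> {p - d..p + d}" "r < s" for r s
    using monotone_onD[OF anti that] by simp
  then show ?thesis using that[OF d] False by blast
qed

text \<open>With \<open>w\<close> the quotient, \<open>x\<close> after \<open>w\<close> is
  \<open>y\<close>; a nearby pair reversed by \<open>w\<close> would give \<open>x\<close> and
  \<open>y\<close> opposite orientations. Taking \<open>y\<close> to be \<one> handles inverses, and
  taking an inverse for \<open>x\<close> handles products.\<close>

lemma increasing_at_quotient:
  assumes x: "x \<in> carrier G" and y: "y \<in> carrier G" and p: "p \<in> K" "act x p = act y p"
    and same: "increasing_at p x \<longleftrightarrow> increasing_at p y"
  shows "increasing_at p (inv x \<otimes> y)"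
proof -
  define w where "w = inv x \<otimes> y"
  have w: "w \<in> carrier G" "x \<otimes> w = y" "act w p = p"
    using x y p by (auto simp: w_def mult_inv_cancel act_mult p(2)[symmetric])
  have xw: "act x (act w t) = act y t" if "t \<in> K" for t
    using act_mult[OF x w(1) that] w(2) by simp
  obtain a where a: "a > 0" "\<And>r s. r \<in> K \<inter> {p - a..p + a} \<Longrightarrow> s \<in> K \<inter> {p - a..p + a} \<Longrightarrow> r < s \<Longrightarrow>
      act x r < act x s \<longleftrightarrow> increasing_at p x"
    using less_iff_increasing_at[OF x, of p] by blast
  obtain b where b: "b > 0" "\<And>r s. r \<in> K \<inter> {p - b..p + b} \<Longrightarrow> s \<in> K \<inter> {p - b..p + b} \<Longrightarrow> r < s \<Longrightarrow>
      act y r < act y s \<longleftrightarrow> increasing_at p y"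
    using less_iff_increasing_at[OF y, of p] by blast
  obtain d where d: "d > 0" "\<And>t. t \<in> K \<Longrightarrow> \<bar>t - p\<bar> \<le> d \<Longrightarrow> \<bar>act w t - act w p\<bar> \<le> a"
    using continuous_at_point[OF w(1) p(1) a(1)] by blast
  define e where "e = min d b"
  have "strict_mono_on (K \<inter> {p - e..p + e}) (act w)"
  proof (rule strict_mono_onI, rule ccontr)
    fix s t assume st: "s \<in> K \<inter> {p - e..p + e}" "t \<in> K \<inter> {p - e..p + e}" "s < t"
      and not_less: "\<not> act w s < act w t"
    have K: "s \<in> K" "t \<in> K" using st by auto
    have "act w s \<noteq> act w t" using st(3) w(1) K by simp
    then have less: "act w t < act w s" using not_less by simp
    have "\<bar>act w s - p\<bar> \<le> a" "\<bar>act w t - p\<bar> \<le> a" using d(2)[of s] d(2)[of t] st w(3) by (auto simp: e_def)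
    then have "act w s \<in> K \<inter> {p - a..p + a}" "act w t \<in> K \<inter> {p - a..p + a}" using K w(1) by auto
    then have "act y t < act y s \<longleftrightarrow> increasing_at p x" using a(2)[OF _ _ less] xw K by simp
    moreover have "act y s < act y t \<longleftrightarrow> increasing_at p y" by (rule b(2)[OF _ _ st(3)]) (use st in \<open>auto simp: e_def\<close>)
    moreover have "act y s \<noteq> act y t" using st(3) y K by simp
    ultimately show False using same by auto
  qed
  moreover have "e > 0" using d(1) b(1) by (simp add: e_def)
  ultimately show ?thesis unfolding increasing_at_def w_def[symmetric] by blast
qed

lemma increasing_at_one: "increasing_at p \<one>"
  unfolding increasing_at_def by (rule exI[of _ 1]) (auto simp: monotone_on_def)

lemma subgroup_oriented_stabilizer:
  assumes p: "p \<in> K"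
  shows "subgroup (oriented_stabilizer p) G"
proof (rule subgroupI)
  show "oriented_stabilizer p \<subseteq> carrier G" by (auto simp: oriented_stabilizer_def)
  show "oriented_stabilizer p \<noteq> {}"
    using p increasing_at_one by (auto simp: oriented_stabilizer_def intro!: exI[of _ \<one>])
  show inv: "inv a \<in> oriented_stabilizer p" if a: "a \<in> oriented_stabilizer p" for a
    using increasing_at_quotient[of a \<one> p] a p increasing_at_one act_inv_fixed[of a p]
    by (simp add: oriented_stabilizer_def)
  show "a \<otimes> b \<in> oriented_stabilizer p" if a: "a \<in> oriented_stabilizer p" and b: "b \<in> oriented_stabilizer p" for a b
    using increasing_at_quotient[of "inv a" b p] inv[OF a] a b p
    by (simp add: oriented_stabilizer_def act_mult)
qed

text \<open>Right cosets of a stabiliser are determined by where the inverse sends the point, hence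
  \<open>inv x\<close> in \<open>\<phi>\<close>.\<close>

lemma fin_index_oriented_stabilizer:
  assumes p: "p \<in> K" and fin: "finite ((\<lambda>g. act g p) ` carrier G)"
  shows "fin_index G (oriented_stabilizer p)"
proof (rule fin_indexI[OF subgroup_oriented_stabilizer[OF p], where \<phi> = "\<lambda>x. (act (inv x) p, increasing_at p (inv x))"])
  have "(\<lambda>x. (act (inv x) p, increasing_at p (inv x))) ` carrier G \<subseteq> ((\<lambda>g. act g p) ` carrier G) \<times> UNIV"
    by auto
  then show "finite ((\<lambda>x. (act (inv x) p, increasing_at p (inv x))) ` carrier G)"
    by (rule finite_subset) (use fin in simp)
next
  fix x y assume x: "x \<in> carrier G" and y: "y \<in> carrier G"
    and eq: "(act (inv x) p, increasing_at p (inv x)) = (act (inv y) p, increasing_at p (inv y))"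
  have "increasing_at p (inv (inv x) \<otimes> inv y)"
    by (rule increasing_at_quotient) (use x y p eq in auto)
  moreover have "act (x \<otimes> inv y) p = p"
    using x y p eq act_mult[of x "inv y" p] by (metis Pair_inject act_inv(2) inv_closed)
  ultimately show "x \<otimes> inv y \<in> oriented_stabilizer p" using x y by (simp add: oriented_stabilizer_def)
qed

definition virtually_commuting_on :: "real set \<Rightarrow> bool" where
  "virtually_commuting_on U \<longleftrightarrow>
     (\<exists>H. fin_index G H \<and> (\<forall>g\<in>H. \<forall>h\<in>H. \<forall>t\<in>K \<inter> U. act (g \<otimes> h) t = act (h \<otimes> g) t))"

text \<open>The oriented stabiliser has finite index, so it is finitely generated by Schreier's
  lemma and inherits the absence of free subsemigroups; \<open>local_commute\<close> then applies to
  its action.\<close>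

lemma virtually_commuting_near_finite_orbit:
  assumes fg: "finitely_generated_group G" and nf: "\<not> contains_free_subsemigroup_2 G"
    and p: "p \<in> K" and fin: "finite ((\<lambda>g. act g p) ` carrier G)"
  obtains U where "open U" "p \<in> U" "virtually_commuting_on U"
proof -
  define H where "H = oriented_stabilizer p"
  have H: "fin_index G H" unfolding H_def by (rule fin_index_oriented_stabilizer[OF p fin])
  have sH: "subgroup H G" using H by (simp add: fin_index_def)
  interpret H: lip_action "G\<lparr>carrier := H\<rparr>" K act by (rule lip_action_subgroup[OF sH])
  have nfH: "\<not> contains_free_subsemigroup_2 (G\<lparr>carrier := H\<rparr>)"
    using contains_free_subsemigroup_2_subgroup[OF subgroup.subset[OF sH]] nf by blast
  obtain e where e: "e > 0" "\<And>g h t. g \<in> H \<Longrightarrow> h \<in> H \<Longrightarrow> t \<in> K \<Longrightarrow> \<bar>t - p\<bar> < e \<Longrightarrow>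
      act (g \<otimes> h) t = act (h \<otimes> g) t"
  proof (rule H.local_commute[OF nfH finitely_generated_fin_index[OF fg H] p])
    show "act g p = p" if "g \<in> carrier (G\<lparr>carrier := H\<rparr>)" for g
      using that by (simp add: H_def oriented_stabilizer_def)
    show "\<exists>e>0. strict_mono_on (K \<inter> {p - e..p + e}) (act g)" if "g \<in> carrier (G\<lparr>carrier := H\<rparr>)" for g
      using that by (simp add: H_def oriented_stabilizer_def increasing_at_def)
  qed (use that in simp)
  have "virtually_commuting_on (ball p e)"
    unfolding virtually_commuting_on_def using H e(2)
    by (intro exI[of _ H]) (auto simp: dist_real_def abs_minus_commute)
  then show ?thesis using that[of "ball p e"] e(1) by simp
qed

text \<open>Conjugating the subgroup by \<open>inv g\<close> transports commutation from a
  neighbourhood of \<open>act g p\<close> to one of \<open>p\<close>.\<close>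

lemma virtually_commuting_on_image:
  assumes U: "open U" "virtually_commuting_on U" and g: "g \<in> carrier G" and p: "p \<in> K" "act g p \<in> U"
  obtains V where "open V" "p \<in> V" "virtually_commuting_on V"
proof -
  obtain H where H: "fin_index G H" "\<And>h k t. h \<in> H \<Longrightarrow> k \<in> H \<Longrightarrow> t \<in> K \<Longrightarrow> t \<in> U \<Longrightarrow>
      act (h \<otimes> k) t = act (k \<otimes> h) t"
    using U(2) unfolding virtually_commuting_on_def by blast
  obtain V where V: "open V" "V \<inter> K = act g -` U \<inter> K"
    using act_cont[OF g] U(1) unfolding continuous_on_open_invariant by metis
  define H' where "H' = {x \<in> carrier G. inv (inv g) \<otimes> x \<otimes> inv g \<in> H}"
  have H': "fin_index G H'" unfolding H'_def by (rule fin_index_conj[OF H(1)]) (use g in simp)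
  have "act (h \<otimes> k) t = act (k \<otimes> h) t" if h: "h \<in> H'" and k: "k \<in> H'" and t: "t \<in> K \<inter> V" for h k t
  proof -
    have c: "h \<in> carrier G" "k \<in> carrier G" "t \<in> K" "g \<otimes> h \<otimes> inv g \<in> H" "g \<otimes> k \<otimes> inv g \<in> H"
      using h k t g by (auto simp: H'_def)
    have "act g t \<in> U" using V(2) t by blast
    then have "act ((g \<otimes> h \<otimes> inv g) \<otimes> (g \<otimes> k \<otimes> inv g)) (act g t) = act ((g \<otimes> k \<otimes> inv g) \<otimes> (g \<otimes> h \<otimes> inv g)) (act g t)"
      using H(2)[OF c(4,5)] c g by simp
    then have "act g (act h (act k t)) = act g (act k (act h t))" using c g by (simp add: act_mult)
    then show ?thesis using c g by (simp add: act_mult)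
  qed
  then have "virtually_commuting_on V" unfolding virtually_commuting_on_def using H' by blast
  moreover have "p \<in> V" using V(2) p by blast
  ultimately show ?thesis using that V(1) by blast
qed

lemma minimal_set_exists:
  assumes Z: "closed Z" "Z \<subseteq> K" "Z \<noteq> {}" "\<And>g x. g \<in> carrier G \<Longrightarrow> x \<in> Z \<Longrightarrow> act g x \<in> Z"
  obtains M where "closed M" "M \<subseteq> Z" "M \<noteq> {}" "\<forall>g\<in>carrier G. \<forall>x\<in>M. act g x \<in> M"
    "\<forall>x\<in>M. \<forall>U. open U \<longrightarrow> U \<inter> M \<noteq> {} \<longrightarrow> (\<exists>g\<in>carrier G. act g x \<in> U)"
proof -
  define good where "good M \<longleftrightarrow> closed M \<and> M \<subseteq> Z \<and> M \<noteq> {} \<and> (\<forall>g\<in>carrier G. \<forall>x\<in>M. act g x \<in> M)" for M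
  have goodZ: "good Z" using Z by (auto simp: good_def)
  \<comment> \<open>Zorn's lemma supplies maximal elements, so it is applied to complements;
    compactness keeps intersections of chains nonempty.\<close>
  have "\<exists>A\<in>{A. good (- A)}. \<forall>B\<in>{A. good (- A)}. A \<subseteq> B \<longrightarrow> B = A"
  proof (rule subset_Zorn_nonempty)
    show "{A. good (- A)} \<noteq> {}" using goodZ by (auto intro!: exI[of _ "- Z"])
    fix \<C> assume ne: "\<C> \<noteq> {}" and ch: "subset.chain {A. good (- A)} \<C>"
    have gC: "good (- A)" if "A \<in> \<C>" for A using ch that by (auto simp: subset_chain_def)
    have cmp: "A \<subseteq> B \<or> B \<subseteq> A" if "A \<in> \<C>" "B \<in> \<C>" for A B using ch that by (auto simp: subset_chain_def)
    have "\<Inter>(uminus ` \<C>) \<noteq> {}"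
    proof (rule compact_chain)
      show "compact S" if "S \<in> uminus ` \<C>" for S
      proof -
        from that obtain A where "A \<in> \<C>" "S = - A" by blast
        then have "closed S" "S \<subseteq> K" using gC[of A] Z(2) unfolding good_def by blast+
        then show ?thesis using compact_Int_closed[OF compact_K, of S] by (simp add: Int_absorb1)
      qed
      show "{} \<notin> uminus ` \<C>" using gC by (fastforce simp: good_def)
      show "S \<subseteq> T \<or> T \<subseteq> S" if "S \<in> uminus ` \<C> \<and> T \<in> uminus ` \<C>" for S T using cmp that by blast
    qed
    moreover have "- \<Union>\<C> = \<Inter>(uminus ` \<C>)" by auto
    moreover have "closed (\<Inter>(uminus ` \<C>))" using gC by (intro closed_Inter) (auto simp: good_def)
    moreover have "\<Inter>(uminus ` \<C>) \<subseteq> Z"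
    proof -
      obtain A where A: "A \<in> \<C>" using ne by blast
      then have "\<Inter>(uminus ` \<C>) \<subseteq> - A" "- A \<subseteq> Z" using gC[OF A] unfolding good_def by blast+
      then show ?thesis by blast
    qed
    moreover have "act g x \<in> \<Inter>(uminus ` \<C>)" if "g \<in> carrier G" "x \<in> \<Inter>(uminus ` \<C>)" for g x
      using gC that by (auto simp: good_def)
    ultimately show "\<Union>\<C> \<in> {A. good (- A)}" by (simp add: good_def)
  qed
  then obtain A where A: "good (- A)" "\<And>B. good (- B) \<Longrightarrow> A \<subseteq> B \<Longrightarrow> B = A" by blast
  define M where "M = - A"
  have M: "closed M" "M \<subseteq> Z" "M \<noteq> {}" "\<forall>g\<in>carrier G. \<forall>x\<in>M. act g x \<in> M"
    using A(1) by (auto simp: good_def M_def)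
  have min: "N = M" if "good N" "N \<subseteq> M" for N
    using A(2)[of "- N"] that by (auto simp: M_def)
  show ?thesis
  proof (rule that[OF M], intro ballI allI impI)
    fix x U assume x: "x \<in> M" and U: "open U" "U \<inter> M \<noteq> {}"
    show "\<exists>g\<in>carrier G. act g x \<in> U"
    proof (rule ccontr)
      assume no: "\<not> ?thesis"
      \<comment> \<open>The points whose orbits avoid \<open>U\<close> form a closed invariant
        subset of \<open>M\<close>. If nonempty it is all of \<open>M\<close> by minimality, which
        is absurd because \<open>U\<close> meets \<open>M\<close>.\<close>
      define N where "N = {y \<in> M. \<forall>g\<in>carrier G. act g y \<notin> U}"
      have MK: "M \<subseteq> K" using M(2) Z(2) by blast
      have "closed (M \<inter> act g -` (- U))" if "g \<in> carrier G" for g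
        by (rule continuous_closed_preimage[OF continuous_on_subset[OF act_cont[OF that] MK] M(1)])
          (use U in \<open>simp add: closed_def\<close>)
      then have "closed (\<Inter>g\<in>carrier G. M \<inter> act g -` (- U))" by blast
      moreover have "(\<Inter>g\<in>carrier G. M \<inter> act g -` (- U)) = N" by (auto simp: N_def)
      ultimately have "closed N" by simp
      moreover have "act h y \<in> N" if "h \<in> carrier G" "y \<in> N" for h y
      proof -
        have y: "y \<in> M" "y \<in> K" using that MK by (auto simp: N_def)
        have "act g (act h y) \<notin> U" if g: "g \<in> carrier G" for g
        proof -
          have "act (g \<otimes> h) y \<notin> U" using \<open>y \<in> N\<close> g \<open>h \<in> carrier G\<close> unfolding N_def by blast
          then show ?thesis using act_mult[OF g \<open>h \<in> carrier G\<close> y(2)] by simp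
        qed
        then show ?thesis using M(4) that(1) y(1) by (simp add: N_def)
      qed
      moreover have "x \<in> N" using x no by (auto simp: N_def)
      ultimately have "good N" using M(2) by (auto simp: good_def N_def)
      then have "N = M" by (rule min) (auto simp: N_def)
      obtain y where y: "y \<in> U" "y \<in> M" using U(2) by blast
      then have "y \<in> N" using \<open>N = M\<close> by simp
      then have "act \<one> y \<notin> U" by (auto simp: N_def)
      then show False using y MK by auto
    qed
  qed
qed

theorem virtually_commuting:
  assumes fg: "finitely_generated_group G" and nf: "\<not> contains_free_subsemigroup_2 G"
  obtains H where "fin_index G H" "\<And>g h t. g \<in> H \<Longrightarrow> h \<in> H \<Longrightarrow> t \<in> K \<Longrightarrow> act (g \<otimes> h) t = act (h \<otimes> g) t"
proof -
  define \<U> where "\<U> = {U. open U \<and> virtually_commuting_on U}"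
  have cover: "K \<subseteq> \<Union>\<U>"
  proof (rule ccontr)
    assume nc: "\<not> K \<subseteq> \<Union>\<U>"
    define Z where "Z = K - \<Union>\<U>"
    have "open (\<Union>\<U>)" by (rule open_Union) (simp add: \<U>_def)
    then have cZ: "closed Z" unfolding Z_def using closed_K by (rule closed_Diff[rotated])
    have iZ: "act g x \<in> Z" if g: "g \<in> carrier G" and x: "x \<in> Z" for g x
    proof -
      have "act g x \<notin> U" if U: "U \<in> \<U>" for U
      proof
        assume "act g x \<in> U"
        then obtain V where "open V" "x \<in> V" "virtually_commuting_on V"
          using virtually_commuting_on_image[of U g x] U g x by (auto simp: \<U>_def Z_def)
        then show False using x by (auto simp: \<U>_def Z_def)
      qed
      then show ?thesis using g x by (auto simp: Z_def)
    qed
    have sZ: "Z \<subseteq> K" "Z \<noteq> {}" using nc by (auto simp: Z_def)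
    obtain M where M: "closed M" "M \<subseteq> Z" "M \<noteq> {}" "\<forall>g\<in>carrier G. \<forall>x\<in>M. act g x \<in> M"
      "\<forall>x\<in>M. \<forall>U. open U \<longrightarrow> U \<inter> M \<noteq> {} \<longrightarrow> (\<exists>g\<in>carrier G. act g x \<in> U)"
      by (rule minimal_set_exists[OF cZ sZ iZ])
    have MK: "M \<subseteq> K" using M(2) by (auto simp: Z_def)
    have "finite M" using infinite_minimal_free[OF fg MK M(1)] M(4,5) nf by blast
    obtain p where p: "p \<in> M" using M(3) by blast
    have "finite ((\<lambda>g. act g p) ` carrier G)"
      by (rule finite_subset[OF _ \<open>finite M\<close>]) (use M(4) p in auto)
    then obtain U where "open U" "p \<in> U" "virtually_commuting_on U"
      using virtually_commuting_near_finite_orbit[OF fg nf] p MK by blast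
    then have "p \<in> \<Union>\<U>" by (auto simp: \<U>_def)
    then show False using p M(2) by (auto simp: Z_def)
  qed
  obtain D where D: "D \<subseteq> \<U>" "finite D" "K \<subseteq> \<Union>D"
    using compactE[OF compact_K cover] by (auto simp: \<U>_def)
  have "\<forall>U\<in>D. \<exists>H. fin_index G H \<and> (\<forall>g\<in>H. \<forall>h\<in>H. \<forall>t\<in>K \<inter> U. act (g \<otimes> h) t = act (h \<otimes> g) t)"
    using D(1) by (auto simp: \<U>_def virtually_commuting_on_def)
  then obtain H where H: "\<And>U. U \<in> D \<Longrightarrow> fin_index G (H U)"
    "\<And>U g h t. U \<in> D \<Longrightarrow> g \<in> H U \<Longrightarrow> h \<in> H U \<Longrightarrow> t \<in> K \<inter> U \<Longrightarrow> act (g \<otimes> h) t = act (h \<otimes> g) t"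
    by metis
  show ?thesis
  proof (rule that)
    show "fin_index G (carrier G \<inter> (\<Inter>U\<in>D. H U))" by (rule fin_index_Inter[OF D(2) H(1)])
    fix g h t assume gh: "g \<in> carrier G \<inter> (\<Inter>U\<in>D. H U)" "h \<in> carrier G \<inter> (\<Inter>U\<in>D. H U)" and t: "t \<in> K"
    obtain U where "U \<in> D" "t \<in> U" using D(3) t by blast
    then show "act (g \<otimes> h) t = act (h \<otimes> g) t" using H(2)[of U g h t] gh t by auto
  qed
qed

end

section \<open>Local diffeomorphisms of class C1+Lip\<close>

lemma C1_diffeomorphism_on_deriv:
  assumes I: "open I" and F: "C1_diffeomorphism_on I F"
  shows "continuous_on I (deriv F)"
    and "\<And>t. t \<in> I \<Longrightarrow> (F has_real_derivative deriv F t) (at t)"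
    and "\<And>t. t \<in> I \<Longrightarrow> deriv F t \<noteq> 0"
proof -
  obtain H where H: "homeomorphism I (F ` I) F H" "F C1_differentiable_on I" "H C1_differentiable_on (F ` I)"
    using F unfolding C1_diffeomorphism_on_def by blast
  obtain D where D: "\<And>t. t \<in> I \<Longrightarrow> (F has_real_derivative D t) (at t)" "continuous_on I D"
    using H(2) unfolding C1_differentiable_on_def has_real_derivative_iff_has_vector_derivative by blast
  obtain E where E: "\<And>t. t \<in> F ` I \<Longrightarrow> (H has_real_derivative E t) (at t)"
    using H(3) unfolding C1_differentiable_on_def has_real_derivative_iff_has_vector_derivative by blast
  have deriv: "deriv F t = D t" if "t \<in> I" for t by (rule DERIV_imp_deriv[OF D(1)[OF that]])
  show "continuous_on I (deriv F)" using D(2) deriv by (simp cong: continuous_on_cong)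
  show "(F has_real_derivative deriv F t) (at t)" if "t \<in> I" for t using D(1)[OF that] deriv[OF that] by simp
  \<comment> \<open>The inverse is differentiable too, and the chain rule makes the product of the
    two derivatives 1.\<close>
  show "deriv F t \<noteq> 0" if t: "t \<in> I" for t
  proof -
    have "((\<lambda>x. H (F x)) has_real_derivative E (F t) * D t) (at t)"
      by (rule DERIV_chain2[OF E D(1)[OF t]]) (use t in simp)
    then have "((\<lambda>x. x) has_real_derivative E (F t) * D t) (at t)"
      by (rule has_field_derivative_transform_within_open[OF _ I t]) (use homeomorphism_apply1[OF H(1)] in simp)
    then have "E (F t) * D t = 1" using DERIV_ident DERIV_unique by blast
    then show ?thesis using deriv[OF t] by auto
  qed
qed

text \<open>\<open>deriv F\<close> has no zeros and so keeps its sign. By the mean value theorem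
  secant slopes are values of the derivative, and the Lipschitz bound on its logarithm limits the
  quotient of two such values.\<close>

lemma local_bounded_distortion:
  assumes I: "open I" "C1_diffeomorphism_on I F" and L: "L-lipschitz_on I (\<lambda>t. ln \<bar>deriv F t\<bar>)"
    and ab: "{a..b} \<subseteq> I"
  shows "strict_mono_on {a..b} F \<or> strict_antimono_on {a..b} F"
    and "\<And>t z t' z'. t \<in> {a..b} \<Longrightarrow> z \<in> {a..b} \<Longrightarrow> t' \<in> {a..b} \<Longrightarrow> z' \<in> {a..b} \<Longrightarrow>
      \<bar>F t - F z\<bar> * \<bar>t' - z'\<bar> \<le> exp (L * (b - a)) * \<bar>F t' - F z'\<bar> * \<bar>t - z\<bar>"
proof -
  note D = C1_diffeomorphism_on_deriv[OF I]
  have sgn: "(\<forall>t\<in>{a..b}. deriv F t > 0) \<or> (\<forall>t\<in>{a..b}. deriv F t < 0)"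
  proof (rule ccontr)
    assume "\<not> ?thesis"
    then obtain s t where st: "s \<in> {a..b}" "t \<in> {a..b}" "deriv F s \<le> 0" "deriv F t \<ge> 0" by force
    have "connected (deriv F ` {a..b})"
      by (rule connected_continuous_image[OF continuous_on_subset[OF D(1) ab]]) simp
    then have "0 \<in> deriv F ` {a..b}"
      using st unfolding connected_iff_interval by (meson image_eqI)
    then show False using D(3) ab by force
  qed
  show "strict_mono_on {a..b} F \<or> strict_antimono_on {a..b} F"
    using sgn
  proof (rule disj_forward)
    assume pos: "\<forall>t\<in>{a..b}. deriv F t > 0"
    show "strict_mono_on {a..b} F"
    proof (rule strict_mono_onI)
      fix r s assume rs: "r \<in> {a..b}" "s \<in> {a..b}" "r < s"
      show "F r < F s"
      proof (rule DERIV_pos_imp_increasing[OF rs(3)])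
        fix x assume "r \<le> x" "x \<le> s"
        then have "x \<in> {a..b}" using rs by auto
        then show "\<exists>y. DERIV F x :> y \<and> y > 0" using D(2) pos ab by blast
      qed
    qed
  next
    assume neg: "\<forall>t\<in>{a..b}. deriv F t < 0"
    show "strict_antimono_on {a..b} F"
    proof (rule monotone_onI)
      fix r s assume rs: "r \<in> {a..b}" "s \<in> {a..b}" "r < s"
      show "F s < F r"
      proof (rule DERIV_neg_imp_decreasing[OF rs(3)])
        fix x assume "r \<le> x" "x \<le> s"
        then have "x \<in> {a..b}" using rs by auto
        then show "\<exists>y. DERIV F x :> y \<and> y < 0" using D(2) neg ab by blast
      qed
    qed
  qed
  have mvt: "\<exists>\<xi>\<in>{a..b}. \<bar>F t - F z\<bar> = \<bar>deriv F \<xi>\<bar> * \<bar>t - z\<bar>" if tz: "t \<in> {a..b}" "z \<in> {a..b}" for t z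
  proof -
    have *: "\<exists>\<xi>\<in>{a..b}. \<bar>F t - F z\<bar> = \<bar>deriv F \<xi>\<bar> * \<bar>t - z\<bar>" if less: "t \<in> {a..b}" "z \<in> {a..b}" "t < z" for t z
    proof -
      have d: "DERIV F x :> deriv F x" if "t \<le> x" "x \<le> z" for x
        using that less(1,2) ab by (intro D(2)) auto
      obtain \<xi> where \<xi>: "t < \<xi>" "\<xi> < z" "F z - F t = (z - t) * deriv F \<xi>"
        using MVT2[OF less(3) d] by blast
      have "\<bar>F t - F z\<bar> = \<bar>F z - F t\<bar>" by simp
      also have "\<dots> = \<bar>deriv F \<xi>\<bar> * \<bar>t - z\<bar>" unfolding \<xi>(3) by (simp add: abs_mult abs_minus_commute)
      finally show ?thesis using \<xi>(1,2) less(1,2) by (intro bexI[of _ \<xi>]) auto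
    qed
    consider "t < z" | "t = z" | "z < t" by linarith
    then show ?thesis
    proof cases
      case 3
      then show ?thesis using *[OF tz(2,1) 3] by (simp add: abs_minus_commute)
    qed (use *[OF tz] tz in auto)
  qed
  fix t z t' z' assume *: "t \<in> {a..b}" "z \<in> {a..b}" "t' \<in> {a..b}" "z' \<in> {a..b}"
  obtain \<xi> where \<xi>: "\<xi> \<in> {a..b}" "\<bar>F t - F z\<bar> = \<bar>deriv F \<xi>\<bar> * \<bar>t - z\<bar>" using mvt *(1,2) by blast
  obtain \<xi>' where \<xi>': "\<xi>' \<in> {a..b}" "\<bar>F t' - F z'\<bar> = \<bar>deriv F \<xi>'\<bar> * \<bar>t' - z'\<bar>" using mvt *(3,4) by blast
  have nz: "\<bar>deriv F \<xi>\<bar> > 0" "\<bar>deriv F \<xi>'\<bar> > 0" using D(3) \<xi>(1) \<xi>'(1) ab by auto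
  have "\<bar>ln \<bar>deriv F \<xi>\<bar> - ln \<bar>deriv F \<xi>'\<bar>\<bar> \<le> L * \<bar>\<xi> - \<xi>'\<bar>"
    using lipschitz_onD[OF L subsetD[OF ab \<xi>(1)] subsetD[OF ab \<xi>'(1)]] by (simp add: dist_real_def)
  also have "\<dots> \<le> L * (b - a)" using \<xi>(1) \<xi>'(1) lipschitz_on_nonneg[OF L] by (intro mult_left_mono) auto
  finally have "ln \<bar>deriv F \<xi>\<bar> \<le> L * (b - a) + ln \<bar>deriv F \<xi>'\<bar>" by linarith
  then have "exp (ln \<bar>deriv F \<xi>\<bar>) \<le> exp (L * (b - a) + ln \<bar>deriv F \<xi>'\<bar>)" by simp
  then have le: "\<bar>deriv F \<xi>\<bar> \<le> exp (L * (b - a)) * \<bar>deriv F \<xi>'\<bar>" using nz by (simp add: exp_add)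
  have "\<bar>F t - F z\<bar> * \<bar>t' - z'\<bar> = \<bar>deriv F \<xi>\<bar> * (\<bar>t - z\<bar> * \<bar>t' - z'\<bar>)" using \<xi>(2) by simp
  also have "\<dots> \<le> (exp (L * (b - a)) * \<bar>deriv F \<xi>'\<bar>) * (\<bar>t - z\<bar> * \<bar>t' - z'\<bar>)"
    by (rule mult_right_mono[OF le]) simp
  also have "\<dots> = exp (L * (b - a)) * \<bar>F t' - F z'\<bar> * \<bar>t - z\<bar>" using \<xi>'(2) by simp
  finally show "\<bar>F t - F z\<bar> * \<bar>t' - z'\<bar> \<le> exp (L * (b - a)) * \<bar>F t' - F z'\<bar> * \<bar>t - z\<bar>" .
qed

text \<open>A Lebesgue number of a finite cover by charts serves as \<open>e\<close>: every shorter
  interval that meets \<open>K\<close> lies inside a single chart.\<close>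

lemma diff_1Lip_tame:
  assumes K: "compact K" and f: "f \<in> diff_1Lip K"
  shows "tame K f"
proof -
  define good where "good I F L \<longleftrightarrow> open I \<and> C1_diffeomorphism_on I F \<and>
    L-lipschitz_on I (\<lambda>t. ln \<bar>deriv F t\<bar>) \<and> (\<forall>t\<in>I \<inter> K. F t = f t)" for I F L
  define \<C> where "\<C> = {I. \<exists>F L. good I F L}"
  have "K \<subseteq> \<Union>\<C>"
  proof
    fix x assume "x \<in> K"
    then obtain I F where I: "open I" "x \<in> I" "C1_diffeomorphism_on I F"
      "\<exists>L. L-lipschitz_on I (\<lambda>t. ln \<bar>deriv F t\<bar>)" "\<forall>t\<in>I \<inter> K. F t = f t"
      using f unfolding diff_1Lip_def by blast
    then have "I \<in> \<C>" unfolding \<C>_def good_def by blast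
    then show "x \<in> \<Union>\<C>" using I(2) by blast
  qed
  moreover have "\<And>I. I \<in> \<C> \<Longrightarrow> open I" by (auto simp: \<C>_def good_def)
  ultimately obtain \<D> where \<D>: "\<D> \<subseteq> \<C>" "finite \<D>" "K \<subseteq> \<Union>\<D>"
    using compactE[OF K, of \<C>] by metis
  have "\<forall>I\<in>\<D>. \<exists>F L. good I F L" using \<D>(1) by (auto simp: \<C>_def)
  then obtain F L where FL: "\<And>I. I \<in> \<D> \<Longrightarrow> good I (F I) (L I)" by metis
  have opn: "\<And>I. I \<in> \<D> \<Longrightarrow> open I" using FL by (simp add: good_def)
  obtain e where e: "e > 0" "\<And>x. x \<in> K \<Longrightarrow> \<exists>I\<in>\<D>. ball x e \<subseteq> I"
    using Heine_Borel_lemma[OF K \<D>(3) opn] by blast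
  have L_nonneg: "L I \<ge> 0" if "I \<in> \<D>" for I
    using FL[OF that] lipschitz_on_nonneg unfolding good_def by blast
  \<comment> \<open>The sum of the nonnegative constants dominates each of them.\<close>
  define L0 where "L0 = (\<Sum>I\<in>\<D>. L I)"
  have L0: "L I \<le> L0" if "I \<in> \<D>" for I
    unfolding L0_def by (rule member_le_sum[OF that]) (use L_nonneg \<D>(2) in auto)
  have "tame_with e L0 K f" unfolding tame_with_def
  proof (intro allI impI)
    fix a b :: real assume ab: "b - a < e"
    show "(strict_mono_on (K \<inter> {a..b}) f \<or> strict_antimono_on (K \<inter> {a..b}) f) \<and>
     (\<forall>t\<in>K \<inter> {a..b}. \<forall>z\<in>K \<inter> {a..b}. \<forall>t'\<in>K \<inter> {a..b}. \<forall>z'\<in>K \<inter> {a..b}.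
        \<bar>f t - f z\<bar> * \<bar>t' - z'\<bar> \<le> exp (L0 * (b - a)) * \<bar>f t' - f z'\<bar> * \<bar>t - z\<bar>)"
    proof (cases "K \<inter> {a..b} = {}")
      case False
      then obtain x where "x \<in> K \<inter> {a..b}" by blast
      then have x: "x \<in> K" "a \<le> x" "x \<le> b" by auto
      obtain I where I: "I \<in> \<D>" "ball x e \<subseteq> I" using e(2)[OF x(1)] by blast
      have "{a..b} \<subseteq> ball x e" using x ab by (auto simp: dist_real_def)
      then have abI: "{a..b} \<subseteq> I" using I(2) by blast
      have g: "open I" "C1_diffeomorphism_on I (F I)" "L0-lipschitz_on I (\<lambda>t. ln \<bar>deriv (F I) t\<bar>)"
        "\<And>t. t \<in> K \<inter> {a..b} \<Longrightarrow> f t = F I t"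
        using FL[OF I(1)] lipschitz_on_le[OF _ L0[OF I(1)]] abI unfolding good_def by auto
      note loc = local_bounded_distortion[OF g(1-3) abI]
      have "strict_mono_on (K \<inter> {a..b}) f \<or> strict_antimono_on (K \<inter> {a..b}) f"
        using loc(1) g(4) by (auto simp: monotone_on_def)
      moreover have "\<bar>f t - f z\<bar> * \<bar>t' - z'\<bar> \<le> exp (L0 * (b - a)) * \<bar>f t' - f z'\<bar> * \<bar>t - z\<bar>"
        if "t \<in> K \<inter> {a..b}" "z \<in> K \<inter> {a..b}" "t' \<in> K \<inter> {a..b}" "z' \<in> K \<inter> {a..b}" for t z t' z'
        using loc(2)[of t z t' z'] that g(4) by simp
      ultimately show ?thesis by blast
    qed (simp add: monotone_on_def)
  qed
  moreover have "L0 \<ge> 0" unfolding L0_def by (rule sum_nonneg) (rule L_nonneg)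
  ultimately show ?thesis using e(1) unfolding tame_def by blast
qed

lemma homeomorphism_inverse_restrict:
  assumes "homeomorphism I (F ` I) F H" "J \<subseteq> F ` I"
  shows "homeomorphism J (H ` J) H F"
proof -
  have "homeomorphism (F ` I) I H F" using assms(1) by (rule homeomorphism_symD)
  then show ?thesis
    by (rule homeomorphism_of_subsets) (use assms(2) homeomorphism_image2[OF assms(1)] in auto)
qed

text \<open>The inverse extends locally by the inverse \<open>H\<close> of a chart \<open>F\<close>.
  Its log-derivative is minus that of \<open>F\<close> composed with \<open>H\<close>, hence
  Lipschitz on a ball small enough for the derivative of \<open>H\<close> to be bounded.\<close>

lemma diff_1Lip_inverse:
  assumes f: "f \<in> diff_1Lip K"
  shows "restrict (inv_into K f) K \<in> diff_1Lip K"
proof -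
  let ?g = "restrict (inv_into K f) K"
  have fB: "f \<in> Bij K" using f by (simp add: diff_1Lip_def)
  have bij: "bij_betw f K K" using fB by (simp add: Bij_def)
  have fg: "f (?g y) = y" "?g y \<in> K" if "y \<in> K" for y
    using that bij by (auto simp: bij_betw_def f_inv_into_f inv_into_into)
  obtain g' where g': "homeomorphism K K f g'" using f by (auto simp: diff_1Lip_def)
  have g_eq: "g' y = ?g y" if "y \<in> K" for y
  proof -
    have "g' y = g' (f (?g y))" using fg[OF that] by simp
    also have "\<dots> = ?g y" by (rule homeomorphism_apply1[OF g' fg(2)[OF that]])
    finally show ?thesis .
  qed
  have homeo: "homeomorphism K K ?g f"
    by (rule homeomorphism_cong[OF homeomorphism_symD[OF g']]) (use g_eq in auto)
  have local: "\<exists>J E. open J \<and> is_interval J \<and> y \<in> J \<and> C1_diffeomorphism_on J E \<and>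
      (\<exists>L. L-lipschitz_on J (\<lambda>t. ln \<bar>deriv E t\<bar>)) \<and> (\<forall>t\<in>J \<inter> K. E t = ?g t)" if y: "y \<in> K" for y
  proof -
    define x where "x = ?g y"
    have x: "x \<in> K" "f x = y" using fg[OF y] by (simp_all add: x_def)
    obtain I F L where I: "open I" "x \<in> I" "C1_diffeomorphism_on I F"
      "L-lipschitz_on I (\<lambda>t. ln \<bar>deriv F t\<bar>)" "\<And>t. t \<in> I \<inter> K \<Longrightarrow> F t = f t"
      using f x(1) unfolding diff_1Lip_def by blast
    obtain H where H: "homeomorphism I (F ` I) F H" "F C1_differentiable_on I" "H C1_differentiable_on (F ` I)"
      using I(3) unfolding C1_diffeomorphism_on_def by blast
    note HF = homeomorphism_apply1[OF H(1)]
    have opn: "open (F ` I)"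
      by (rule invariance_of_domain[OF homeomorphism_cont1[OF H(1)] I(1)])
        (metis HF inj_onI)
    have yF: "y \<in> F ` I" using I(2,5) x by (metis IntI image_eqI)
    obtain E where E: "\<And>t. t \<in> F ` I \<Longrightarrow> (H has_real_derivative E t) (at t)" "continuous_on (F ` I) E"
      using H(3) unfolding C1_differentiable_on_def has_real_derivative_iff_has_vector_derivative by blast
    obtain r0 where r0: "r0 > 0" "cball y r0 \<subseteq> F ` I" using opn yF open_contains_cball by blast
    have "bounded (E ` cball y r0)"
      by (rule compact_imp_bounded[OF compact_continuous_image[OF continuous_on_subset[OF E(2) r0(2)] compact_cball]])
    then obtain B where "\<forall>z\<in>E ` cball y r0. norm z \<le> B" unfolding bounded_iff by blast
    then have B: "\<And>t. t \<in> cball y r0 \<Longrightarrow> \<bar>E t\<bar> \<le> B" by simp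
    have gcont: "continuous_on K ?g" by (rule homeomorphism_cont1[OF homeo])
    \<comment> \<open>On \<open>V\<close> the global inverse takes values in \<open>I\<close>, so
      that on \<open>J \<inter> K\<close> it agrees with the local inverse \<open>H\<close>.\<close>
    obtain V where V: "open V" "V \<inter> K = ?g -` I \<inter> K"
      using gcont I(1) unfolding continuous_on_open_invariant by metis
    have "y \<in> V" using V(2) y I(2) by (auto simp: x_def)
    then obtain r1 where r1: "r1 > 0" "ball y r1 \<subseteq> V" using V(1) open_contains_ball by blast
    define J where "J = ball y (min r0 r1)"
    have J: "open J" "is_interval J" "y \<in> J" "J \<subseteq> F ` I" "J \<subseteq> V" "J \<subseteq> cball y r0" "convex J"
      using r0 r1 by (auto simp: J_def is_interval_ball_real)
    have homJ: "homeomorphism J (H ` J) H F" by (rule homeomorphism_inverse_restrict[OF H(1) J(4)])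
    have HJ: "H ` J \<subseteq> I" using J(4) HF by auto
    have "C1_diffeomorphism_on J H" unfolding C1_diffeomorphism_on_def
      using homJ C1_differentiable_on_subset[OF H(3) J(4)] C1_differentiable_on_subset[OF H(2) HJ] by blast
    moreover have "\<bar>B\<bar>-lipschitz_on J H"
    proof (rule lipschitz_onI)
      fix s t assume st: "s \<in> J" "t \<in> J"
      have "norm (H s - H t) \<le> \<bar>B\<bar> * norm (s - t)"
      proof (rule field_differentiable_bound[OF J(7) _ _ st])
        show "(H has_field_derivative E z) (at z within J)" if "z \<in> J" for z
          using E(1)[of z] J(4) that by (auto intro: has_field_derivative_at_within)
        show "norm (E z) \<le> \<bar>B\<bar>" if "z \<in> J" for z using B[of z] J(6) that by force
      qed
      then show "dist (H s) (H t) \<le> \<bar>B\<bar> * dist s t" by (simp add: dist_norm)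
    qed simp
    then have lip: "(L * \<bar>B\<bar>)-lipschitz_on J (\<lambda>t. ln \<bar>deriv F (H t)\<bar>)"
      using lipschitz_on_compose2[OF _ lipschitz_on_subset[OF I(4) HJ]] by blast
    have dH: "ln \<bar>deriv H t\<bar> = - ln \<bar>deriv F (H t)\<bar>" if t: "t \<in> J" for t
    proof -
      have Ht: "H t \<in> I" using HJ t by blast
      have "F (H t) = t" using homeomorphism_apply2[OF H(1)] J(4) t by auto
      then have "((\<lambda>x. H (F x)) has_real_derivative E t * deriv F (H t)) (at (H t))"
        using DERIV_chain2[of H "E t" F "H t" "deriv F (H t)"] E(1)[of t] J(4) t
          C1_diffeomorphism_on_deriv(2)[OF I(1,3) Ht] by auto
      then have "((\<lambda>x. x) has_real_derivative E t * deriv F (H t)) (at (H t))"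
        by (rule has_field_derivative_transform_within_open[OF _ I(1) Ht]) (use HF in simp)
      then have "E t * deriv F (H t) = 1" using DERIV_ident DERIV_unique by blast
      moreover have "deriv H t = E t" by (rule DERIV_imp_deriv[OF E(1)]) (use J(4) t in auto)
      ultimately have "\<bar>deriv H t\<bar> * \<bar>deriv F (H t)\<bar> = 1" by (metis abs_mult abs_one)
      moreover have "\<bar>deriv F (H t)\<bar> > 0" using C1_diffeomorphism_on_deriv(3)[OF I(1,3) Ht] by simp
      ultimately have "\<bar>deriv H t\<bar> = inverse \<bar>deriv F (H t)\<bar>" by (simp add: field_simps)
      then show ?thesis by (simp only: ln_inverse)
    qed
    have "(L * \<bar>B\<bar>)-lipschitz_on J (\<lambda>t. - ln \<bar>deriv F (H t)\<bar>)"
      using lip unfolding lipschitz_on_def by (simp add: dist_real_def abs_minus_commute)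
    then have "(L * \<bar>B\<bar>)-lipschitz_on J (\<lambda>t. ln \<bar>deriv H t\<bar>)"
      by (rule lipschitz_on_transform) (use dH in auto)
    moreover have "H t = ?g t" if t: "t \<in> J \<inter> K" for t
    proof -
      have "?g t \<in> I" using V(2) J(5) t by blast
      then have "H (F (?g t)) = ?g t" by (rule HF)
      moreover have "F (?g t) = t" using I(5)[of "?g t"] \<open>?g t \<in> I\<close> fg[of t] t by auto
      ultimately show ?thesis by simp
    qed
    ultimately show ?thesis using J(1-3) by blast
  qed
  have "?g \<in> Bij K" using fB by (rule restrict_inv_into_Bij)
  then show ?thesis unfolding diff_1Lip_def using homeo local by blast
qed

section \<open>The theorem\<close>

lemma mult_diff_1Lip:
  assumes "g \<in> diff_1Lip K" "f \<in> diff_1Lip K"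
  shows "mult (diff_1Lip_group K) g f = compose K g f"
  using assms by (simp add: diff_1Lip_group_def BijGroup_def diff_1Lip_def)

text \<open>The inverse of a monoid element is a definite description over the carrier; identifying
  it with the inverse map needs \<open>diff_1Lip_inverse\<close> for membership.\<close>

lemma inv_diff_1Lip:
  assumes f: "f \<in> diff_1Lip K"
  shows "inv\<^bsub>diff_1Lip_group K\<^esub> f = restrict (inv_into K f) K"
proof -
  interpret B: group "BijGroup K" by (rule group_BijGroup)
  let ?g = "restrict (inv_into K f) K"
  have g: "?g \<in> diff_1Lip K" by (rule diff_1Lip_inverse[OF f])
  have B: "h \<in> carrier (BijGroup K)" if "h \<in> diff_1Lip K" for h
    using that by (simp add: BijGroup_def diff_1Lip_def)
  have inv: "inv\<^bsub>BijGroup K\<^esub> f = ?g" using f by (intro inv_BijGroup) (simp add: diff_1Lip_def)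
  show ?thesis unfolding m_inv_def
  proof (rule the_equality)
    show "?g \<in> carrier (diff_1Lip_group K) \<and> f \<otimes>\<^bsub>diff_1Lip_group K\<^esub> ?g = \<one>\<^bsub>diff_1Lip_group K\<^esub> \<and>
      ?g \<otimes>\<^bsub>diff_1Lip_group K\<^esub> f = \<one>\<^bsub>diff_1Lip_group K\<^esub>"
      using g B.r_inv[OF B[OF f]] B.l_inv[OF B[OF f]] inv by (simp add: diff_1Lip_group_def)
    show "h = ?g" if h: "h \<in> carrier (diff_1Lip_group K) \<and> f \<otimes>\<^bsub>diff_1Lip_group K\<^esub> h = \<one>\<^bsub>diff_1Lip_group K\<^esub> \<and>
      h \<otimes>\<^bsub>diff_1Lip_group K\<^esub> f = \<one>\<^bsub>diff_1Lip_group K\<^esub>" for h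
      using h B.inv_equality[of h f] B[OF f] B[of h] inv by (simp add: diff_1Lip_group_def)
  qed
qed

lemma lip_action_diff_1Lip:
  assumes K: "cantor_set K" and G: "subgroup G (diff_1Lip_group K)"
  shows "lip_action ((diff_1Lip_group K)\<lparr>carrier := G\<rparr>) K (\<lambda>g x. g x)"
proof -
  let ?G = "(diff_1Lip_group K)\<lparr>carrier := G\<rparr>"
  have compK: "compact K" using K by (simp add: cantor_set_def)
  have GD: "g \<in> diff_1Lip K" if "g \<in> G" for g
    using subgroup.subset[OF G] that by (auto simp: diff_1Lip_group_def)
  have GB: "g \<in> Bij K" if "g \<in> G" for g using GD[OF that] by (simp add: diff_1Lip_def)
  have maps: "g x \<in> K" if "g \<in> G" "x \<in> K" for g x
    using Bij_imp_funcset[OF GB[OF that(1)]] that(2) by auto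
  have mult: "g \<otimes>\<^bsub>?G\<^esub> h = compose K g h" if "g \<in> G" "h \<in> G" for g h
    using mult_diff_1Lip[OF GD[OF that(1)] GD[OF that(2)]] by simp
  have one: "\<one>\<^bsub>?G\<^esub> = (\<lambda>x\<in>K. x)" by (simp add: diff_1Lip_group_def BijGroup_def)
  have grp: "group ?G"
  proof (rule groupI)
    show "x \<otimes>\<^bsub>?G\<^esub> y \<in> carrier ?G" if "x \<in> carrier ?G" "y \<in> carrier ?G" for x y
      using that subgroup.m_closed[OF G] by simp
    then have cl: "compose K x y \<in> G" if "x \<in> G" "y \<in> G" for x y using that mult by simp
    show "\<one>\<^bsub>?G\<^esub> \<in> carrier ?G" using subgroup.one_closed[OF G] by simp
    show "x \<otimes>\<^bsub>?G\<^esub> y \<otimes>\<^bsub>?G\<^esub> z = x \<otimes>\<^bsub>?G\<^esub> (y \<otimes>\<^bsub>?G\<^esub> z)"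
      if "x \<in> carrier ?G" "y \<in> carrier ?G" "z \<in> carrier ?G" for x y z
      using that cl mult compose_assoc[OF Bij_imp_funcset[OF GB[of z]], of x y] by simp
    show "\<one>\<^bsub>?G\<^esub> \<otimes>\<^bsub>?G\<^esub> x = x" if "x \<in> carrier ?G" for x
      using that mult[of "\<one>\<^bsub>?G\<^esub>" x] subgroup.one_closed[OF G] one GB[of x]
      by (simp add: Bij_imp_funcset Bij_imp_extensional)
    show "\<exists>y\<in>carrier ?G. y \<otimes>\<^bsub>?G\<^esub> x = \<one>\<^bsub>?G\<^esub>" if "x \<in> carrier ?G" for x
    proof
      have x: "x \<in> G" using that by simp
      have y: "restrict (inv_into K x) K \<in> G"
        using subgroup.m_inv_closed[OF G x] inv_diff_1Lip[OF GD[OF x]] by simp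
      then show "restrict (inv_into K x) K \<in> carrier ?G" by simp
      show "restrict (inv_into K x) K \<otimes>\<^bsub>?G\<^esub> x = \<one>\<^bsub>?G\<^esub>"
        unfolding mult[OF y x] one by (rule Bij_compose_restrict_eq[OF GB[OF x]])
    qed
  qed
  interpret group ?G by (rule grp)
  show ?thesis
  proof unfold_locales
    show "compact K" by (rule compK)
    show "\<exists>t. a < t \<and> t < b \<and> t \<notin> K" if ab: "a \<in> K" "b \<in> K" "a < b" for a b
    proof (rule ccontr)
      assume "\<not> ?thesis"
      then have "{a..b} \<subseteq> K" using ab by (force simp: le_less)
      then have "{a..b} \<subseteq> connected_component_set K a"
        using ab by (intro connected_component_maximal) auto
      moreover have "connected_component_set K a = {a}"
        using K ab(1) by (auto simp: cantor_set_def totally_disconnected_def)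
      ultimately have "{a..b} \<subseteq> {a}" by simp
      moreover have "b \<in> {a..b}" using ab(3) by simp
      ultimately show False using ab(3) by blast
    qed
    show "continuous_on K g" if "g \<in> carrier ?G" for g
    proof -
      have "g \<in> diff_1Lip K" using GD that by simp
      then obtain g' where "homeomorphism K K g g'" unfolding diff_1Lip_def by blast
      then show ?thesis by (rule homeomorphism_cont1)
    qed
    show "tame K g" if "g \<in> carrier ?G" for g
      by (rule diff_1Lip_tame[OF compK GD]) (use that in simp)
  qed (use maps mult one in \<open>auto simp: compose_def\<close>)
qed

theorem theorem1p8:
  fixes K :: "real set" and G :: "(real \<Rightarrow> real) set"
  assumes "cantor_set K"
    and "subgroup G (diff_1Lip_group K)"
    and "finitely_generated_group ((diff_1Lip_group K)\<lparr>carrier := G\<rparr>)"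
    and "\<not> contains_free_subsemigroup_2 ((diff_1Lip_group K)\<lparr>carrier := G\<rparr>)"
  shows "virtually_abelian ((diff_1Lip_group K)\<lparr>carrier := G\<rparr>)"
proof -
  define \<Gamma> where "\<Gamma> = (diff_1Lip_group K)\<lparr>carrier := G\<rparr>"
  interpret lip_action \<Gamma> K "\<lambda>g x. g x"
    unfolding \<Gamma>_def by (rule lip_action_diff_1Lip[OF assms(1,2)])
  obtain H where H: "fin_index \<Gamma> H"
    and comm: "\<And>g h t. g \<in> H \<Longrightarrow> h \<in> H \<Longrightarrow> t \<in> K \<Longrightarrow> (g \<otimes>\<^bsub>\<Gamma>\<^esub> h) t = (h \<otimes>\<^bsub>\<Gamma>\<^esub> g) t"
    using virtually_commuting[OF assms(3,4)[folded \<Gamma>_def]] by blast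
  have sH: "subgroup H \<Gamma>" using H by (simp add: fin_index_def)
  have ext: "g \<in> extensional K" if "g \<in> carrier \<Gamma>" for g
    using that subgroup.subset[OF assms(2)]
    by (auto simp: \<Gamma>_def diff_1Lip_group_def diff_1Lip_def Bij_def)
  \<comment> \<open>Products are \<open>undefined\<close> outside \<open>K\<close>, so agreement at
    the points of \<open>K\<close> is equality in the group.\<close>
  have "g \<otimes>\<^bsub>\<Gamma>\<^esub> h = h \<otimes>\<^bsub>\<Gamma>\<^esub> g" if gh: "g \<in> H" "h \<in> H" for g h
  proof (rule extensionalityI[of _ K])
    show "g \<otimes>\<^bsub>\<Gamma>\<^esub> h \<in> extensional K" "h \<otimes>\<^bsub>\<Gamma>\<^esub> g \<in> extensional K"
      using gh subgroup.mem_carrier[OF sH] by (auto intro: ext)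
  qed (rule comm[OF gh])
  then have "comm_group (\<Gamma>\<lparr>carrier := H\<rparr>)"
    by (intro group.group_comm_groupI[OF subgroup_imp_group[OF sH]]) simp
  then have "virtually_abelian \<Gamma>"
    using H unfolding virtually_abelian_def fin_index_def by blast
  then show ?thesis by (simp add: \<Gamma>_def)
qed

end
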